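(* Let $\mathcal{L} \subset \mathbb{S}^n$ be a regular linear subspace of codimension at least two, and let $S \in \mathbb{P}\mathbb{S}^n$ be generic. Let $\mathcal{G}_S := \{\ell \in \mathrm{Gr}(1,\mathbb{P}\mathbb{S}^n) \mid S \in \ell\}$ and $$\mathcal{J} := \overline{\{\ell \in \mathrm{Gr}(1,\mathbb{P}\mathbb{S}^n) \mid \exists (\Sigma,\Gamma) \in L^{-1}\times L^\perp : \Sigma \neq \Gamma,\ \Sigma \in \ell,\ \Gamma \in \ell\}}.$$ Then the ML degree of $\mathcal{L}$ equals $|\mathcal{J} \cap \mathcal{G}_S|$.
   Context: $\mathbb{S}^n$ denotes the space of complex symmetric $n\times n$ matrices, with the bilinear pairing $\langle K,\Sigma\rangle = \mathrm{tr}(K\Sigma)$, and $\mathbb{P}\mathbb{S}^n$ its projectivization. A linear subspace $\mathcal{L}\subseteq\mathbb{S}^n$ is regular if it contains a matrix of full rank. Its polar space is $\mathcal{L}^\perp = \{\Sigma \in \mathbb{S}^n : \mathrm{tr}(K\Sigma)=0 \ \forall K\in\mathcal{L}\}$. The reciprocal variety $\mathcal{L}^{-1}$ is the Zariski closure in $\mathbb{S}^n$ of the set of inverses of the invertible matrices in $\mathcal{L}$. The maximum likelihood (ML) degree of $\mathcal{L}$ is the number of matrices in $\mathcal{L}^{-1}\cap(\mathcal{L}^\perp + S)$ for generic $S\in\mathbb{S}^n$. $L^{-1}$ and $L^\perp$ denote the projectivizations of $\mathcal{L}^{-1}$ and $\mathcal{L}^\perp$ in $\mathbb{P}\mathbb{S}^n$.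 $\mathrm{Gr}(1,\mathbb{P}\mathbb{S}^n)$ is the Grassmannian of lines in $\mathbb{P}\mathbb{S}^n$. *)

theory Defs
  imports "HOL-Analysis.Analysis"
begin

inductive_set poly_fun :: "(('i \<Rightarrow> complex) \<Rightarrow> complex) set" where
  pconst: "(\<lambda>x. c) \<in> poly_fun"
| pvar: "(\<lambda>x. x i) \<in> poly_fun"
| padd: "p \<in> poly_fun \<Longrightarrow> q \<in> poly_fun \<Longrightarrow> (\<lambda>x. p x + q x) \<in> poly_fun"
| pmult: "p \<in> poly_fun \<Longrightarrow> q \<in> poly_fun \<Longrightarrow> (\<lambda>x. p x * q x) \<in> poly_fun"

definition zariski_closed :: "('i \<Rightarrow> complex) set \<Rightarrow> bool" where
  "zariski_closed A \<longleftrightarrow> (\<exists>P \<subseteq> poly_fun. A = {x. \<forall>p\<in>P. p x = 0})"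

definition zariski_closure :: "('i \<Rightarrow> complex) set \<Rightarrow> ('i \<Rightarrow> complex) set" where
  "zariski_closure A = \<Inter>{C. zariski_closed C \<and> A \<subseteq> C}"

definition mat_coords :: "complex^'n^'n \<Rightarrow> ('n \<times> 'n \<Rightarrow> complex)" where
  "mat_coords M = (\<lambda>(i,j). M$i$j)"

definition mat_zariski_closure :: "(complex^'n^'n) set \<Rightarrow> (complex^'n^'n) set" where
  "mat_zariski_closure A = {M. mat_coords M \<in> zariski_closure (mat_coords ` A)}"

definition mscale :: "complex \<Rightarrow> complex^'n^'n \<Rightarrow> complex^'n^'n" where
  "mscale c M = (\<chi> i j. c * M$i$j)"

interpretation cmat: vector_space "mscale :: complex \<Rightarrow> complex^'n^'n \<Rightarrow> complex^'n^'n"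
  by unfold_locales (simp_all add: mscale_def vec_eq_iff algebra_simps)

definition symmat :: "(complex^'n^'n) set" where
  "symmat = {M. transpose M = M}"

definition lin_subspace_sym :: "(complex^'n^'n) set \<Rightarrow> bool" where
  "lin_subspace_sym L \<longleftrightarrow> cmat.subspace L \<and> L \<subseteq> symmat"

definition regular_subspace :: "(complex^'n^'n) set \<Rightarrow> bool" where
  "regular_subspace L \<longleftrightarrow> (\<exists>K\<in>L. invertible K)"

definition polar_space :: "(complex^'n^'n) set \<Rightarrow> (complex^'n^'n) set" where
  "polar_space L = {\<Sigma>\<in>symmat. \<forall>K\<in>L. trace (K ** \<Sigma>) = 0}"

definition reciprocal_variety :: "(complex^'n^'n) set \<Rightarrow> (complex^'n^'n) set" where
  "reciprocal_variety L = mat_zariski_closure {matrix_inv K | K. K \<in> L \<and> invertible K}"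

definition nonempty_open_in_sym :: "(complex^'n^'n) set \<Rightarrow> bool" where
  "nonempty_open_in_sym U \<longleftrightarrow> U \<noteq> {} \<and>
     (\<exists>C. zariski_closed C \<and> U = {M\<in>symmat. mat_coords M \<notin> C})"

definition ml_fibre :: "(complex^'n^'n) set \<Rightarrow> complex^'n^'n \<Rightarrow> (complex^'n^'n) set" where
  "ml_fibre L S = reciprocal_variety L \<inter> {\<Gamma> + S | \<Gamma>. \<Gamma> \<in> polar_space L}"

definition ml_degree :: "(complex^'n^'n) set \<Rightarrow> nat" where
  "ml_degree L = (THE d. \<exists>U. nonempty_open_in_sym U \<and>
       (\<forall>S\<in>U. finite (ml_fibre L S) \<and> card (ml_fibre L S) = d))"

text \<open>A line in P S^n is a 2-dimensional linear subspace of S^n.\<close>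
definition is_line :: "(complex^'n^'n) set \<Rightarrow> bool" where
  "is_line W \<longleftrightarrow> cmat.subspace W \<and> W \<subseteq> symmat \<and> cmat.dim W = 2"

text \<open>Two nonzero matrices give distinct points of projective space iff they are
  linearly independent.\<close>
definition indep_pair :: "complex^'n^'n \<Rightarrow> complex^'n^'n \<Rightarrow> bool" where
  "indep_pair u v \<longleftrightarrow> u \<noteq> v \<and> \<not> cmat.dependent {u, v}"

definition pluecker :: "complex^'n^'n \<Rightarrow> complex^'n^'n \<Rightarrow> (('n \<times> 'n) \<times> ('n \<times> 'n) \<Rightarrow> complex)" where
  "pluecker u v = (\<lambda>((a,b),(c,d)). u$a$b * v$c$d - u$c$d * v$a$b)"

text \<open>Zariski closure in the Grassmannian of lines (via the Pluecker embedding: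
  a line lies in the closure iff its Pluecker vector lies in the Zariski closure of
  the affine cone over the Pluecker image of the given set of lines).\<close>
definition line_closure :: "(complex^'n^'n) set set \<Rightarrow> (complex^'n^'n) set set" where
  "line_closure \<A> = {W. is_line W \<and>
     (\<forall>u v. u \<in> W \<and> v \<in> W \<and> indep_pair u v \<longrightarrow>
        pluecker u v \<in> zariski_closure
          {pluecker u' v' | u' v'. indep_pair u' v' \<and> cmat.span {u', v'} \<in> \<A>})}"

definition lines_through :: "complex^'n^'n \<Rightarrow> (complex^'n^'n) set set" where
  "lines_through S = {W. is_line W \<and> S \<in> W}"

definition J_lines :: "(complex^'n^'n) set \<Rightarrow> (complex^'n^'n) set set" where
  "J_lines L = line_closure {W. is_line W \<and>
     (\<exists>\<Sigma> \<Gamma>. \<Sigma> \<in> reciprocal_variety L \<and> \<Sigma> \<noteq> 0 \<and> \<Gamma> \<in> polar_space L \<and> \<Gamma> \<noteq> 0 \<and>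
        indep_pair \<Sigma> \<Gamma> \<and> \<Sigma> \<in> W \<and> \<Gamma> \<in> W)}"

end

theory Submission
  imports Defs "HOL-Computational_Algebra.Fundamental_Theorem_Algebra"
begin

text \<open>
  Write \<open>X\<close> for the reciprocal variety and \<open>H\<close> for the polar space.  Pairing with a basis of
  \<open>L\<close> projects symmetric matrices onto \<open>k\<close>-space with kernel \<open>H\<close>, and the ML degree counts the
  points of \<open>X\<close> in a generic fibre of this projection.  Either the projection of \<open>X\<close> satisfies a
  polynomial relation, and then both counts are zero, or it is dominant.  In the dominant case let
  \<open>Q(s, t, y)\<close> be a relation of minimal \<open>y\<close>-degree \<open>d\<close> satisfied by \<open>y = t(x)\<close>, where \<open>t\<close> is a linear
  form with indeterminate coefficients and \<open>s\<close> is the projection of \<open>x \<in> X\<close>.  Differentiating with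
  respect to \<open>t\<close> (Kronecker) recovers the coordinates of \<open>x\<close> as \<open>-Q\<^sub>t / Q\<^sub>y\<close>, so a generic
  fibre is in bijection with the \<open>d\<close> simple roots of \<open>Q(s, t, -)\<close>.

  A line through a generic \<open>S\<close> that meets \<open>X\<close> and \<open>H\<close> contains a point of \<open>X\<close> in the fibre of \<open>S\<close>.
  Only one such point lies on the line: \<open>H\<close> has dimension at least two, so every \<open>t\<close> kills
  some direction of \<open>H\<close>, and \<open>Q\<^sub>y \<noteq> 0\<close> separates the points.  No further lines appear in the
  closure, because \<open>\<Prod>\<^sub>x (y - t(x))\<close>, taken over the fibre, is polynomial in \<open>(s, t, y)\<close> up to a
  factor depending on \<open>s\<close> only; evaluated at forms \<open>t\<close> that kill the direction of the line, it gives
  polynomial equations in the Pluecker coordinates.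
\<close>

section \<open>Algebras of functions and generically finite covers\<close>


text \<open>Two difficulties shape the argument. The cones \<open>X\<close> and \<open>H\<close> may
  meet outside the origin, so in a limit of joining lines the two points may come together, and
  points of a fibre may run off to infinity; little can be read off a limit of points. The join is
  therefore described by polynomial equations, which pass to Zariski closures by themselves:
  contracting the Pluecker vector of a line with a linear form returns a point of that line
  polynomially. The second difficulty is to count fibres by elementary means. As the inverses are
  parametrised by \<open>a \<mapsto> num a / \<delta> a\<close>, functions on \<open>X\<close> are
  pulled back to the complement of \<open>\<delta> = 0\<close> in \<open>k\<close>-space, where
  products of nonzero functions are visibly nonzero; algebraicity over the base comes from comparing
  numbers of unknowns and equations; relations of least degree stand in for irreducible polynomials.
  Codimension two is essential: if \<open>H\<close> were spanned by one matrix, every point of a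
  fibre would lie on the single line through \<open>S\<close> and that matrix, and a fibre of any
  size would be counted once.\<close>

text \<open>Polynomials are handled as functions, so a coordinate ring is a set of functions closed
  under the ring operations; over the infinite field of complex numbers this loses nothing. The
  notion covers \<open>poly_fun\<close>, the localisation \<open>PW\<close> and the polynomials in
  one parameter alike.\<close>

definition fun_algebra :: "('w \<Rightarrow> complex) set \<Rightarrow> bool" where
  "fun_algebra R \<longleftrightarrow> (\<forall>c. (\<lambda>_. c) \<in> R) \<and> (\<forall>f\<in>R. \<forall>g\<in>R. (\<lambda>w. f w + g w) \<in> R \<and> (\<lambda>w. f w * g w) \<in> R)"

lemma fa_const: "fun_algebra R \<Longrightarrow> (\<lambda>_. c) \<in> R"
  and fa_add: "fun_algebra R \<Longrightarrow> f \<in> R \<Longrightarrow> g \<in> R \<Longrightarrow> (\<lambda>w. f w + g w) \<in> R"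
  and fa_mult: "fun_algebra R \<Longrightarrow> f \<in> R \<Longrightarrow> g \<in> R \<Longrightarrow> (\<lambda>w. f w * g w) \<in> R"
  by (auto simp: fun_algebra_def)

lemma fa_sum: "fun_algebra R \<Longrightarrow> (\<And>i. i \<in> A \<Longrightarrow> (\<lambda>w. f i w) \<in> R) \<Longrightarrow> (\<lambda>w. \<Sum>i\<in>A. f i w) \<in> R"
  by (induction A rule: infinite_finite_induct) (auto intro: fa_const fa_add)

lemma fa_prod: "fun_algebra R \<Longrightarrow> (\<And>i. i \<in> A \<Longrightarrow> (\<lambda>w. f i w) \<in> R) \<Longrightarrow> (\<lambda>w. \<Prod>i\<in>A. f i w) \<in> R"
  by (induction A rule: infinite_finite_induct) (auto intro: fa_const fa_mult)

lemma fa_power: "fun_algebra R \<Longrightarrow> f \<in> R \<Longrightarrow> (\<lambda>w. f w ^ n) \<in> R"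
  by (induction n) (auto intro: fa_const fa_mult)

lemma fa_uminus: "fun_algebra R \<Longrightarrow> f \<in> R \<Longrightarrow> (\<lambda>w. - f w) \<in> R"
  using fa_mult[OF _ fa_const[of R "-1"], of f] by simp

lemma fa_diff: "fun_algebra R \<Longrightarrow> f \<in> R \<Longrightarrow> g \<in> R \<Longrightarrow> (\<lambda>w. f w - g w) \<in> R"
  using fa_add[of R f "\<lambda>w. - g w"] fa_uminus[of R g] by simp

lemma fun_algebra_poly_fun: "fun_algebra (poly_fun :: (('i \<Rightarrow> complex) \<Rightarrow> complex) set)"
  by (auto simp: fun_algebra_def intro: poly_fun.intros)

lemmas pf_sum = fa_sum[OF fun_algebra_poly_fun]
  and pf_prod = fa_prod[OF fun_algebra_poly_fun]
  and pf_power = fa_power[OF fun_algebra_poly_fun]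
  and pf_uminus = fa_uminus[OF fun_algebra_poly_fun]
  and pf_diff = fa_diff[OF fun_algebra_poly_fun]

lemmas pf_intros = pconst pvar padd pmult pf_sum pf_prod pf_power pf_uminus pf_diff

lemma poly_fun_subst:
  assumes "p \<in> poly_fun" "fun_algebra R" "\<And>i. (\<lambda>w. F w i) \<in> R"
  shows "(\<lambda>w. p (F w)) \<in> R"
  using assms(1) by induction (auto intro: fa_const fa_add fa_mult assms)

lemmas pf_subst = poly_fun_subst[OF _ fun_algebra_poly_fun]

lemma fun_algebra_poly: "fun_algebra {f. \<exists>P. \<forall>\<tau>. f \<tau> = poly P \<tau>}"
  unfolding fun_algebra_def
proof (intro conjI allI ballI)
  fix c :: complex
  show "(\<lambda>_. c) \<in> {f. \<exists>P. \<forall>\<tau>. f \<tau> = poly P \<tau>}" by (auto intro: exI[of _ "[:c:]"])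
next
  fix f g :: "complex \<Rightarrow> complex"
  assume "f \<in> {f. \<exists>P. \<forall>\<tau>. f \<tau> = poly P \<tau>}" "g \<in> {f. \<exists>P. \<forall>\<tau>. f \<tau> = poly P \<tau>}"
  then obtain P Q where "\<forall>\<tau>. f \<tau> = poly P \<tau>" "\<forall>\<tau>. g \<tau> = poly Q \<tau>" by auto
  then show "(\<lambda>w. f w + g w) \<in> {f. \<exists>P. \<forall>\<tau>. f \<tau> = poly P \<tau>}"
    "(\<lambda>w. f w * g w) \<in> {f. \<exists>P. \<forall>\<tau>. f \<tau> = poly P \<tau>}"
    by (auto intro: exI[of _ "P + Q"] exI[of _ "P * Q"])
qed

lemma poly_fun_line:
  assumes "p \<in> poly_fun"
  obtains P where "\<And>\<tau>. p (\<lambda>i. x i + \<tau> * y i) = poly P \<tau>"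
proof -
  have "(\<lambda>\<tau>. p (\<lambda>i. x i + \<tau> * y i)) \<in> {f. \<exists>P. \<forall>\<tau>. f \<tau> = poly P \<tau>}"
  proof (rule poly_fun_subst[OF assms fun_algebra_poly])
    fix i
    have "\<forall>\<tau>. x i + \<tau> * y i = poly [:x i, y i:] \<tau>" by simp
    then show "(\<lambda>\<tau>. x i + \<tau> * y i) \<in> {f. \<exists>P. \<forall>\<tau>. f \<tau> = poly P \<tau>}" by blast
  qed
  then show ?thesis using that by auto
qed

text \<open>Irreducibility of \<open>\<Omega>\<close> in terms of functions. Elements of
  \<open>R\<close> that agree on \<open>\<Omega>\<close> are not identified, so being zero has to
  mean vanishing on \<open>\<Omega>\<close>.\<close>

definition fun_domain :: "'w set \<Rightarrow> ('w \<Rightarrow> complex) set \<Rightarrow> bool" where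
  "fun_domain \<Omega> R \<longleftrightarrow> (\<forall>f\<in>R. \<forall>g\<in>R. (\<exists>w\<in>\<Omega>. f w \<noteq> 0) \<longrightarrow> (\<exists>w\<in>\<Omega>. g w \<noteq> 0) \<longrightarrow> (\<exists>w\<in>\<Omega>. f w * g w \<noteq> 0))"

lemma fun_domainD:
  assumes "fun_domain \<Omega> R" "f \<in> R" "g \<in> R" "w \<in> \<Omega>" "f w \<noteq> 0" "w' \<in> \<Omega>" "g w' \<noteq> 0"
  obtains z where "z \<in> \<Omega>" "f z \<noteq> 0" "g z \<noteq> 0"
proof -
  have "\<exists>w\<in>\<Omega>. f w * g w \<noteq> 0"
    using assms(1)[unfolded fun_domain_def, rule_format, OF assms(2,3)] assms(4-7) by blast
  then show ?thesis using that by auto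
qed

lemma fun_domain_prod:
  assumes "fun_domain \<Omega> R" "fun_algebra R" "finite A" "\<Omega> \<noteq> {}" "\<And>i. i \<in> A \<Longrightarrow> f i \<in> R"
    "\<And>i. i \<in> A \<Longrightarrow> \<exists>w\<in>\<Omega>. f i w \<noteq> 0"
  shows "\<exists>w\<in>\<Omega>. (\<Prod>i\<in>A. f i w) \<noteq> 0"
  using assms(3,5,6)
proof (induction A)
  case empty
  then show ?case using assms(4) by auto
next
  case (insert i A)
  have "\<exists>w\<in>\<Omega>. (\<Prod>i\<in>A. f i w) \<noteq> 0" using insert by auto
  moreover have "\<exists>w\<in>\<Omega>. f i w \<noteq> 0" using insert by auto
  moreover have "(\<lambda>w. \<Prod>i\<in>A. f i w) \<in> R" using insert assms(2) by (intro fa_prod) auto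
  moreover have "f i \<in> R" using insert by auto
  ultimately have "\<exists>w\<in>\<Omega>. f i w * (\<Prod>i\<in>A. f i w) \<noteq> 0"
    using assms(1)[unfolded fun_domain_def, rule_format, of "f i" "\<lambda>w. \<Prod>i\<in>A. f i w"] by simp
  then show ?case using insert by simp
qed

definition affine_closed :: "('i \<Rightarrow> complex) set \<Rightarrow> bool" where
  "affine_closed A \<longleftrightarrow> (\<forall>x\<in>A. \<forall>y\<in>A. \<forall>\<tau>. (\<lambda>i. x i + \<tau> * (y i - x i)) \<in> A)"

text \<open>On the line joining a point where \<open>f\<close> is nonzero to a point where
  \<open>g\<close> is nonzero, both restrict to nonzero polynomials in one variable, and so does
  their product.\<close>

lemma poly_fun_domain:
  fixes A :: "('i \<Rightarrow> complex) set"
  assumes A: "affine_closed A"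
  shows "fun_domain A poly_fun"
  unfolding fun_domain_def
proof (intro ballI impI)
  fix f g :: "('i \<Rightarrow> complex) \<Rightarrow> complex"
  assume fg: "f \<in> poly_fun" "g \<in> poly_fun"
    and "\<exists>w\<in>A. f w \<noteq> 0" "\<exists>w\<in>A. g w \<noteq> 0"
  then obtain x y where xy: "x \<in> A" "f x \<noteq> 0" "y \<in> A" "g y \<noteq> 0" by blast
  let ?l = "\<lambda>\<tau> i. x i + \<tau> * (y i - x i)"
  obtain P where P: "\<And>\<tau>. f (?l \<tau>) = poly P \<tau>" using poly_fun_line[OF fg(1), where y="\<lambda>i. y i - x i"] by blast
  obtain Q where Q: "\<And>\<tau>. g (?l \<tau>) = poly Q \<tau>" using poly_fun_line[OF fg(2), where y="\<lambda>i. y i - x i"] by blast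
  have "P \<noteq> 0" using P[of 0] xy by auto
  moreover have "Q \<noteq> 0" using Q[of 1] xy by auto
  ultimately have "P * Q \<noteq> 0" by simp
  then obtain \<tau> where "poly (P * Q) \<tau> \<noteq> 0" using poly_all_0_iff_0 by blast
  then have "f (?l \<tau>) * g (?l \<tau>) \<noteq> 0" by (simp add: P Q)
  then show "\<exists>w\<in>A. f w * g w \<noteq> 0" using A xy unfolding affine_closed_def by blast
qed

section \<open>Polynomials in one variable over an algebra of functions\<close>

text \<open>A model of \<open>R[y]\<close> by functions. The degree may drop at individual points
  \<open>b\<close>, so a uniform bound is part of the definition; it makes evaluation at
  \<open>y\<close> one fixed finite sum.\<close>

definition cpoly :: "('b \<Rightarrow> complex) set \<Rightarrow> ('b \<Rightarrow> complex poly) set" where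
  "cpoly R = {F. (\<forall>j. (\<lambda>b. coeff (F b) j) \<in> R) \<and> (\<exists>e. \<forall>b. degree (F b) \<le> e)}"

lemma poly_as_sum_le: "degree (p :: 'a :: comm_semiring_1 poly) \<le> e \<Longrightarrow> poly p y = (\<Sum>j\<le>e. coeff p j * y ^ j)"
  unfolding poly_altdef
  by (rule sum.mono_neutral_left) (auto simp: coeff_eq_0)

context
  fixes R :: "('b \<Rightarrow> complex) set"
  assumes R: "fun_algebra R"
begin

lemma cpoly_add: "F \<in> cpoly R \<Longrightarrow> G \<in> cpoly R \<Longrightarrow> (\<lambda>b. F b + G b) \<in> cpoly R"
proof -
  assume F: "F \<in> cpoly R" and G: "G \<in> cpoly R"
  obtain e1 e2 where "\<forall>b. degree (F b) \<le> e1" "\<forall>b. degree (G b) \<le> e2" using F G by (auto simp: cpoly_def)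
  then have "\<forall>b. degree (F b + G b) \<le> max e1 e2" by (meson degree_add_le_max max.mono order_trans)
  then show ?thesis using F G R by (auto simp: cpoly_def intro!: fa_add)
qed

lemma cpoly_mult: "F \<in> cpoly R \<Longrightarrow> G \<in> cpoly R \<Longrightarrow> (\<lambda>b. F b * G b) \<in> cpoly R"
proof -
  assume F: "F \<in> cpoly R" and G: "G \<in> cpoly R"
  obtain e1 e2 where "\<forall>b. degree (F b) \<le> e1" "\<forall>b. degree (G b) \<le> e2" using F G by (auto simp: cpoly_def)
  then have "\<forall>b. degree (F b * G b) \<le> e1 + e2" by (meson add_mono degree_mult_le order_trans)
  then show ?thesis using F G R by (auto simp: cpoly_def coeff_mult intro!: fa_sum fa_mult)
qed

lemma cpoly_const: "f \<in> R \<Longrightarrow> (\<lambda>b. [:f b:]) \<in> cpoly R"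
proof -
  assume f: "f \<in> R"
  have "(\<lambda>b. coeff [:f b:] j) \<in> R" for j
    using f fa_const[OF R] by (cases j) simp_all
  then show ?thesis by (auto simp: cpoly_def)
qed

lemma cpoly_fixed: "(\<lambda>b. P) \<in> cpoly R"
  using fa_const[OF R] by (auto simp: cpoly_def)

lemma cpoly_smult: "f \<in> R \<Longrightarrow> G \<in> cpoly R \<Longrightarrow> (\<lambda>b. smult (f b) (G b)) \<in> cpoly R"
  using cpoly_mult[OF cpoly_const] by force

lemma cpoly_diff: "F \<in> cpoly R \<Longrightarrow> G \<in> cpoly R \<Longrightarrow> (\<lambda>b. F b - G b) \<in> cpoly R"
  using cpoly_add[of F "\<lambda>b. smult (-1) (G b)"] cpoly_smult[OF fa_const[OF R], of G "-1"] by simp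

lemma cpoly_uminus: "G \<in> cpoly R \<Longrightarrow> (\<lambda>b. - G b) \<in> cpoly R"
  using cpoly_smult[OF fa_const[OF R], of G "-1"] by simp

lemma cpoly_sum: "(\<And>i. i \<in> A \<Longrightarrow> F i \<in> cpoly R) \<Longrightarrow> (\<lambda>b. \<Sum>i\<in>A. F i b) \<in> cpoly R"
  by (induction A rule: infinite_finite_induct) (auto intro: cpoly_fixed cpoly_add)

lemma cpoly_power: "F \<in> cpoly R \<Longrightarrow> (\<lambda>b. F b ^ n) \<in> cpoly R"
  by (induction n) (auto intro: cpoly_fixed cpoly_mult)

lemma cpoly_pderiv: "F \<in> cpoly R \<Longrightarrow> (\<lambda>b. pderiv (F b)) \<in> cpoly R"
proof -
  assume F: "F \<in> cpoly R"
  then obtain e where "\<forall>b. degree (F b) \<le> e" by (auto simp: cpoly_def)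
  then have "\<forall>b. degree (pderiv (F b)) \<le> e" by (metis degree_pderiv diff_le_self order_trans)
  then show ?thesis using F R by (auto simp: cpoly_def coeff_pderiv intro!: fa_mult fa_const)
qed

lemma cpoly_coeff: "F \<in> cpoly R \<Longrightarrow> (\<lambda>b. coeff (F b) j) \<in> R"
  by (auto simp: cpoly_def)

lemma cpoly_degree:
  assumes "F \<in> cpoly R" obtains e where "\<And>b. degree (F b) \<le> e"
  using assms by (auto simp: cpoly_def)

lemma cpoly_eval:
  assumes "F \<in> cpoly R" "fun_algebra S" "\<And>p. p \<in> R \<Longrightarrow> (\<lambda>w. p (\<pi> w)) \<in> S" "f \<in> S"
  shows "(\<lambda>w. poly (F (\<pi> w)) (f w)) \<in> S"
proof -
  obtain e where e: "\<And>b. degree (F b) \<le> e" using cpoly_degree[OF assms(1)] by blast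
  have "(\<lambda>w. \<Sum>j\<le>e. coeff (F (\<pi> w)) j * f w ^ j) \<in> S"
    by (intro fa_sum fa_mult fa_power assms(2,4) assms(3)[OF cpoly_coeff[OF assms(1)]])
  then show ?thesis using poly_as_sum_le[OF e] by simp
qed

end

text \<open>A division step multiplies by the coefficient \<open>coeff (Q b) d\<close> instead of
  dividing by it, since it may vanish at some \<open>b\<close>. The induction runs over a degree
  bound for \<open>G\<close> common to all of \<open>\<BB>\<close>, so one exponent \<open>M\<close>
  serves every \<open>b\<close>.\<close>

lemma pseudo_division:
  assumes R: "fun_algebra R" and Q: "Q \<in> cpoly R" and degQ: "\<forall>b\<in>\<BB>. degree (Q b) \<le> d" and "d > 0"
    and G: "G \<in> cpoly R"
  shows "\<exists>M H P. H \<in> cpoly R \<and> P \<in> cpoly R \<and> (\<forall>b\<in>\<BB>. degree (P b) < d \<and> smult (coeff (Q b) d ^ M) (G b) = Q b * H b + P b)"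
proof -
  obtain e where "\<forall>b\<in>\<BB>. degree (G b) < e" using cpoly_degree[OF R G] by (metis less_Suc_eq_le)
  then show ?thesis using G
  proof (induction e arbitrary: G)
    case 0
    then show ?case using cpoly_fixed[OF R, of 0] by (metis less_nat_zero_code)
  next
    case (Suc e)
    show ?case
    proof (cases "e < d")
      case True
      then have "\<forall>b\<in>\<BB>. degree (G b) < d" using Suc by auto
      then show ?thesis using Suc cpoly_fixed[OF R, of 0] by (intro exI[of _ 0] exI[of _ "\<lambda>_. 0"] exI[of _ G]) auto
    next
      case False
      let ?c = "\<lambda>b. coeff (Q b) d"
      let ?T = "\<lambda>b. monom (coeff (G b) e) (e - d)"
      have T: "?T \<in> cpoly R"
        using cpoly_mult[OF R cpoly_const[OF R cpoly_coeff[OF R Suc.prems(2), of e]] cpoly_fixed[OF R, of "monom 1 (e-d)"]]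
        by (simp add: smult_monom)
      define G' where "G' = (\<lambda>b. smult (?c b) (G b) - Q b * ?T b)"
      have G': "G' \<in> cpoly R" unfolding G'_def
        by (intro cpoly_diff[OF R] cpoly_smult[OF R] cpoly_mult[OF R] T Q Suc.prems cpoly_coeff[OF R])
      have "degree (G' b) < e" if b: "b \<in> \<BB>" for b
      proof -
        have "coeff (G' b) j = 0" if "j \<ge> e" for j
        proof (cases "j = e")
          case True
          have "coeff (Q b * ?T b) e = coeff (Q b) d * coeff (G b) e"
            using False by (simp add: mult.commute[of "Q b"] coeff_monom_mult)
          then show ?thesis using True by (simp add: G'_def)
        next
          case False
          then have "j > e" using that by simp
          then have "coeff (G b) j = 0" using Suc.prems b by (metis coeff_eq_0 le_less_trans less_Suc_eq_le)
          moreover have "coeff (Q b * ?T b) j = 0"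
          proof (rule coeff_eq_0)
            have "degree (Q b * ?T b) \<le> d + (e - d)"
              using degQ b degree_monom_le[of "coeff (G b) e" "e-d"] by (meson add_mono degree_mult_le order_trans)
            then show "degree (Q b * ?T b) < j" using \<open>\<not> e < d\<close> \<open>j > e\<close> by simp
          qed
          ultimately show ?thesis by (simp add: G'_def)
        qed
        \<comment> \<open>Without this, the zero polynomial, whose degree is 0, would not have
          degree below \<open>e\<close>.\<close>
        moreover have "e > 0" using False \<open>d > 0\<close> by simp
        ultimately show ?thesis by (metis degree_0 leading_coeff_0_iff not_le)
      qed
      then obtain M H P where MHP: "H \<in> cpoly R" "P \<in> cpoly R"
        "\<forall>b\<in>\<BB>. degree (P b) < d \<and> smult (?c b ^ M) (G' b) = Q b * H b + P b"
        using Suc.IH[OF _ G'] by blast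
      have "smult (?c b ^ Suc M) (G b) = Q b * (H b + smult (?c b ^ M) (?T b)) + P b" if "b \<in> \<BB>" for b
      proof -
        have "smult (?c b ^ Suc M) (G b) = smult (?c b ^ M) (G' b + Q b * ?T b)"
          by (simp add: G'_def mult.commute)
        also have "\<dots> = smult (?c b ^ M) (G' b) + Q b * smult (?c b ^ M) (?T b)"
          by (simp add: smult_add_right)
        finally show ?thesis using MHP(3) that by (simp add: algebra_simps)
      qed
      moreover have "(\<lambda>b. H b + smult (?c b ^ M) (?T b)) \<in> cpoly R"
        by (intro cpoly_add[OF R] cpoly_smult[OF R] T MHP fa_power[OF R] cpoly_coeff[OF R Q])
      ultimately show ?thesis using MHP by blast
    qed
  qed
qed

section \<open>Generically finite covers\<close>

text \<open>A dominant algebraic map seen through its functions only: by \<open>dominant\<close> no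
  function that is nonzero on the base becomes zero when pulled back, and by
  \<open>algebraic\<close> every function upstairs satisfies a nontrivial polynomial over the
  base.\<close>

locale alg_cover =
  fixes PB :: "('b \<Rightarrow> complex) set" and \<BB> :: "'b set"
    and PW :: "('w \<Rightarrow> complex) set" and \<Omega> :: "'w set" and \<pi> :: "'w \<Rightarrow> 'b"
  assumes PB: "fun_algebra PB" and PW: "fun_algebra PW"
    and pull: "p \<in> PB \<Longrightarrow> (\<lambda>w. p (\<pi> w)) \<in> PW"
    and \<pi>: "w \<in> \<Omega> \<Longrightarrow> \<pi> w \<in> \<BB>"
    and dom: "fun_domain \<Omega> PW" and domB: "fun_domain \<BB> PB"
    and dominant: "p \<in> PB \<Longrightarrow> b \<in> \<BB> \<Longrightarrow> p b \<noteq> 0 \<Longrightarrow> \<exists>w\<in>\<Omega>. p (\<pi> w) \<noteq> 0"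
    and algebraic: "g \<in> PW \<Longrightarrow> \<exists>W\<in>cpoly PB. (\<exists>b\<in>\<BB>. W b \<noteq> 0) \<and> (\<forall>w\<in>\<Omega>. poly (W (\<pi> w)) (g w) = 0)"
begin

lemma eval_PW: "F \<in> cpoly PB \<Longrightarrow> f \<in> PW \<Longrightarrow> (\<lambda>w. poly (F (\<pi> w)) (f w)) \<in> PW"
  by (rule cpoly_eval[OF PB _ PW pull])

definition rel :: "('w \<Rightarrow> complex) \<Rightarrow> ('b \<Rightarrow> complex poly) \<Rightarrow> nat \<Rightarrow> bool" where
  "rel f Q d \<longleftrightarrow> Q \<in> cpoly PB \<and> (\<exists>b\<in>\<BB>. Q b \<noteq> 0) \<and> (\<forall>b\<in>\<BB>. degree (Q b) \<le> d) \<and> (\<forall>w\<in>\<Omega>. poly (Q (\<pi> w)) (f w) = 0)"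

text \<open>The counterpart of a minimal polynomial is a relation with least degree bound
  \<open>d\<close>. The bound is positive because a relation of degree 0 would be a nonzero function
  on the base that vanishes on the image of \<open>\<pi>\<close>.\<close>

lemma min_rel:
  assumes "f \<in> PW"
  obtains Q d where "rel f Q d" "d > 0" "\<exists>b\<in>\<BB>. coeff (Q b) d \<noteq> 0"
    "\<And>P. P \<in> cpoly PB \<Longrightarrow> \<forall>b\<in>\<BB>. degree (P b) < d \<Longrightarrow> \<forall>w\<in>\<Omega>. poly (P (\<pi> w)) (f w) = 0 \<Longrightarrow> \<forall>b\<in>\<BB>. P b = 0"
proof -
  obtain P0 where P0: "P0 \<in> cpoly PB" "\<exists>b\<in>\<BB>. P0 b \<noteq> 0" "\<forall>w\<in>\<Omega>. poly (P0 (\<pi> w)) (f w) = 0"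
    using algebraic[OF assms] by blast
  obtain e where "\<And>b. degree (P0 b) \<le> e" using cpoly_degree[OF PB P0(1)] by blast
  then have "rel f P0 e" using P0 by (auto simp: rel_def)
  then have ex: "\<exists>d Q. rel f Q d" by blast
  define d where "d = (LEAST d. \<exists>Q. rel f Q d)"
  obtain Q where Q: "rel f Q d" using LeastI_ex[OF ex] unfolding d_def by blast
  have least: "d \<le> e" if "rel f P e" for e P
    unfolding d_def using that by (intro Least_le) blast
  have "d > 0"
  proof (rule ccontr)
    assume "\<not> d > 0"
    then have deg: "\<forall>b\<in>\<BB>. degree (Q b) = 0" using Q by (auto simp: rel_def)
    obtain b where b: "b \<in> \<BB>" "Q b \<noteq> 0" using Q by (auto simp: rel_def)
    then have "coeff (Q b) 0 \<noteq> 0" using deg by (metis leading_coeff_0_iff)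
    then obtain w where w: "w \<in> \<Omega>" "coeff (Q (\<pi> w)) 0 \<noteq> 0"
      using dominant[OF cpoly_coeff[OF PB] b(1)] Q unfolding rel_def by blast
    then have "poly (Q (\<pi> w)) (f w) = coeff (Q (\<pi> w)) 0" using deg \<pi> poly_as_sum_le[of "Q (\<pi> w)" 0] by auto
    then show False using Q w by (auto simp: rel_def)
  qed
  moreover have min: "\<forall>b\<in>\<BB>. P b = 0"
    if "P \<in> cpoly PB" "\<forall>b\<in>\<BB>. degree (P b) < d" "\<forall>w\<in>\<Omega>. poly (P (\<pi> w)) (f w) = 0" for P
  proof (rule ccontr)
    assume "\<not> ?thesis"
    then have "rel f P (d - 1)" using that by (auto simp: rel_def)
    then show False using least \<open>d > 0\<close> by fastforce
  qed
  moreover have "\<exists>b\<in>\<BB>. coeff (Q b) d \<noteq> 0"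
  proof (rule ccontr)
    assume H: "\<not> ?thesis"
    have "degree (Q b) < d" if "b \<in> \<BB>" for b
    proof -
      have "degree (Q b) \<le> d" "coeff (Q b) d = 0" using Q H that by (auto simp: rel_def)
      then show ?thesis using \<open>d > 0\<close> by (metis degree_0 leading_coeff_0_iff le_neq_implies_less)
    qed
    then show False using min[of Q] Q by (auto simp: rel_def)
  qed
  ultimately show ?thesis using that Q by blast
qed

text \<open>A shortest relation with constant coefficient zero would be divisible by the variable,
  and as \<open>g\<close> is not a zero divisor the quotient would be a shorter relation. The lemma
  moves a condition from the source to the base: above a base point where this coefficient is
  nonzero, \<open>g\<close> has no zero.\<close>

lemma const_coeff:
  assumes g: "g \<in> PW" and nz: "\<exists>w\<in>\<Omega>. g w \<noteq> 0"
  obtains W where "W \<in> cpoly PB" "\<exists>b\<in>\<BB>. coeff (W b) 0 \<noteq> 0" "\<forall>w\<in>\<Omega>. poly (W (\<pi> w)) (g w) = 0"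
proof -
  obtain W d where W: "rel g W d" "d > 0" "\<exists>b\<in>\<BB>. coeff (W b) d \<noteq> 0"
    and min: "\<And>P. P \<in> cpoly PB \<Longrightarrow> \<forall>b\<in>\<BB>. degree (P b) < d \<Longrightarrow> \<forall>w\<in>\<Omega>. poly (P (\<pi> w)) (g w) = 0 \<Longrightarrow> \<forall>b\<in>\<BB>. P b = 0"
    by (rule min_rel[OF g], rule that, assumption+)
  have Wc: "W \<in> cpoly PB" using W by (auto simp: rel_def)
  have "\<exists>b\<in>\<BB>. coeff (W b) 0 \<noteq> 0"
  proof (rule ccontr)
    assume H: "\<not> ?thesis"
    define V where "V = (\<lambda>b. poly_shift 1 (W b))"
    have degV: "degree (V b) \<le> degree (W b) - 1" for b
      by (rule degree_le) (auto simp: V_def coeff_poly_shift intro!: coeff_eq_0)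
    obtain e where e: "\<And>b. degree (W b) \<le> e" using cpoly_degree[OF PB Wc] by blast
    have "V \<in> cpoly PB"
      using Wc degV e unfolding cpoly_def V_def
      by (auto simp: coeff_poly_shift intro!: exI[of _ e]) (meson diff_le_self order_trans)
    have WV: "W b = pCons 0 (V b)" if "b \<in> \<BB>" for b
      using H that by (intro poly_eqI) (auto simp: V_def coeff_pCons coeff_poly_shift split: nat.split)
    have "\<forall>w\<in>\<Omega>. poly (V (\<pi> w)) (g w) = 0"
    proof (rule ccontr)
      assume "\<not> ?thesis"
      then obtain w where "w \<in> \<Omega>" "poly (V (\<pi> w)) (g w) \<noteq> 0" by blast
      then obtain z where z: "z \<in> \<Omega>" "poly (V (\<pi> z)) (g z) \<noteq> 0" "g z \<noteq> 0"
        using fun_domainD[OF dom eval_PW[OF \<open>V \<in> cpoly PB\<close> g] g] nz by blast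
      have "poly (W (\<pi> z)) (g z) = g z * poly (V (\<pi> z)) (g z)" using WV \<pi>[OF z(1)] by simp
      then show False using z W by (auto simp: rel_def)
    qed
    moreover have "\<forall>b\<in>\<BB>. degree (V b) < d" using degV W(1,2) unfolding rel_def
      by (metis Suc_pred' le_diff_conv less_Suc_eq_le order_trans Suc_eq_plus1)
    ultimately have "\<forall>b\<in>\<BB>. V b = 0" using min \<open>V \<in> cpoly PB\<close> by blast
    then show False using WV W by (auto simp: rel_def)
  qed
  then show ?thesis using that W by (auto simp: rel_def)
qed

text \<open>Over a generic base point the roots of \<open>Q\<close> behave like values of
  \<open>f\<close>, although no fibre is inspected: if \<open>G\<close> annihilates
  \<open>f\<close>, pseudo-division by \<open>Q\<close> leaves a remainder of degree below
  \<open>d\<close> that also annihilates \<open>f\<close>, hence is zero by minimality, and so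
  \<open>G\<close> vanishes at the roots.\<close>

theorem simple_cover:
  assumes f: "f \<in> PW"
  obtains Q d a where "Q \<in> cpoly PB" "a \<in> PB" "\<exists>b\<in>\<BB>. a b \<noteq> 0"
    "\<forall>w\<in>\<Omega>. poly (Q (\<pi> w)) (f w) = 0" "\<forall>b\<in>\<BB>. degree (Q b) \<le> d"
    "\<And>b. b \<in> \<BB> \<Longrightarrow> a b \<noteq> 0 \<Longrightarrow> coeff (Q b) d \<noteq> 0"
    "\<And>b y. b \<in> \<BB> \<Longrightarrow> a b \<noteq> 0 \<Longrightarrow> poly (Q b) y = 0 \<Longrightarrow> poly (pderiv (Q b)) y \<noteq> 0"
    "\<And>b y G. b \<in> \<BB> \<Longrightarrow> a b \<noteq> 0 \<Longrightarrow> poly (Q b) y = 0 \<Longrightarrow> G \<in> cpoly PB \<Longrightarrow>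
       \<forall>w\<in>\<Omega>. poly (G (\<pi> w)) (f w) = 0 \<Longrightarrow> poly (G b) y = 0"
proof -
  obtain Q d where Q: "rel f Q d" "d > 0" and lead: "\<exists>b\<in>\<BB>. coeff (Q b) d \<noteq> 0"
    and min: "\<And>P. P \<in> cpoly PB \<Longrightarrow> \<forall>b\<in>\<BB>. degree (P b) < d \<Longrightarrow> \<forall>w\<in>\<Omega>. poly (P (\<pi> w)) (f w) = 0 \<Longrightarrow> \<forall>b\<in>\<BB>. P b = 0"
    by (rule min_rel[OF f], rule that, assumption+)
  have Qc: "Q \<in> cpoly PB" and degQ: "\<forall>b\<in>\<BB>. degree (Q b) \<le> d" and Q0: "\<forall>w\<in>\<Omega>. poly (Q (\<pi> w)) (f w) = 0"
    using Q by (auto simp: rel_def)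
  have roots: "poly (G b) y = 0" if b: "b \<in> \<BB>" "coeff (Q b) d \<noteq> 0" "poly (Q b) y = 0"
    and G: "G \<in> cpoly PB" "\<forall>w\<in>\<Omega>. poly (G (\<pi> w)) (f w) = 0" for b y G
  proof -
    obtain M H P where *: "H \<in> cpoly PB" "P \<in> cpoly PB"
      "\<forall>b\<in>\<BB>. degree (P b) < d \<and> smult (coeff (Q b) d ^ M) (G b) = Q b * H b + P b"
      using pseudo_division[OF PB Qc degQ \<open>d > 0\<close> G(1)] by blast
    have "poly (P (\<pi> w)) (f w) = 0" if w: "w \<in> \<Omega>" for w
    proof -
      have "poly (smult (coeff (Q (\<pi> w)) d ^ M) (G (\<pi> w))) (f w) = poly (Q (\<pi> w) * H (\<pi> w) + P (\<pi> w)) (f w)"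
        using * \<pi>[OF w] by simp
      then show ?thesis using G Q0 w by simp
    qed
    then have "P b = 0" using min *(2,3) b by blast
    then have "poly (smult (coeff (Q b) d ^ M) (G b)) y = poly (Q b * H b) y" using * b by simp
    then show ?thesis using b by simp
  qed
  let ?D = "\<lambda>b. pderiv (Q b)"
  have Dc: "?D \<in> cpoly PB" by (rule cpoly_pderiv[OF PB Qc])
  \<comment> \<open>The derivative is too short to annihilate \<open>f\<close> unless it is zero on
    the base, and its coefficient \<open>of_nat d * coeff (Q b) d\<close> is not.\<close>
  have "\<exists>w\<in>\<Omega>. poly (?D (\<pi> w)) (f w) \<noteq> 0"
  proof (rule ccontr)
    assume H: "\<not> ?thesis"
    have "\<forall>b\<in>\<BB>. degree (?D b) < d" using degQ \<open>d > 0\<close> by (auto simp: degree_pderiv)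
    then have *: "\<forall>b\<in>\<BB>. ?D b = 0" using min[OF Dc] H by blast
    obtain b where b: "b \<in> \<BB>" "coeff (Q b) d \<noteq> 0" using lead by blast
    have "coeff (?D b) (d - 1) = of_nat d * coeff (Q b) d" using \<open>d > 0\<close> by (simp add: coeff_pderiv)
    then show False using * b \<open>d > 0\<close> by simp
  qed
  then obtain W where W: "W \<in> cpoly PB" "\<exists>b\<in>\<BB>. coeff (W b) 0 \<noteq> 0"
    "\<forall>w\<in>\<Omega>. poly (W (\<pi> w)) (poly (?D (\<pi> w)) (f w)) = 0"
    using const_coeff[OF eval_PW[OF Dc f]] by blast
  obtain e where e: "\<And>b. degree (W b) \<le> e" using cpoly_degree[OF PB W(1)] by blast
  \<comment> \<open>\<open>G\<close> is \<open>W\<close> composed with the derivative of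
    \<open>Q\<close>. It annihilates \<open>f\<close>, so it vanishes at the roots of
    \<open>Q b\<close>; at a multiple root its value is the constant coefficient of
    \<open>W b\<close>. The factor \<open>coeff (W b) 0\<close> of \<open>?a\<close> therefore
    excludes multiple roots.\<close>
  define G where "G = (\<lambda>b. \<Sum>j\<le>e. smult (coeff (W b) j) (?D b ^ j))"
  have G: "G \<in> cpoly PB" unfolding G_def
    by (intro cpoly_sum[OF PB] cpoly_smult[OF PB] cpoly_power[OF PB] Dc cpoly_coeff[OF PB] W)
  have polyG: "poly (G b) y = poly (W b) (poly (?D b) y)" for b y
    using poly_as_sum_le[OF e] by (simp add: G_def poly_sum)
  let ?a = "\<lambda>b. coeff (Q b) d * coeff (W b) 0"
  have "\<exists>b\<in>\<BB>. ?a b \<noteq> 0"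
    using domB[unfolded fun_domain_def, rule_format, OF cpoly_coeff[OF PB Qc] cpoly_coeff[OF PB W(1)]]
      lead W(2) by blast
  moreover have "?a \<in> PB" by (intro fa_mult[OF PB] cpoly_coeff[OF PB] Qc W)
  moreover have "poly (?D b) y \<noteq> 0" if "b \<in> \<BB>" "?a b \<noteq> 0" "poly (Q b) y = 0" for b y
  proof
    assume "poly (?D b) y = 0"
    moreover have "poly (G b) y = 0" using roots[OF that(1) _ that(3) G] that(2) W(3) polyG by simp
    ultimately show False using that(2) by (simp add: polyG poly_0_coeff_0)
  qed
  ultimately show ?thesis
    using Qc Q0 degQ
    by (intro that[of Q ?a d]) (assumption | rule roots | simp)+
qed

end

section \<open>Algebraic dependence by counting\<close>


text \<open>The degree is bounded in each coordinate separately because that is what a product grid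
  detects: \<open>(D + 1) ^ n\<close> nodes determine such a function of \<open>n\<close> variables,
  and such powers are what the counting argument compares.\<close>

definition bdeg :: "nat \<Rightarrow> (('v \<Rightarrow> complex) \<Rightarrow> complex) \<Rightarrow> bool" where
  "bdeg D f \<longleftrightarrow> (\<forall>x i. \<exists>p. degree p \<le> D \<and> (\<forall>t. f (x(i := t)) = poly p t))"

lemma bdegE:
  assumes "bdeg D f" obtains p where "degree p \<le> D" "\<And>t. f (x(i := t)) = poly p t"
  using assms unfolding bdeg_def by blast

lemma bdeg_mono: "bdeg D f \<Longrightarrow> D \<le> D' \<Longrightarrow> bdeg D' f"
  unfolding bdeg_def by (meson order_trans)

lemma bdeg_const: "bdeg D (\<lambda>_. c)"
  unfolding bdeg_def by (intro allI exI[of _ "[:c:]"]) simp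

lemma bdeg_var: "bdeg 1 (\<lambda>x. x v)"
  unfolding bdeg_def
proof (intro allI)
  fix x :: "'a \<Rightarrow> complex" and i
  show "\<exists>p. degree p \<le> 1 \<and> (\<forall>t. (x(i := t)) v = poly p t)"
    by (rule exI[of _ "if i = v then [:0,1:] else [:x v:]"]) simp
qed

lemma bdeg_add: "bdeg D f \<Longrightarrow> bdeg D g \<Longrightarrow> bdeg D (\<lambda>x. f x + g x)"
  unfolding bdeg_def
proof (intro allI)
  fix x i assume f: "\<forall>x i. \<exists>p. degree p \<le> D \<and> (\<forall>t. f (x(i := t)) = poly p t)"
    and g: "\<forall>x i. \<exists>p. degree p \<le> D \<and> (\<forall>t. g (x(i := t)) = poly p t)"
  obtain p q where "degree p \<le> D" "\<forall>t. f (x(i := t)) = poly p t" "degree q \<le> D" "\<forall>t. g (x(i := t)) = poly q t"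
    using f g by blast
  then show "\<exists>p. degree p \<le> D \<and> (\<forall>t. f (x(i := t)) + g (x(i := t)) = poly p t)"
    by (intro exI[of _ "p + q"]) (auto intro: degree_add_le)
qed

lemma bdeg_mult: "bdeg D f \<Longrightarrow> bdeg E g \<Longrightarrow> bdeg (D + E) (\<lambda>x. f x * g x)"
  unfolding bdeg_def
proof (intro allI)
  fix x i assume f: "\<forall>x i. \<exists>p. degree p \<le> D \<and> (\<forall>t. f (x(i := t)) = poly p t)"
    and g: "\<forall>x i. \<exists>p. degree p \<le> E \<and> (\<forall>t. g (x(i := t)) = poly p t)"
  obtain p q where "degree p \<le> D" "\<forall>t. f (x(i := t)) = poly p t" "degree q \<le> E" "\<forall>t. g (x(i := t)) = poly q t"
    using f g by blast
  then show "\<exists>p. degree p \<le> D + E \<and> (\<forall>t. f (x(i := t)) * g (x(i := t)) = poly p t)"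
    by (intro exI[of _ "p * q"]) (auto intro: order_trans[OF degree_mult_le] add_mono)
qed

lemma bdeg_cmult: "bdeg D f \<Longrightarrow> bdeg D (\<lambda>x. c * f x)"
  using bdeg_mult[OF bdeg_const[of 0 c], of D f] by simp

lemma bdeg_sum: "(\<And>i. i \<in> A \<Longrightarrow> bdeg D (f i)) \<Longrightarrow> bdeg D (\<lambda>x. \<Sum>i\<in>A. f i x)"
  by (induction A rule: infinite_finite_induct) (simp_all add: bdeg_const bdeg_add)

lemma bdeg_prod: "(\<And>i. i \<in> A \<Longrightarrow> bdeg D (f i)) \<Longrightarrow> bdeg (D * card A) (\<lambda>x. \<Prod>i\<in>A. f i x)"
  by (induction A rule: infinite_finite_induct) (simp_all add: bdeg_const bdeg_mult)

lemma poly_fun_bdeg: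
  assumes "p \<in> poly_fun" shows "\<exists>D. bdeg D p"
  using assms
proof induction
  case (padd p q)
  then obtain D E where "bdeg D p" "bdeg E q" by blast
  then show ?case by (intro exI[of _ "max D E"] bdeg_add) (auto elim: bdeg_mono)
qed (auto intro: bdeg_const bdeg_var bdeg_mult)

text \<open>The coordinates are freed from the grid one at a time: with the others fixed, the
  function is a polynomial of degree at most \<open>D\<close> in the current coordinate, and the
  grid offers more than \<open>D\<close> roots.\<close>

lemma grid_zero:
  assumes J: "finite J" and f: "bdeg D f" and N: "\<And>v. v \<in> J \<Longrightarrow> D < card (N v)"
    and zero: "\<And>x. (\<And>v. v \<in> J \<Longrightarrow> x v \<in> N v) \<Longrightarrow> (\<And>v. v \<notin> J \<Longrightarrow> x v = 0) \<Longrightarrow> f x = 0"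
    and x: "\<And>v. v \<notin> J \<Longrightarrow> x v = 0"
  shows "f x = 0"
proof -
  have "\<forall>x. (\<forall>v\<in>J - A. x v \<in> N v) \<longrightarrow> (\<forall>v. v \<notin> J \<longrightarrow> x v = 0) \<longrightarrow> f x = 0" if "A \<subseteq> J" for A
    using finite_subset[OF that J] that
  proof (induction A)
    case empty
    then show ?case using zero by auto
  next
    case (insert v A)
    show ?case
    proof (intro allI impI)
      fix x assume *: "\<forall>w\<in>J - insert v A. x w \<in> N w" "\<forall>v. v \<notin> J \<longrightarrow> x v = 0"
      obtain p where p: "degree p \<le> D" "\<And>t. f (x(v := t)) = poly p t" using bdegE[OF f] by metis
      have "poly p t = 0" if t: "t \<in> N v" for t
      proof -
        have "f (x(v := t)) = 0" using insert t *
          by (intro insert.IH[THEN spec, THEN mp, THEN mp]) auto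
        then show ?thesis using p by simp
      qed
      then have sub: "N v \<subseteq> {t. poly p t = 0}" by blast
      have "p = 0"
      proof (rule ccontr)
        assume "p \<noteq> 0"
        then have "card (N v) \<le> degree p"
          using card_mono[OF poly_roots_finite sub] card_poly_roots_bound[of p] by linarith
        then show False using N[of v] insert p by auto
      qed
      then show "f x = 0" using p(2)[of "x v"] by simp
    qed
  qed
  from this[of J] show ?thesis using x by simp
qed

text \<open>The offset \<open>u\<close> translates the grid. It is 0 in the counting argument; later
  a well chosen offset keeps all nodes off a hypersurface.\<close>

definition node :: "'v set \<Rightarrow> ('v \<Rightarrow> complex) \<Rightarrow> ('v \<Rightarrow> nat) \<Rightarrow> 'v \<Rightarrow> complex" where
  "node J u g = (\<lambda>v. if v \<in> J then u v + of_nat (g v) else 0)"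

text \<open>The product Lagrange polynomial of the node with index \<open>g\<close>.\<close>

definition lag :: "'v set \<Rightarrow> ('v \<Rightarrow> complex) \<Rightarrow> nat \<Rightarrow> ('v \<Rightarrow> nat) \<Rightarrow> ('v \<Rightarrow> complex) \<Rightarrow> complex" where
  "lag J u D g x = (\<Prod>v\<in>J. \<Prod>n\<in>{..D} - {g v}. (x v - u v - of_nat n) / (of_nat (g v) - of_nat n))"

abbreviation grid :: "'v set \<Rightarrow> nat \<Rightarrow> ('v \<Rightarrow> nat) set" where
  "grid J D \<equiv> PiE J (\<lambda>_. {..D})"

lemma lag_poly_fun: "lag J u D g \<in> poly_fun"
proof -
  have "(\<lambda>x. \<Prod>v\<in>J. \<Prod>n\<in>{..D} - {g v}. (x v - u v - of_nat n) * (1 / (of_nat (g v) - of_nat n))) \<in> poly_fun"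
    by (intro pf_intros)
  then show ?thesis unfolding lag_def[abs_def] by simp
qed

lemma lag_node:
  assumes J: "finite J" and g: "g \<in> grid J D" and h: "h \<in> grid J D"
  shows "lag J u D g (node J u h) = (if g = h then 1 else 0)"
proof (cases "g = h")
  case True
  then show ?thesis by (simp add: lag_def node_def)
next
  case False
  then obtain v where v: "v \<in> J" "g v \<noteq> h v" using g h by (metis PiE_ext)
  then have "(\<Prod>n\<in>{..D} - {g v}. (node J u h v - u v - of_nat n) / (of_nat (g v) - of_nat n)) = 0"
    using h by (intro prod_zero bexI[of _ "h v"]) (auto simp: node_def)
  then show ?thesis using v J False unfolding lag_def by (auto intro!: prod_zero)
qed

lemma bdeg_lag:
  assumes J: "finite J" and g: "g \<in> grid J D"
  shows "bdeg D (lag J u D g)"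
  unfolding bdeg_def
proof (intro allI)
  fix x :: "'a \<Rightarrow> complex" and i
  let ?fac = "\<lambda>x v. \<Prod>n\<in>{..D} - {g v}. (x v - u v - of_nat n) / (of_nat (g v) - of_nat n)"
  show "\<exists>p. degree p \<le> D \<and> (\<forall>t. lag J u D g (x(i := t)) = poly p t)"
  proof (cases "i \<in> J")
    case False
    then have "lag J u D g (x(i := t)) = lag J u D g x" for t unfolding lag_def by (intro prod.cong refl) auto
    then show ?thesis by (intro exI[of _ "[:lag J u D g x:]"]) simp
  next
    case True
    define q where "q = (\<Prod>n\<in>{..D} - {g i}. smult (1 / (of_nat (g i) - of_nat n)) [:- u i - of_nat n, 1:])"
    have "g i \<le> D" using g True by auto
    have "degree q \<le> (\<Sum>n\<in>{..D} - {g i}. degree (smult (1 / (of_nat (g i) - of_nat n)) [:- u i - of_nat n, 1::complex:]))"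
      unfolding q_def by (rule degree_prod_sum_le[unfolded o_def]) auto
    also have "\<dots> \<le> (\<Sum>n\<in>{..D} - {g i}. 1)" by (intro sum_mono order_trans[OF degree_smult_le]) simp
    also have "\<dots> = D" using \<open>g i \<le> D\<close> by simp
    finally have "degree q \<le> D" .
    moreover have "lag J u D g (x(i := t)) = poly (smult (\<Prod>v\<in>J-{i}. ?fac x v) q) t" for t
    proof -
      have "lag J u D g (x(i := t)) = ?fac (x(i:=t)) i * (\<Prod>v\<in>J-{i}. ?fac (x(i:=t)) v)"
        unfolding lag_def using True J by (simp add: prod.remove)
      also have "(\<Prod>v\<in>J-{i}. ?fac (x(i:=t)) v) = (\<Prod>v\<in>J-{i}. ?fac x v)" by (intro prod.cong refl) auto
      also have "?fac (x(i:=t)) i = poly q t" unfolding q_def poly_prod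
        by (intro prod.cong refl) (simp add: diff_divide_distrib add_divide_distrib)
      finally show ?thesis by (simp only: poly_smult mult.commute)
    qed
    ultimately show ?thesis by (intro exI[of _ "smult (\<Prod>v\<in>J-{i}. ?fac x v) q"]) (auto intro: order_trans[OF degree_smult_le])
  qed
qed

lemma interpolation:
  assumes J: "finite J" and f: "bdeg D f" and x: "\<And>v. v \<notin> J \<Longrightarrow> x v = 0"
  shows "f x = (\<Sum>g\<in>grid J D. f (node J u g) * lag J u D g x)"
proof -
  let ?h = "\<lambda>x. f x - (\<Sum>g\<in>grid J D. f (node J u g) * lag J u D g x)"
  have "bdeg D (\<lambda>x. f x + (\<Sum>g\<in>grid J D. (- f (node J u g)) * lag J u D g x))"
  proof (intro bdeg_add f bdeg_sum)
    fix g assume "g \<in> grid J D"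
    then show "bdeg D (\<lambda>x. - f (node J u g) * lag J u D g x)"
      by (intro bdeg_cmult bdeg_lag J)
  qed
  then have "bdeg D ?h" by (simp add: sum_negf)
  then have "?h x = 0"
  proof (rule grid_zero[OF J])
    fix v assume "v \<in> J"
    have "inj_on (\<lambda>n. u v + of_nat n :: complex) {..D}" by (auto intro!: inj_onI)
    then show "D < card ((\<lambda>n. u v + of_nat n) ` {..D})" by (simp add: card_image)
  next
    fix z assume z: "\<And>v. v \<in> J \<Longrightarrow> z v \<in> (\<lambda>n. u v + of_nat n) ` {..D}" "\<And>v. v \<notin> J \<Longrightarrow> z v = 0"
    then have "\<exists>n. \<forall>v\<in>J. n v \<le> D \<and> z v = u v + of_nat (n v)"
      by (intro bchoice ballI) (metis (no_types, lifting) imageE atMost_iff)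
    then obtain n where n: "\<forall>v\<in>J. n v \<le> D \<and> z v = u v + of_nat (n v)" by blast
    let ?g = "restrict n J"
    have g: "?g \<in> grid J D" using n by auto
    have zg: "z = node J u ?g" using n z by (auto simp: node_def)
    have "(\<Sum>h\<in>grid J D. f (node J u h) * lag J u D h z) = (\<Sum>h\<in>grid J D. if h = ?g then f (node J u h) else 0)"
      by (intro sum.cong refl) (simp add: zg lag_node[OF J _ g])
    also have "\<dots> = f z" using J g by (simp add: zg sum.delta finite_PiE)
    finally show "?h z = 0" by simp
  qed (use x in auto)
  then show ?thesis by simp
qed

text \<open>Gaussian elimination: an unknown \<open>a0\<close> with nonzero coefficient in equation
  \<open>b\<close> is eliminated, which costs one equation and one unknown.\<close>

lemma underdetermined_system:
  fixes M :: "'a \<Rightarrow> 'b \<Rightarrow> complex"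
  assumes "finite B" "finite A" "card B < card A"
  shows "\<exists>c. (\<exists>a\<in>A. c a \<noteq> 0) \<and> (\<forall>b\<in>B. (\<Sum>a\<in>A. c a * M a b) = 0)"
  using assms
proof (induction B arbitrary: A M)
  case empty
  then have "\<exists>a. a \<in> A" by (metis card.empty less_irrefl equals0I)
  then show ?case by (intro exI[of _ "\<lambda>_. 1"]) auto
next
  case (insert b B)
  show ?case
  proof (cases "\<forall>a\<in>A. M a b = 0")
    case True
    moreover have "card B < card A" using insert by simp
    ultimately show ?thesis using insert.IH[of A M] insert.prems by auto
  next
    case False
    then obtain a0 where a0: "a0 \<in> A" "M a0 b \<noteq> 0" by blast
    let ?A = "A - {a0}"
    define M' where "M' = (\<lambda>a b'. M a b' - M a b / M a0 b * M a0 b')"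
    have "card B < card ?A" using insert a0 by simp
    then obtain c where c: "\<exists>a\<in>?A. c a \<noteq> 0" "\<forall>b'\<in>B. (\<Sum>a\<in>?A. c a * M' a b') = 0"
      using insert.IH[of ?A M'] insert.prems by auto
    define c' where "c' = c(a0 := - (\<Sum>a\<in>?A. c a * (M a b / M a0 b)))"
    have *: "(\<Sum>a\<in>A. c' a * M a b') = (\<Sum>a\<in>?A. c a * M' a b')" for b'
    proof -
      have "(\<Sum>a\<in>A. c' a * M a b') = c' a0 * M a0 b' + (\<Sum>a\<in>?A. c' a * M a b')"
        using a0 insert.prems by (simp add: sum.remove)
      also have "(\<Sum>a\<in>?A. c' a * M a b') = (\<Sum>a\<in>?A. c a * M a b')" by (intro sum.cong) (auto simp: c'_def)
      also have "c' a0 * M a0 b' = (\<Sum>a\<in>?A. - (c a * (M a b / M a0 b) * M a0 b'))"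
        by (simp add: c'_def sum_negf sum_distrib_right)
      finally show ?thesis by (simp add: M'_def sum.distrib[symmetric] algebra_simps)
    qed
    have "(\<Sum>a\<in>?A. c a * M' a b) = 0" using a0 by (simp add: M'_def)
    then have "\<forall>b'\<in>insert b B. (\<Sum>a\<in>A. c' a * M a b') = 0" using c * by auto
    moreover have "\<exists>a\<in>A. c' a \<noteq> 0" using c(1) by (auto simp: c'_def)
    ultimately show ?thesis by blast
  qed
qed

text \<open>
  The unknowns are the values of \<open>P\<close> on a grid with \<open>(M + 1) ^ card I\<close> points, the equations say
  that \<open>P (q / \<delta>)\<close>, with denominators cleared, vanishes on a grid with \<open>(D * M * r + 1) ^ card J\<close>
  points; for large \<open>M\<close> there are more unknowns than equations.
\<close>
lemma algebraic_dependence: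
  fixes q :: "'u \<Rightarrow> ('v \<Rightarrow> complex) \<Rightarrow> complex"
  assumes J: "finite J" and I: "finite I" and less: "card J < card I"
    and q: "\<And>i. i \<in> I \<Longrightarrow> q i \<in> poly_fun" and \<delta>: "\<delta> \<in> poly_fun"
  shows "\<exists>P\<in>poly_fun. (\<exists>x. (\<forall>i. i \<notin> I \<longrightarrow> x i = 0) \<and> P x \<noteq> 0) \<and>
    (\<forall>w. (\<forall>v. v \<notin> J \<longrightarrow> w v = 0) \<longrightarrow> \<delta> w \<noteq> 0 \<longrightarrow> P (\<lambda>i. if i \<in> I then q i w / \<delta> w else 0) = 0)"
proof -
  obtain D1 where D1: "bdeg D1 \<delta>" using poly_fun_bdeg[OF \<delta>] by blast
  have "\<forall>i\<in>I. \<exists>D. bdeg D (q i)" using q poly_fun_bdeg by blast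
  then obtain Dq where Dq: "\<forall>i\<in>I. bdeg (Dq i) (q i)" by metis
  define D where "D = D1 + (\<Sum>i\<in>I. Dq i)"
  have dD: "bdeg D \<delta>" using D1 by (rule bdeg_mono) (simp add: D_def)
  have qD: "bdeg D (q i)" if "i \<in> I" for i
  proof (rule bdeg_mono)
    show "bdeg (Dq i) (q i)" using Dq that by blast
    show "Dq i \<le> D" unfolding D_def using that I member_le_sum[of i I Dq] by simp
  qed
  define r where "r = card I"
  \<comment> \<open>The value that makes the comparison below work: \<open>(K + 1) ^ card J\<close>
    is at most \<open>((D * r + 1) * (M + 1)) ^ card J\<close>, which equals
    \<open>M * (M + 1) ^ card J\<close> and is thus smaller than
    \<open>(M + 1) ^ card I\<close>.\<close>
  define M where "M = (D * r + 1) ^ card J"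
  \<comment> \<open>For \<open>g\<close> in the grid this is the Lagrange polynomial of
    \<open>g\<close> at the point \<open>q / \<delta>\<close>, times
    \<open>\<delta> ^ (M * r)\<close>: each of the \<open>M * r\<close> linear factors has absorbed
    one \<open>\<delta>\<close>.\<close>
  define H where "H = (\<lambda>g w. \<Prod>i\<in>I. \<Prod>n\<in>{..M} - {g i}. (q i w + \<delta> w * (- of_nat n)) * (1 / (of_nat (g i) - of_nat n)))"
  define K where "K = D * M * r"
  have H: "bdeg K (H g)" if "g \<in> grid I M" for g
  proof -
    have "bdeg (D * M) (\<lambda>w. \<Prod>n\<in>{..M} - {g i}. (q i w + \<delta> w * (- of_nat n)) * (1 / (of_nat (g i) - of_nat n)))" if i: "i \<in> I" for i
    proof -
      have "bdeg (D + 0) (\<lambda>w. (q i w + \<delta> w * (- of_nat n)) * (1 / (of_nat (g i) - of_nat n)))" for n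
        using bdeg_cmult[OF dD, of "- of_nat n"]
        by (intro bdeg_mult[OF _ bdeg_const] bdeg_add qD i) (simp add: mult.commute)
      then have "bdeg (D * card ({..M} - {g i})) (\<lambda>w. \<Prod>n\<in>{..M} - {g i}. (q i w + \<delta> w * (- of_nat n)) * (1 / (of_nat (g i) - of_nat n)))"
        by (intro bdeg_prod) simp
      moreover have "card ({..M} - {g i}) = M" using that i \<open>g \<in> grid I M\<close> by (subst card_Diff_singleton) auto
      ultimately show ?thesis by simp
    qed
    then show ?thesis unfolding H_def K_def r_def by (intro bdeg_prod) simp
  qed
  have "card (grid J K) < card (grid I M)"
  proof -
    have "card (grid J K) = (K + 1) ^ card J" using J by (simp add: card_PiE)
    also have "\<dots> \<le> ((D * r + 1) * (M + 1)) ^ card J"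
      by (intro power_mono) (auto simp: K_def algebra_simps)
    also have "\<dots> = M * (M + 1) ^ card J" unfolding power_mult_distrib by (simp add: M_def)
    also have "\<dots> < (M + 1) * (M + 1) ^ card J" by (intro mult_strict_right_mono) auto
    also have "\<dots> = (M + 1) ^ (Suc (card J))" by simp
    also have "\<dots> \<le> (M + 1) ^ r" using less unfolding r_def by (intro power_increasing) auto
    also have "\<dots> = card (grid I M)" using I by (simp add: card_PiE r_def)
    finally show ?thesis .
  qed
  then obtain c where c: "\<exists>g\<in>grid I M. c g \<noteq> 0"
    "\<forall>h\<in>grid J K. (\<Sum>g\<in>grid I M. c g * H g (node J (\<lambda>_. 0) h)) = 0"
    using underdetermined_system[of "grid J K" "grid I M" "\<lambda>g h. H g (node J (\<lambda>_. 0) h)"] I J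
    by (auto simp: finite_PiE)
  define P where "P = (\<lambda>x. \<Sum>g\<in>grid I M. c g * lag I (\<lambda>_. 0) M g x)"
  have PP: "P \<in> poly_fun" unfolding P_def by (intro pf_intros lag_poly_fun)
  obtain h where h: "h \<in> grid I M" "c h \<noteq> 0" using c by blast
  have "P (node I (\<lambda>_. 0) h) = (\<Sum>g\<in>grid I M. if g = h then c g else 0)"
    unfolding P_def by (intro sum.cong refl) (simp add: lag_node[OF I _ h(1)])
  also have "\<dots> = c h" using I h by (simp add: sum.delta finite_PiE)
  finally have "P (node I (\<lambda>_. 0) h) \<noteq> 0" using h by simp
  then have P0: "\<exists>x. (\<forall>i. i \<notin> I \<longrightarrow> x i = 0) \<and> P x \<noteq> 0"
    by (intro exI[of _ "node I (\<lambda>_. 0) h"]) (simp add: node_def)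
  let ?F = "\<lambda>w. \<Sum>g\<in>grid I M. c g * H g w"
  have Fdeg: "bdeg K ?F"
  proof (rule bdeg_sum)
    fix g assume "g \<in> grid I M"
    then show "bdeg K (\<lambda>w. c g * H g w)" by (intro bdeg_cmult H)
  qed
  have F0: "?F w = 0" if "\<And>v. v \<notin> J \<Longrightarrow> w v = 0" for w
    using interpolation[OF J Fdeg that, where u = "\<lambda>_. 0"] c(2) by simp
  have "P (\<lambda>i. if i \<in> I then q i w / \<delta> w else 0) = 0" if w: "\<And>v. v \<notin> J \<Longrightarrow> w v = 0" and \<delta>w: "\<delta> w \<noteq> 0" for w
  proof -
    let ?y = "\<lambda>i. if i \<in> I then q i w / \<delta> w else 0"
    have "H g w = \<delta> w ^ (M * r) * lag I (\<lambda>_. 0) M g ?y" if g: "g \<in> grid I M" for g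
    proof -
      have "H g w = (\<Prod>i\<in>I. \<Prod>n\<in>{..M} - {g i}. \<delta> w * ((?y i - 0 - of_nat n) / (of_nat (g i) - of_nat n)))"
        unfolding H_def using \<delta>w by (intro prod.cong refl) (auto simp: field_simps)
      also have "\<dots> = (\<Prod>i\<in>I. \<delta> w ^ M * (\<Prod>n\<in>{..M} - {g i}. (?y i - 0 - of_nat n) / (of_nat (g i) - of_nat n)))"
      proof (intro prod.cong refl)
        fix i assume "i \<in> I"
        then have "card ({..M} - {g i}) = M" using g by (subst card_Diff_singleton) auto
        then show "(\<Prod>n\<in>{..M} - {g i}. \<delta> w * ((?y i - 0 - of_nat n) / (of_nat (g i) - of_nat n))) =
          \<delta> w ^ M * (\<Prod>n\<in>{..M} - {g i}. (?y i - 0 - of_nat n) / (of_nat (g i) - of_nat n))"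
          by (simp only: prod.distrib prod_constant)
      qed
      also have "\<dots> = \<delta> w ^ (M * r) * lag I (\<lambda>_. 0) M g ?y"
        unfolding lag_def r_def by (simp only: prod.distrib prod_constant power_mult)
      finally show ?thesis .
    qed
    then have "?F w = \<delta> w ^ (M * r) * P ?y" unfolding P_def by (simp add: sum_distrib_left mult_ac)
    then show ?thesis using F0[of w] w \<delta>w by simp
  qed
  then show ?thesis using PP P0 by blast
qed

section \<open>Parametrised cones and their linear projection\<close>


definition lin :: "('e::finite \<Rightarrow> complex) \<Rightarrow> ('e \<Rightarrow> complex) \<Rightarrow> complex" where
  "lin t x = (\<Sum>e\<in>UNIV. t e * x e)"

lemma lin_add: "lin t (\<lambda>e. x e + y e) = lin t x + lin t y"
  and lin_diff: "lin t (\<lambda>e. x e - y e) = lin t x - lin t y"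
  and lin_scale: "lin t (\<lambda>e. c * x e) = c * lin t x"
  and lin_minus: "lin t (\<lambda>e. - x e) = - lin t x"
  and lin_diff_left: "lin (\<lambda>e. t e - u e) x = lin t x - lin u x"
  and lin_scale_left: "lin (\<lambda>e. c * t e) x = c * lin t x"
  by (simp_all add: lin_def algebra_simps sum.distrib sum_subtractf sum_distrib_left sum_negf)

lemma lin_sum: "lin t (\<lambda>e. \<Sum>i\<in>A. x i e) = (\<Sum>i\<in>A. lin t (x i))"
  unfolding lin_def by (subst sum.swap) (simp add: sum_distrib_left)

lemma lin_zero: "lin t (\<lambda>_. 0) = 0" "lin (\<lambda>_. 0) x = 0"
  by (simp_all add: lin_def)

lemma lin_fa: "fun_algebra R \<Longrightarrow> (\<And>e. (\<lambda>w. t w e) \<in> R) \<Longrightarrow> (\<And>e. (\<lambda>w. x w e) \<in> R) \<Longrightarrow> (\<lambda>w. lin (t w) (x w)) \<in> R"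
  unfolding lin_def by (intro fa_sum fa_mult)

lemma case_sum_fa: "(\<And>i. (\<lambda>w. s w i) \<in> R) \<Longrightarrow> (\<And>f. (\<lambda>w. t w f) \<in> R) \<Longrightarrow> (\<lambda>w. case_sum (s w) (t w) v) \<in> R"
  by (cases v) simp_all

lemma lin_unit: "lin (\<lambda>e'. if e' = e then 1 else 0) x = x e"
  by (simp add: lin_def if_distrib[of "\<lambda>z. z * _"] cong: if_cong)

lemma lin_nonzero: "x \<noteq> (\<lambda>_. 0) \<Longrightarrow> \<exists>t. lin t x \<noteq> 0"
  by (metis lin_unit ext)

lemma zariski_closure_iff:
  "x \<in> zariski_closure A \<longleftrightarrow> (\<forall>p\<in>poly_fun. (\<forall>y\<in>A. p y = 0) \<longrightarrow> p x = 0)"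
proof
  assume x: "x \<in> zariski_closure A"
  show "\<forall>p\<in>poly_fun. (\<forall>y\<in>A. p y = 0) \<longrightarrow> p x = 0"
  proof (intro ballI impI)
    fix p :: "('a \<Rightarrow> complex) \<Rightarrow> complex" assume p: "p \<in> poly_fun" "\<forall>y\<in>A. p y = 0"
    have "zariski_closed {x. \<forall>q\<in>{p}. q x = 0}" unfolding zariski_closed_def using p by blast
    then show "p x = 0" using x p unfolding zariski_closure_def by auto
  qed
next
  assume *: "\<forall>p\<in>poly_fun. (\<forall>y\<in>A. p y = 0) \<longrightarrow> p x = 0"
  show "x \<in> zariski_closure A"
    unfolding zariski_closure_def
  proof
    fix C assume "C \<in> {C. zariski_closed C \<and> A \<subseteq> C}"
    then obtain P where "P \<subseteq> poly_fun" "C = {x. \<forall>p\<in>P. p x = 0}" "A \<subseteq> C" unfolding zariski_closed_def by blast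
    then show "x \<in> C" using * by blast
  qed
qed

text \<open>The variable \<open>None\<close> becomes \<open>y\<close> and the others become
  parameters, so that a dependence between the base coordinates and one further function turns into
  a relation for that function over the base.\<close>

lemma poly_fun_option_cpoly:
  fixes P :: "('v option \<Rightarrow> complex) \<Rightarrow> complex"
  assumes "P \<in> poly_fun"
  shows "\<exists>W\<in>cpoly poly_fun. \<forall>b y. P (case_option y b) = poly (W b) y"
  using assms
proof induction
  case (pconst c)
  then show ?case by (intro bexI[of _ "\<lambda>_. [:c:]"] cpoly_fixed fun_algebra_poly_fun) auto
next
  case (pvar i)
  show ?case
  proof (cases i)
    case None
    then show ?thesis by (intro bexI[of _ "\<lambda>_. [:0,1:]"] cpoly_fixed fun_algebra_poly_fun) auto
  next
    case (Some v)
    then show ?thesis by (intro bexI[of _ "\<lambda>b. [:b v:]"] cpoly_const fun_algebra_poly_fun poly_fun.pvar) auto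
  qed
next
  case (padd p q)
  then obtain F G where "F \<in> cpoly poly_fun" "\<forall>b y. p (case_option y b) = poly (F b) y"
    "G \<in> cpoly poly_fun" "\<forall>b y. q (case_option y b) = poly (G b) y" by blast
  then show ?case by (intro bexI[of _ "\<lambda>b. F b + G b"] cpoly_add fun_algebra_poly_fun) auto
next
  case (pmult p q)
  then obtain F G where "F \<in> cpoly poly_fun" "\<forall>b y. p (case_option y b) = poly (F b) y"
    "G \<in> cpoly poly_fun" "\<forall>b y. q (case_option y b) = poly (G b) y" by blast
  then show ?case by (intro bexI[of _ "\<lambda>b. F b * G b"] cpoly_mult fun_algebra_poly_fun) auto
qed

text \<open>In the application \<open>V\<close> is the space of symmetric matrices, the forms
  \<open>\<beta> i\<close> come from a basis of the subspace, \<open>dv\<close> is a dual system,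
  \<open>\<delta>\<close> is the determinant of the general element and \<open>num\<close> lists its
  cofactors. As \<open>k\<close> is a number and not a type, \<open>k\<close>-space is modelled by
  the sequences in \<open>supp\<close>.\<close>

locale param_cone =
  fixes k :: nat and \<beta> dv :: "nat \<Rightarrow> 'e::finite \<Rightarrow> complex" and V :: "('e \<Rightarrow> complex) set"
    and \<delta> :: "(nat \<Rightarrow> complex) \<Rightarrow> complex" and num :: "'e \<Rightarrow> (nat \<Rightarrow> complex) \<Rightarrow> complex"
  assumes \<delta>: "\<delta> \<in> poly_fun" and num: "num e \<in> poly_fun"
    and k_pos: "k > 0"
    and dual: "i < k \<Longrightarrow> j < k \<Longrightarrow> lin (\<beta> i) (dv j) = (if i = j then 1 else 0)"
    and dv: "j < k \<Longrightarrow> dv j \<in> V"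
    and V_zero: "(\<lambda>_. 0) \<in> V"
    and V_add: "x \<in> V \<Longrightarrow> y \<in> V \<Longrightarrow> (\<lambda>e. x e + y e) \<in> V"
    and V_scale: "x \<in> V \<Longrightarrow> (\<lambda>e. c * x e) \<in> V"
    and V_closed: "zariski_closed V"
begin

definition supp :: "(nat \<Rightarrow> complex) set" where "supp = {a. \<forall>i\<ge>k. a i = 0}"
definition reg :: "(nat \<Rightarrow> complex) set" where "reg = {a \<in> supp. \<delta> a \<noteq> 0}"
definition inv :: "(nat \<Rightarrow> complex) \<Rightarrow> 'e \<Rightarrow> complex" where "inv a e = num e a / \<delta> a"
definition X0 :: "('e \<Rightarrow> complex) set" where "X0 = inv ` reg"
definition X :: "('e \<Rightarrow> complex) set" where "X = zariski_closure X0"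
definition sv :: "('e \<Rightarrow> complex) \<Rightarrow> nat \<Rightarrow> complex" where
  "sv x = (\<lambda>i. if i < k then lin (\<beta> i) x else 0)"
definition H :: "('e \<Rightarrow> complex) set" where "H = {x \<in> V. \<forall>i<k. lin (\<beta> i) x = 0}"
definition sec :: "(nat \<Rightarrow> complex) \<Rightarrow> 'e \<Rightarrow> complex" where
  "sec s = (\<lambda>e. \<Sum>j<k. s j * dv j e)"

text \<open>Besides \<open>k\<close>-space the base carries auxiliary coordinates, of any index
  type, that \<open>\<pi>\<close> leaves alone. They hold the coefficients of \<open>t\<close> in
  the relation for \<open>t(x)\<close>, and three vectors in the separation argument.\<close>

definition BB :: "(nat + 'f \<Rightarrow> complex) set" where "BB = {b. \<forall>i\<ge>k. b (Inl i) = 0}"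
definition \<Omega> :: "(nat + 'f \<Rightarrow> complex) set" where "\<Omega> = {w\<in>BB. \<delta> (w \<circ> Inl) \<noteq> 0}"
definition \<pi> :: "(nat + 'f \<Rightarrow> complex) \<Rightarrow> nat + 'f \<Rightarrow> complex" where
  "\<pi> w = case_sum (sv (inv (w \<circ> Inl))) (w \<circ> Inr)"
text \<open>The localisation of the polynomial ring at \<open>\<delta>\<close>. Being a fraction is
  required only on \<open>\<Omega>\<close>, where \<open>\<delta>\<close> does not vanish.\<close>

definition PW :: "((nat + 'f \<Rightarrow> complex) \<Rightarrow> complex) set" where
  "PW = {r. \<exists>n. \<exists>p\<in>poly_fun. \<forall>w\<in>\<Omega>. r w * \<delta> (w \<circ> Inl) ^ n = p w}"

definition dominant_cone :: bool where
  "dominant_cone \<longleftrightarrow> (\<forall>p\<in>poly_fun. (\<forall>x\<in>X0. p (sv x) = 0) \<longrightarrow> (\<forall>s\<in>supp. p s = 0))"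

lemma V_sum: "finite A \<Longrightarrow> (\<And>i. i \<in> A \<Longrightarrow> x i \<in> V) \<Longrightarrow> (\<lambda>e. \<Sum>i\<in>A. x i e) \<in> V"
  by (induction A rule: finite_induct) (auto intro: V_zero V_add)

lemma V_diff: "x \<in> V \<Longrightarrow> y \<in> V \<Longrightarrow> (\<lambda>e. x e - y e) \<in> V"
  using V_add[OF _ V_scale[of y "-1"], of x] by simp

lemma sec_V: "sec s \<in> V"
  unfolding sec_def by (intro V_sum V_scale dv) auto

lemma sv_supp: "sv x \<in> supp" by (simp add: sv_def supp_def)

lemma sv_sec: "s \<in> supp \<Longrightarrow> sv (sec s) = s"
proof
  fix i assume s: "s \<in> supp"
  show "sv (sec s) i = s i"
  proof (cases "i < k")
    case True
    have "lin (\<beta> i) (sec s) = (\<Sum>j<k. s j * lin (\<beta> i) (dv j))"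
      by (simp add: sec_def lin_sum lin_scale)
    also have "\<dots> = (\<Sum>j<k. if j = i then s j else 0)" using True by (intro sum.cong refl) (auto simp: dual)
    finally show ?thesis using True by (simp add: sv_def)
  qed (use s in \<open>auto simp: sv_def supp_def\<close>)
qed

lemma sv_add: "sv (\<lambda>e. x e + y e) = (\<lambda>i. sv x i + sv y i)"
  and sv_diff: "sv (\<lambda>e. x e - y e) = (\<lambda>i. sv x i - sv y i)"
  and sv_scale: "sv (\<lambda>e. c * x e) = (\<lambda>i. c * sv x i)"
  by (auto simp: sv_def fun_eq_iff lin_add lin_diff lin_scale)

lemma H_iff: "x \<in> H \<longleftrightarrow> x \<in> V \<and> sv x = (\<lambda>_. 0)"
  by (auto simp: H_def sv_def fun_eq_iff)

lemma sv_poly: "(\<lambda>x. sv x i) \<in> poly_fun"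
  by (cases "i < k") (auto simp: sv_def lin_def intro!: pf_intros)

lemma sv_fa: "fun_algebra R \<Longrightarrow> (\<And>e. (\<lambda>w. x w e) \<in> R) \<Longrightarrow> (\<lambda>w. sv (x w) i) \<in> R"
  using poly_fun_subst[OF sv_poly] by blast

lemma X0_X: "X0 \<subseteq> X"
  by (auto simp: X_def zariski_closure_iff)

lemma X_ext:
  assumes "p \<in> poly_fun" "\<And>a. a \<in> reg \<Longrightarrow> p (inv a) = 0" "x \<in> X"
  shows "p x = 0"
  using assms by (auto simp: X_def zariski_closure_iff X0_def)

lemma BB_affine: "affine_closed BB"
  by (auto simp: affine_closed_def BB_def)

lemma case_sum_BB: "case_sum s t \<in> BB \<longleftrightarrow> s \<in> supp"
  by (auto simp: BB_def supp_def)

lemma \<delta>_free: "(\<lambda>w. \<delta> (w \<circ> Inl)) \<in> poly_fun"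
  by (rule pf_subst[OF \<delta>]) (auto intro: pvar)

lemma num_free: "(\<lambda>w. num e (w \<circ> Inl)) \<in> poly_fun"
  by (rule pf_subst[OF num]) (auto intro: pvar)

lemma \<pi>_BB: "\<pi> w \<in> BB"
  by (simp add: \<pi>_def case_sum_BB sv_supp)

lemma PW_algebra: "fun_algebra (PW :: ((nat + 'f \<Rightarrow> complex) \<Rightarrow> complex) set)"
  unfolding fun_algebra_def
proof (intro conjI allI ballI)
  fix c
  show "(\<lambda>_. c) \<in> (PW :: ((nat + 'f \<Rightarrow> complex) \<Rightarrow> complex) set)"
    unfolding PW_def by (auto intro!: exI[of _ 0] bexI[of _ "\<lambda>_. c"] pconst)
next
  fix f g :: "(nat + 'f \<Rightarrow> complex) \<Rightarrow> complex"
  assume "f \<in> PW" "g \<in> PW"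
  then obtain m n p q where *: "p \<in> poly_fun" "\<forall>w\<in>\<Omega>. f w * \<delta> (w \<circ> Inl) ^ m = p w"
    "q \<in> poly_fun" "\<forall>w\<in>\<Omega>. g w * \<delta> (w \<circ> Inl) ^ n = q w" unfolding PW_def by blast
  show "(\<lambda>w. f w * g w) \<in> PW"
    unfolding PW_def
  proof (intro CollectI exI[of _ "m+n"] bexI[of _ "\<lambda>w. p w * q w"] ballI)
    fix w :: "nat + 'f \<Rightarrow> complex" assume "w \<in> \<Omega>"
    then have "p w * q w = (f w * \<delta> (w \<circ> Inl) ^ m) * (g w * \<delta> (w \<circ> Inl) ^ n)" using * by simp
    then show "f w * g w * \<delta> (w \<circ> Inl) ^ (m + n) = p w * q w" by (simp add: power_add)
  qed (intro pf_intros *)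
  show "(\<lambda>w. f w + g w) \<in> PW"
    unfolding PW_def
  proof (intro CollectI exI[of _ "m+n"] bexI[of _ "\<lambda>w. p w * \<delta> (w \<circ> Inl) ^ n + q w * \<delta> (w \<circ> Inl) ^ m"] ballI)
    fix w :: "nat + 'f \<Rightarrow> complex" assume "w \<in> \<Omega>"
    then have "p w * \<delta> (w \<circ> Inl) ^ n + q w * \<delta> (w \<circ> Inl) ^ m = (f w * \<delta> (w \<circ> Inl) ^ m) * \<delta> (w \<circ> Inl) ^ n + (g w * \<delta> (w \<circ> Inl) ^ n) * \<delta> (w \<circ> Inl) ^ m" using * by simp
    then show "(f w + g w) * \<delta> (w \<circ> Inl) ^ (m + n) = p w * \<delta> (w \<circ> Inl) ^ n + q w * \<delta> (w \<circ> Inl) ^ m"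
      by (simp add: power_add algebra_simps)
  qed (intro pf_intros * \<delta>_free)
qed

lemma PW_poly: "p \<in> poly_fun \<Longrightarrow> p \<in> PW"
  unfolding PW_def by (auto intro!: exI[of _ 0])

lemma PW_inv: "(\<lambda>w. inv (w \<circ> Inl) e) \<in> PW"
  unfolding PW_def
  by (intro CollectI exI[of _ 1] bexI[of _ "\<lambda>w. num e (w \<circ> Inl)"] num_free) (auto simp: inv_def \<Omega>_def)

lemma PW_\<pi>: "(\<lambda>w. \<pi> w v) \<in> PW"
proof (cases v)
  case (Inl i)
  then show ?thesis by (simp add: \<pi>_def sv_fa[OF PW_algebra] PW_inv)
next
  case (Inr f)
  then show ?thesis by (simp add: \<pi>_def PW_poly pvar)
qed

text \<open>Source and base have equally many coordinates, so the base coordinates together with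
  \<open>g\<close> are one function too many to be independent; this gives algebraicity. For
  dominance the auxiliary coordinates are frozen.\<close>

lemma cover:
  assumes dom: dominant_cone
  shows "alg_cover poly_fun (BB :: (nat + 'f::finite \<Rightarrow> complex) set) PW \<Omega> \<pi>"
proof
  show "fun_algebra (poly_fun :: ((nat + 'f \<Rightarrow> complex) \<Rightarrow> complex) set)" by (rule fun_algebra_poly_fun)
  show "fun_algebra (PW :: ((nat + 'f \<Rightarrow> complex) \<Rightarrow> complex) set)" by (rule PW_algebra)
  show "fun_domain (BB :: (nat + 'f \<Rightarrow> complex) set) poly_fun" by (rule poly_fun_domain[OF BB_affine])
  show "\<pi> w \<in> BB" for w :: "nat + 'f \<Rightarrow> complex" by (rule \<pi>_BB)
  show "(\<lambda>w. p (\<pi> w)) \<in> PW" if "p \<in> poly_fun" for p :: "(nat + 'f \<Rightarrow> complex) \<Rightarrow> complex"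
    by (rule poly_fun_subst[OF that PW_algebra PW_\<pi>])
  show "fun_domain (\<Omega> :: (nat + 'f \<Rightarrow> complex) set) PW"
    unfolding fun_domain_def
  proof (intro ballI impI)
    fix f g :: "(nat + 'f \<Rightarrow> complex) \<Rightarrow> complex"
    assume "f \<in> PW" "g \<in> PW" and nz: "\<exists>w\<in>\<Omega>. f w \<noteq> 0" "\<exists>w\<in>\<Omega>. g w \<noteq> 0"
    then obtain m n p q where *: "p \<in> poly_fun" "\<forall>w\<in>\<Omega>. f w * \<delta> (w \<circ> Inl) ^ m = p w"
      "q \<in> poly_fun" "\<forall>w\<in>\<Omega>. g w * \<delta> (w \<circ> Inl) ^ n = q w" unfolding PW_def by blast
    obtain w1 w2 where w1: "w1 \<in> \<Omega>" "f w1 \<noteq> 0" and w2: "w2 \<in> \<Omega>" "g w2 \<noteq> 0" using nz by blast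
    have B: "w1 \<in> BB" "w2 \<in> BB" and d: "\<delta> (w1 \<circ> Inl) \<noteq> 0" "\<delta> (w2 \<circ> Inl) \<noteq> 0" using w1 w2 by (auto simp: \<Omega>_def)
    have p1: "p w1 \<noteq> 0" using w1 d * by (metis mult_eq_0_iff power_not_zero)
    have q2: "q w2 \<noteq> 0" using w2 d * by (metis mult_eq_0_iff power_not_zero)
    have D: "fun_domain (BB :: (nat + 'f \<Rightarrow> complex) set) poly_fun" by (rule poly_fun_domain[OF BB_affine])
    \<comment> \<open>The additional factor \<open>\<delta>\<close> forces the common point of
      nonvanishing into \<open>\<Omega>\<close>.\<close>
    have pd: "(\<lambda>w. p w * \<delta> (w \<circ> Inl)) \<in> poly_fun" by (intro pf_intros * \<delta>_free)
    have pd1: "p w1 * \<delta> (w1 \<circ> Inl) \<noteq> 0" using p1 d by simp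
    obtain z where z: "z \<in> BB" "p z * \<delta> (z \<circ> Inl) \<noteq> 0" "q z \<noteq> 0"
      using fun_domainD[OF D pd *(3), of w1 w2] B pd1 q2 by blast
    then have "z \<in> \<Omega>" by (auto simp: \<Omega>_def)
    moreover have "f z \<noteq> 0" "g z \<noteq> 0" using * z \<open>z \<in> \<Omega>\<close> by (metis mult_zero_left)+
    ultimately show "\<exists>w\<in>\<Omega>. f w * g w \<noteq> 0" by auto
  qed
  show "\<exists>w\<in>\<Omega>. p (\<pi> w) \<noteq> 0" if p: "p \<in> poly_fun" "b \<in> BB" "p b \<noteq> 0"
    for p :: "(nat + 'f \<Rightarrow> complex) \<Rightarrow> complex" and b
  proof -
    let ?p = "\<lambda>s. p (case_sum s (b \<circ> Inr))"
    have pp: "?p \<in> poly_fun"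
      by (rule pf_subst[OF p(1)], rule case_sum_fa) (rule pvar pconst)+
    have bs: "case_sum (b \<circ> Inl) (b \<circ> Inr) = b" by (auto simp: fun_eq_iff split: sum.split)
    have "b \<circ> Inl \<in> supp" using p by (auto simp: supp_def BB_def)
    moreover have "?p (b \<circ> Inl) \<noteq> 0" using p bs by simp
    ultimately obtain x where "x \<in> X0" "?p (sv x) \<noteq> 0"
      using dom[unfolded dominant_cone_def, rule_format, OF pp] by metis
    then obtain a where a: "a \<in> reg" "?p (sv (inv a)) \<noteq> 0" by (auto simp: X0_def)
    have e: "case_sum a (b \<circ> Inr) \<circ> Inl = a" "case_sum a (b \<circ> Inr) \<circ> Inr = b \<circ> Inr" by (auto simp: fun_eq_iff)
    show ?thesis
      using a by (intro bexI[of _ "case_sum a (b \<circ> Inr)"]) (simp_all add: \<pi>_def e \<Omega>_def case_sum_BB reg_def)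
  qed
  show "\<exists>W\<in>cpoly poly_fun. (\<exists>b\<in>BB. W b \<noteq> 0) \<and> (\<forall>w\<in>\<Omega>. poly (W (\<pi> w)) (g w) = 0)"
    if g: "g \<in> PW" for g :: "(nat + 'f \<Rightarrow> complex) \<Rightarrow> complex"
  proof -
    obtain n p where p: "p \<in> poly_fun" "\<forall>w\<in>\<Omega>. g w * \<delta> (w \<circ> Inl) ^ n = p w" using g unfolding PW_def by blast
    let ?J = "Inl ` {..<k} \<union> range Inr :: (nat + 'f) set"
    let ?I = "insert None (Some ` ?J)"
    let ?d = "\<lambda>w::nat + 'f \<Rightarrow> complex. \<delta> (w \<circ> Inl)"
    \<comment> \<open>Numerators over the common denominator \<open>\<delta> ^ (n + 1)\<close>:
      \<open>g\<close> brings the denominator \<open>\<delta> ^ n\<close>, the projected coordinates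
      bring \<open>\<delta>\<close>, the auxiliary ones none.\<close>
    define q where "q = (\<lambda>i w. case i of None \<Rightarrow> p w * ?d w
       | Some v \<Rightarrow> (case v of Inl i \<Rightarrow> lin (\<beta> i) (\<lambda>e. num e (w \<circ> Inl)) * ?d w ^ n | Inr f \<Rightarrow> w (Inr f) * ?d w ^ (n+1)))"
    have finJ: "finite ?J" and finI: "finite ?I" by simp_all
    have "card ?I = card ?J + 1" by (simp add: card_image)
    then have less: "card ?J < card ?I" by simp
    have qp: "q i \<in> poly_fun" for i
    proof (cases i)
      case None
      then show ?thesis unfolding q_def by (simp, intro pf_intros p \<delta>_free)
    next
      case (Some v)
      then show ?thesis unfolding q_def
        by (cases v) (simp_all del: power_Suc, (intro pf_intros \<delta>_free lin_fa fun_algebra_poly_fun num_free)+)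
    qed
    have dp: "(\<lambda>w. ?d w ^ (n+1)) \<in> poly_fun" by (intro pf_intros \<delta>_free)
    obtain P where P: "P \<in> poly_fun" "\<exists>x. (\<forall>i. i \<notin> ?I \<longrightarrow> x i = 0) \<and> P x \<noteq> 0"
      "\<forall>w. (\<forall>v. v \<notin> ?J \<longrightarrow> w v = 0) \<longrightarrow> ?d w ^ (n+1) \<noteq> 0 \<longrightarrow> P (\<lambda>i. if i \<in> ?I then q i w / ?d w ^ (n+1) else 0) = 0"
      using algebraic_dependence[where q = q, OF finJ finI less qp dp] by (elim bexE conjE) (rule that)
    obtain W where W: "W \<in> cpoly poly_fun" "\<forall>b y. P (case_option y b) = poly (W b) y"
      using poly_fun_option_cpoly[OF P(1)] by blast
    obtain x where x: "\<forall>i. i \<notin> ?I \<longrightarrow> x i = 0" "P x \<noteq> 0" using P by blast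
    have "case_option (x None) (x \<circ> Some) = x" by (auto simp: fun_eq_iff split: option.split)
    then have "W (x \<circ> Some) \<noteq> 0" using W(2) x(2) by (metis poly_0)
    moreover have "x (Some (Inl i)) = 0" if "i \<ge> k" for i
    proof -
      have "Some (Inl i) \<notin> ?I" using that by auto
      then show ?thesis using x(1) by blast
    qed
    then have "x \<circ> Some \<in> BB" by (simp add: BB_def)
    moreover have "poly (W (\<pi> w)) (g w) = 0" if w: "w \<in> \<Omega>" for w
    proof -
      have wd: "?d w \<noteq> 0" "w \<in> BB" using w by (auto simp: \<Omega>_def)
      have w0: "w v = 0" if "v \<notin> ?J" for v
      proof (cases v)
        case (Inl i)
        then have "i \<ge> k" using that by (metis UnI1 image_eqI lessThan_iff not_le)
        then show ?thesis using wd(2) Inl by (simp add: BB_def)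
      qed (use that in auto)
      have "(\<lambda>i. if i \<in> ?I then q i w / ?d w ^ (n+1) else 0) = case_option (g w) (\<pi> w)"
      proof
        fix i
        show "(if i \<in> ?I then q i w / ?d w ^ (n+1) else 0) = case_option (g w) (\<pi> w) i"
        proof (cases i)
          case None
          have "p w = g w * ?d w ^ n" using p w by simp
          then show ?thesis using None wd by (simp add: q_def field_simps)
        next
          case (Some v)
          show ?thesis
          proof (cases v)
            case (Inl j)
            have "lin (\<beta> j) (inv (w \<circ> Inl)) = lin (\<beta> j) (\<lambda>e. num e (w \<circ> Inl)) / ?d w"
              using lin_scale[of "\<beta> j" "1 / ?d w"] by (simp add: inv_def[abs_def])
            then show ?thesis using Some Inl wd by (auto simp: q_def \<pi>_def sv_def)
          next
            case (Inr f)
            then show ?thesis using Some wd by (simp add: q_def \<pi>_def)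
          qed
        qed
      qed
      then show ?thesis using P(3)[rule_format, of w] w0 wd(1) W(2) by simp
    qed
    ultimately show ?thesis using W(1) by blast
  qed
qed

end

section \<open>Generic fibres of the projection\<close>


lemma poly_fun_partial_deriv:
  assumes "q \<in> poly_fun"
  shows "\<exists>q'\<in>poly_fun. \<forall>b. ((\<lambda>\<tau>. q (b(v := b v + \<tau>))) has_field_derivative q' b) (at 0)"
  using assms
proof induction
  case (pconst c)
  then show ?case by (intro bexI[of _ "\<lambda>_. 0"] poly_fun.pconst) auto
next
  case (pvar i)
  show ?case
  proof (cases "i = v")
    case True
    then show ?thesis by (intro bexI[of _ "\<lambda>_. 1"] poly_fun.pconst) (auto intro!: derivative_eq_intros)
  next
    case False
    then show ?thesis by (intro bexI[of _ "\<lambda>_. 0"] poly_fun.pconst) auto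
  qed
next
  case (padd p q)
  then obtain p' q' where "p' \<in> poly_fun" "\<forall>b. ((\<lambda>\<tau>. p (b(v := b v + \<tau>))) has_field_derivative p' b) (at 0)"
    "q' \<in> poly_fun" "\<forall>b. ((\<lambda>\<tau>. q (b(v := b v + \<tau>))) has_field_derivative q' b) (at 0)" by blast
  then show ?case by (intro bexI[of _ "\<lambda>b. p' b + q' b"] poly_fun.padd) (auto simp del: fun_upd_apply intro!: DERIV_add)
next
  case (pmult p q)
  then obtain p' q' where *: "p' \<in> poly_fun" "\<forall>b. ((\<lambda>\<tau>. p (b(v := b v + \<tau>))) has_field_derivative p' b) (at 0)"
    "q' \<in> poly_fun" "\<forall>b. ((\<lambda>\<tau>. q (b(v := b v + \<tau>))) has_field_derivative q' b) (at 0)" by blast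
  have "((\<lambda>\<tau>. p (b(v := b v + \<tau>)) * q (b(v := b v + \<tau>))) has_field_derivative p' b * q b + q' b * p b) (at 0)" for b
    using DERIV_mult[OF *(2)[rule_format, of b] *(4)[rule_format, of b]] by simp
  then show ?case
    by (intro bexI[of _ "\<lambda>b. p' b * q b + q' b * p b"] allI pf_intros pmult.hyps *)
qed

text \<open>The chain rule along a curve on which coordinate \<open>v\<close> moves with speed 1 and
  \<open>y\<close> with speed \<open>x\<close>. The value of a linear form moves in this way when
  one of its coefficients is perturbed and the point is kept.\<close>

lemma cpoly_partial_deriv:
  fixes Q :: "('v \<Rightarrow> complex) \<Rightarrow> complex poly"
  assumes Q: "Q \<in> cpoly poly_fun"
  shows "\<exists>Q'\<in>cpoly poly_fun. \<forall>b y x. ((\<lambda>\<tau>. poly (Q (b(v := b v + \<tau>))) (y + \<tau> * x)) has_field_derivative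
    poly (Q' b) y + x * poly (pderiv (Q b)) y) (at 0)"
proof -
  obtain e where e: "\<And>b. degree (Q b) \<le> e" using cpoly_degree[OF fun_algebra_poly_fun Q] by blast
  have "\<forall>j. \<exists>q'\<in>poly_fun. \<forall>b. ((\<lambda>\<tau>. coeff (Q (b(v := b v + \<tau>))) j) has_field_derivative q' b) (at 0)"
    using poly_fun_partial_deriv[OF cpoly_coeff[OF fun_algebra_poly_fun Q]] by blast
  then obtain q' where q': "\<And>j. q' j \<in> poly_fun"
    "\<And>j b. ((\<lambda>\<tau>. coeff (Q (b(v := b v + \<tau>))) j) has_field_derivative q' j b) (at 0)" by metis
  define Q' where "Q' = (\<lambda>b. \<Sum>j\<le>e. smult (q' j b) (monom 1 j))"
  have "Q' \<in> cpoly poly_fun" unfolding Q'_def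
    by (intro cpoly_sum cpoly_smult cpoly_fixed fun_algebra_poly_fun q')
  moreover have "((\<lambda>\<tau>. poly (Q (b(v := b v + \<tau>))) (y + \<tau> * x)) has_field_derivative
    poly (Q' b) y + x * poly (pderiv (Q b)) y) (at 0)" for b y x
  proof -
    have "((\<lambda>z. \<Sum>j\<le>e. coeff (Q b) j * z ^ j) has_field_derivative (\<Sum>j\<le>e. coeff (Q b) j * (of_nat j * y ^ (j - 1)))) (at y)"
      by (auto intro!: derivative_eq_intros sum.cong simp: mult_ac)
    then have "(poly (Q b) has_field_derivative (\<Sum>j\<le>e. coeff (Q b) j * (of_nat j * y ^ (j - 1)))) (at y)"
      by (subst poly_as_sum_le[OF e, of b, abs_def])
    then have D: "poly (pderiv (Q b)) y = (\<Sum>j\<le>e. coeff (Q b) j * (of_nat j * y ^ (j - 1)))"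
      using DERIV_unique poly_DERIV by blast
    have "((\<lambda>\<tau>. (y + \<tau> * x) ^ j) has_field_derivative x * (of_nat j * y ^ (j - 1))) (at 0)" for j
      by (auto intro!: derivative_eq_intros)
    then have "((\<lambda>\<tau>. \<Sum>j\<le>e. coeff (Q (b(v := b v + \<tau>))) j * (y + \<tau> * x) ^ j) has_field_derivative
      (\<Sum>j\<le>e. q' j b * (y + 0 * x) ^ j + x * (of_nat j * y ^ (j - 1)) * coeff (Q (b(v := b v + 0))) j)) (at 0)"
      by (intro DERIV_sum DERIV_mult q')
    moreover have "(\<Sum>j\<le>e. q' j b * (y + 0 * x) ^ j + x * (of_nat j * y ^ (j - 1)) * coeff (Q (b(v := b v + 0))) j)
      = poly (Q' b) y + x * poly (pderiv (Q b)) y"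
      by (simp add: Q'_def D poly_sum poly_monom sum.distrib sum_distrib_left mult_ac)
    ultimately show ?thesis using poly_as_sum_le[OF e] by simp
  qed
  ultimately show ?thesis by blast
qed

text \<open>Fractions are substituted into \<open>p\<close> and the denominators cleared; the result
  is a polynomial in \<open>y\<close> over the base and can be tested at the roots of
  \<open>Q\<close>.\<close>

lemma cpoly_homogenise:
  fixes N :: "'e \<Rightarrow> ('v \<Rightarrow> complex) \<Rightarrow> complex poly"
  assumes "p \<in> poly_fun" and N: "\<And>e. N e \<in> cpoly poly_fun" and D: "D \<in> cpoly poly_fun"
  shows "\<exists>G\<in>cpoly poly_fun. \<exists>n. \<forall>b y. poly (D b) y \<noteq> 0 \<longrightarrow>
    poly (G b) y = poly (D b) y ^ n * p (\<lambda>e. poly (N e b) y / poly (D b) y)"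
  using assms(1)
proof induction
  case (pconst c)
  then show ?case
    by (intro bexI[of _ "\<lambda>_. [:c:]"] exI[of _ 0] cpoly_fixed fun_algebra_poly_fun) auto
next
  case (pvar i)
  then show ?case by (intro bexI[of _ "N i"] exI[of _ 1] N) auto
next
  case (padd p q)
  then obtain F G m n where *: "F \<in> cpoly poly_fun" "G \<in> cpoly poly_fun"
    "\<forall>b y. poly (D b) y \<noteq> 0 \<longrightarrow> poly (F b) y = poly (D b) y ^ m * p (\<lambda>e. poly (N e b) y / poly (D b) y)"
    "\<forall>b y. poly (D b) y \<noteq> 0 \<longrightarrow> poly (G b) y = poly (D b) y ^ n * q (\<lambda>e. poly (N e b) y / poly (D b) y)" by blast
  show ?case
    by (intro bexI[of _ "\<lambda>b. F b * D b ^ n + G b * D b ^ m"] exI[of _ "m + n"])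
      (auto simp: * power_add algebra_simps intro!: cpoly_add cpoly_mult cpoly_power fun_algebra_poly_fun D)
next
  case (pmult p q)
  then obtain F G m n where *: "F \<in> cpoly poly_fun" "G \<in> cpoly poly_fun"
    "\<forall>b y. poly (D b) y \<noteq> 0 \<longrightarrow> poly (F b) y = poly (D b) y ^ m * p (\<lambda>e. poly (N e b) y / poly (D b) y)"
    "\<forall>b y. poly (D b) y \<noteq> 0 \<longrightarrow> poly (G b) y = poly (D b) y ^ n * q (\<lambda>e. poly (N e b) y / poly (D b) y)" by blast
  show ?case
    by (intro bexI[of _ "\<lambda>b. F b * G b"] exI[of _ "m + n"])
      (auto simp: * power_add algebra_simps intro!: cpoly_mult fun_algebra_poly_fun)
qed

lemma card_roots_simple:
  fixes p :: "complex poly"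
  assumes "p \<noteq> 0" and simple: "\<And>y. poly p y = 0 \<Longrightarrow> poly (pderiv p) y \<noteq> 0"
  shows "card {y. poly p y = 0} = degree p"
    and "p = smult (lead_coeff p) (\<Prod>y\<in>{y. poly p y = 0}. [:-y, 1:])"
proof -
  have sq: "rsquarefree p" using simple by (metis rsquarefree_roots)
  have *: "smult (lead_coeff p) (\<Prod>z|poly p z = 0. [:-z, 1:] ^ order z p) = p"
    by (rule complex_poly_decompose)
  have o1: "order z p = 1" if "poly p z = 0" for z
    using sq that \<open>p \<noteq> 0\<close> unfolding rsquarefree_def by (metis order_root)
  show **: "p = smult (lead_coeff p) (\<Prod>y\<in>{y. poly p y = 0}. [:-y, 1:])"
    using * o1 by (metis (mono_tags, lifting) mem_Collect_eq power_one_right prod.cong)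
  have "degree p = degree (\<Prod>y\<in>{y. poly p y = 0}. [:-y, 1:])"
    using \<open>p \<noteq> 0\<close> by (subst **) simp
  also have "\<dots> = card {y. poly p y = 0}" by (subst degree_prod_eq_sum_degree) auto
  finally show "card {y. poly p y = 0} = degree p" by simp
qed

text \<open>The outcome of \<open>simple_cover\<close> for the function \<open>t(x)\<close>. The
  name \<open>disc\<close> alludes to a discriminant: where it is nonzero, the degree does not drop,
  all roots are simple, and relations satisfied by \<open>t(x)\<close> hold at every root.\<close>

locale cone_relation = param_cone +
  fixes Q :: "(nat + 'a \<Rightarrow> complex) \<Rightarrow> complex poly" and d :: nat and disc :: "(nat + 'a \<Rightarrow> complex) \<Rightarrow> complex"
  assumes dom: dominant_cone
    and Q: "Q \<in> cpoly poly_fun" and disc: "disc \<in> poly_fun" and disc_nz: "\<exists>b\<in>BB. disc b \<noteq> 0"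
    and Q_vanish: "\<forall>w\<in>\<Omega>. poly (Q (\<pi> w)) (lin (w \<circ> Inr) (inv (w \<circ> Inl))) = 0"
    and Q_degree: "\<forall>b\<in>BB. degree (Q b) \<le> d"
    and Q_lead: "b \<in> BB \<Longrightarrow> disc b \<noteq> 0 \<Longrightarrow> coeff (Q b) d \<noteq> 0"
    and Q_simple: "b \<in> BB \<Longrightarrow> disc b \<noteq> 0 \<Longrightarrow> poly (Q b) y = 0 \<Longrightarrow> poly (pderiv (Q b)) y \<noteq> 0"
    and Q_roots: "b \<in> BB \<Longrightarrow> disc b \<noteq> 0 \<Longrightarrow> poly (Q b) y = 0 \<Longrightarrow> G \<in> cpoly poly_fun \<Longrightarrow>
       \<forall>w\<in>\<Omega>. poly (G (\<pi> w)) (lin (w \<circ> Inr) (inv (w \<circ> Inl))) = 0 \<Longrightarrow> poly (G b) y = 0"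

lemma (in param_cone) cone_relation_exists:
  assumes dominant_cone
  shows "\<exists>Q d disc. cone_relation k \<beta> dv V \<delta> num Q d disc"
proof -
  interpret alg_cover poly_fun "BB :: (nat + 'e \<Rightarrow> complex) set" PW \<Omega> \<pi>
    by (rule cover[OF assms])
  have f: "(\<lambda>w::nat + 'e \<Rightarrow> complex. lin (w \<circ> Inr) (inv (w \<circ> Inl))) \<in> PW"
    by (intro lin_fa PW_algebra PW_inv PW_poly) (simp add: pvar)
  show ?thesis
    by (rule simple_cover[OF f], intro exI, unfold_locales) (use assms in assumption)+
qed

context cone_relation
begin

definition Fib :: "(nat \<Rightarrow> complex) \<Rightarrow> ('a \<Rightarrow> complex) set" where
  "Fib s = {x\<in>X. sv x = s}"

lemma Omega_case: "case_sum a t \<in> \<Omega> \<longleftrightarrow> a \<in> reg"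
  by (auto simp: \<Omega>_def case_sum_BB reg_def comp_def)

text \<open>For fixed \<open>t\<close> the claim is a polynomial identity in \<open>x\<close>, so it
  extends from the parametrised points to their closure.\<close>

lemma X_relation:
  assumes G: "G \<in> cpoly poly_fun" and *: "\<forall>w\<in>\<Omega>. poly (G (\<pi> w)) (lin (w \<circ> Inr) (inv (w \<circ> Inl))) = 0"
    and x: "x \<in> X"
  shows "poly (G (case_sum (sv x) t)) (lin t x) = 0"
proof -
  have "(\<lambda>x. poly (G (case_sum (sv x) t)) (lin t x)) \<in> poly_fun"
  proof (rule cpoly_eval[OF fun_algebra_poly_fun G fun_algebra_poly_fun])
    fix p :: "(nat + 'a \<Rightarrow> complex) \<Rightarrow> complex" assume "p \<in> poly_fun"
    then show "(\<lambda>x. p (case_sum (sv x) t)) \<in> poly_fun"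
      by (rule pf_subst) (rule case_sum_fa, rule sv_poly, rule pconst)
  qed (intro lin_fa fun_algebra_poly_fun pconst pvar)
  then show ?thesis
  proof (rule X_ext[OF _ _ x])
    fix a assume "a \<in> reg"
    then have "case_sum a t \<in> \<Omega>" by (simp add: Omega_case)
    then show "poly (G (case_sum (sv (inv a)) t)) (lin t (inv a)) = 0"
      using *[rule_format, of "case_sum a t"] by (simp add: \<pi>_def comp_def)
  qed
qed

lemmas X_Q = X_relation[OF Q Q_vanish]

text \<open>When the coefficient \<open>t e\<close> moves by \<open>\<tau>\<close> and
  \<open>x\<close> stays, the root \<open>lin t x\<close> moves by \<open>\<tau> * x e\<close> while
  \<open>Q\<close> remains zero; the derivative at \<open>\<tau> = 0\<close> is the identity. It
  makes \<open>x e\<close> a quotient of functions of projection, form and root.\<close>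

lemma kronecker:
  "\<exists>Q'\<in>cpoly poly_fun. (\<forall>x\<in>X. \<forall>t. poly (Q' (case_sum (sv x) t)) (lin t x) = - (x e * poly (pderiv (Q (case_sum (sv x) t))) (lin t x)))
    \<and> (\<forall>w\<in>\<Omega>. poly (Q' (\<pi> w)) (lin (w \<circ> Inr) (inv (w \<circ> Inl))) = - (inv (w \<circ> Inl) e * poly (pderiv (Q (\<pi> w))) (lin (w \<circ> Inr) (inv (w \<circ> Inl)))))"
proof -
  obtain Q' where Q': "Q' \<in> cpoly poly_fun"
    and D: "\<And>b y x. ((\<lambda>\<tau>. poly (Q (b(Inr e := b (Inr e) + \<tau>))) (y + \<tau> * x)) has_field_derivative
      poly (Q' b) y + x * poly (pderiv (Q b)) y) (at 0)" using cpoly_partial_deriv[OF Q, of "Inr e"] by blast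
  have *: "poly (Q' (case_sum (sv x) t)) (lin t x) = - (x e * poly (pderiv (Q (case_sum (sv x) t))) (lin t x))"
    if x: "x \<in> X" for x t
  proof -
    let ?b = "case_sum (sv x) t"
    have "poly (Q (?b(Inr e := ?b (Inr e) + \<tau>))) (lin t x + \<tau> * x e) = 0" for \<tau>
    proof -
      let ?t = "t(e := t e + \<tau>)"
      have 1: "?b(Inr e := ?b (Inr e) + \<tau>) = case_sum (sv x) ?t"
        by (auto simp: fun_eq_iff split: sum.split)
      have "lin ?t x = (\<Sum>e'\<in>UNIV. t e' * x e' + (if e' = e then \<tau> * x e' else 0))"
        unfolding lin_def by (intro sum.cong refl) (auto simp: algebra_simps)
      also have "\<dots> = lin t x + \<tau> * x e" by (simp add: sum.distrib lin_def)
      finally show ?thesis using X_Q[OF x, of ?t] 1 by simp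
    qed
    then have "((\<lambda>\<tau>. 0) has_field_derivative poly (Q' ?b) (lin t x) + x e * poly (pderiv (Q ?b)) (lin t x)) (at 0)"
      using D[of ?b "lin t x" "x e"] by simp
    then have "poly (Q' ?b) (lin t x) + x e * poly (pderiv (Q ?b)) (lin t x) = 0"
      using DERIV_unique DERIV_const by blast
    then show ?thesis by (simp add: eq_neg_iff_add_eq_0)
  qed
  moreover have "poly (Q' (\<pi> w)) (lin (w \<circ> Inr) (inv (w \<circ> Inl))) = - (inv (w \<circ> Inl) e * poly (pderiv (Q (\<pi> w))) (lin (w \<circ> Inr) (inv (w \<circ> Inl))))"
    if w: "w \<in> \<Omega>" for w
  proof -
    have "w \<circ> Inl \<in> reg" using w by (auto simp: \<Omega>_def reg_def BB_def supp_def)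
    then have "inv (w \<circ> Inl) \<in> X" using X0_X by (auto simp: X0_def)
    then show ?thesis using * by (simp add: \<pi>_def)
  qed
  ultimately show ?thesis using Q' by blast
qed

lemma Fib_separated:
  assumes "x \<in> Fib s" "x' \<in> Fib s" "lin t x = lin t x'"
    "poly (pderiv (Q (case_sum s t))) (lin t x) \<noteq> 0"
  shows "x = x'"
proof
  fix e
  obtain Q' where "\<forall>x\<in>X. \<forall>t. poly (Q' (case_sum (sv x) t)) (lin t x) = - (x e * poly (pderiv (Q (case_sum (sv x) t))) (lin t x))"
    using kronecker[of e] by blast
  then have "- (x e * poly (pderiv (Q (case_sum s t))) (lin t x)) = - (x' e * poly (pderiv (Q (case_sum s t))) (lin t x))"
    using assms(1-3) unfolding Fib_def by (metis (mono_tags, lifting) mem_Collect_eq)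
  then show "x e = x' e" using assms(4) by simp
qed

lemma lin_mult: "(\<Sum>e\<in>UNIV. u e * (x e * c)) = lin u x * c"
  by (simp add: lin_def sum_distrib_right mult.assoc)

lemma \<pi>_sv: "i < k \<Longrightarrow> \<pi> w (Inl i) = lin (\<beta> i) (inv (w \<circ> Inl))"
  and \<pi>_free: "\<pi> w (Inr e) = (w \<circ> Inr) e"
  by (simp_all add: \<pi>_def sv_def)

text \<open>The Kronecker quotients at an arbitrary root \<open>y\<close> define a candidate
  \<open>x\<close>. Each property demanded of it is a polynomial relation that holds along the
  cover, and \<open>Q_roots\<close> transfers such relations to \<open>y\<close>.\<close>

lemma root_lift:
  assumes s: "s \<in> supp" and nz: "disc (case_sum s t) \<noteq> 0" and y: "poly (Q (case_sum s t)) y = 0"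
  shows "\<exists>x\<in>Fib s. lin t x = y"
proof -
  let ?b = "case_sum s t"
  have b: "?b \<in> BB" using s by (simp add: case_sum_BB)
  let ?D = "\<lambda>b. pderiv (Q b)"
  have D: "?D \<in> cpoly poly_fun" by (intro cpoly_pderiv fun_algebra_poly_fun Q)
  obtain N where N: "\<And>e. N e \<in> cpoly poly_fun"
    and Nw: "\<And>e w. w\<in>\<Omega> \<Longrightarrow> poly (N e (\<pi> w)) (lin (w \<circ> Inr) (inv (w \<circ> Inl))) = - (inv (w \<circ> Inl) e * poly (?D (\<pi> w)) (lin (w \<circ> Inr) (inv (w \<circ> Inl))))"
    using kronecker by metis
  let ?N = "\<lambda>e b. - N e b"
  have N': "?N e \<in> cpoly poly_fun" for e by (intro cpoly_uminus fun_algebra_poly_fun N)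
  have Dy: "poly (?D ?b) y \<noteq> 0" by (rule Q_simple[OF b nz y])
  define x where "x = (\<lambda>e. poly (?N e ?b) y / poly (?D ?b) y)"
  have xe: "poly (N e ?b) y = - (x e * poly (?D ?b) y)" for e using Dy by (simp add: x_def)
  have "x \<in> X"
    unfolding X_def zariski_closure_iff
  proof (intro ballI impI)
    fix p :: "('a \<Rightarrow> complex) \<Rightarrow> complex" assume p: "p \<in> poly_fun" "\<forall>y\<in>X0. p y = 0"
    obtain G n where G: "G \<in> cpoly poly_fun" "\<And>b y. poly (?D b) y \<noteq> 0 \<Longrightarrow>
      poly (G b) y = poly (?D b) y ^ n * p (\<lambda>e. poly (?N e b) y / poly (?D b) y)"
      using cpoly_homogenise[where N = ?N and D = ?D, OF p(1) N' D] by blast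
    \<comment> \<open>The factor \<open>?D b\<close> disposes of the points of
      \<open>\<Omega>\<close> where the derivative vanishes and nothing is known about
      \<open>G\<close>.\<close>
    have "poly (?D ?b * G ?b) y = 0"
    proof (rule Q_roots[OF b nz y, of "\<lambda>b. ?D b * G b"])
      show "(\<lambda>b. ?D b * G b) \<in> cpoly poly_fun" by (intro cpoly_mult fun_algebra_poly_fun D G)
      show "\<forall>w\<in>\<Omega>. poly (?D (\<pi> w) * G (\<pi> w)) (lin (w \<circ> Inr) (inv (w \<circ> Inl))) = 0"
      proof
        fix w :: "nat + 'a \<Rightarrow> complex" assume w: "w \<in> \<Omega>"
        let ?y = "lin (w \<circ> Inr) (inv (w \<circ> Inl))"
        show "poly (?D (\<pi> w) * G (\<pi> w)) ?y = 0"
        proof (cases "poly (?D (\<pi> w)) ?y = 0")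
          case False
          have "(\<lambda>e. poly (?N e (\<pi> w)) ?y / poly (?D (\<pi> w)) ?y) = inv (w \<circ> Inl)"
            using Nw[OF w] False by (simp add: fun_eq_iff)
          moreover have "inv (w \<circ> Inl) \<in> X0" using w by (auto simp: X0_def \<Omega>_def reg_def BB_def supp_def)
          ultimately show ?thesis using G(2)[OF False] p(2) by simp
        qed simp
      qed
    qed
    then have "poly (G ?b) y = 0" using Dy by simp
    then show "p x = 0" using G(2)[OF Dy] Dy by (simp add: x_def)
  qed
  moreover have "sv x = s"
  proof
    fix i
    show "sv x i = s i"
    proof (cases "i < k")
      case True
      \<comment> \<open>The identity between \<open>s i\<close> and
        \<open>lin (\<beta> i) x\<close>, multiplied by the derivative so that \<open>N e\<close>,
        which stands for \<open>- x e\<close> times the derivative, can be used.\<close>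
      let ?G = "\<lambda>b. smult (b (Inl i)) (?D b) + (\<Sum>e\<in>UNIV. smult (\<beta> i e) (N e b))"
      have "poly (?G ?b) y = 0"
      proof (rule Q_roots[OF b nz y])
        show "?G \<in> cpoly poly_fun"
          by (intro cpoly_add cpoly_sum cpoly_smult fun_algebra_poly_fun D N pvar pconst)
        show "\<forall>w\<in>\<Omega>. poly (?G (\<pi> w)) (lin (w \<circ> Inr) (inv (w \<circ> Inl))) = 0"
        proof
          fix w :: "nat + 'a \<Rightarrow> complex" assume w: "w \<in> \<Omega>"
          show "poly (?G (\<pi> w)) (lin (w \<circ> Inr) (inv (w \<circ> Inl))) = 0"
            using True by (simp add: poly_sum Nw[OF w] lin_mult sum_negf \<pi>_sv)
        qed
      qed
      then have "s i * poly (?D ?b) y - lin (\<beta> i) x * poly (?D ?b) y = 0"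
        by (simp add: poly_sum xe lin_mult sum_negf)
      then show ?thesis using Dy True by (simp add: sv_def left_diff_distrib[symmetric])
    qed (use s in \<open>auto simp: sv_def supp_def\<close>)
  qed
  moreover have "lin t x = y"
  proof -
    let ?G = "\<lambda>b. [:0,1:] * ?D b + (\<Sum>e\<in>UNIV. smult (b (Inr e)) (N e b))"
    have "poly (?G ?b) y = 0"
    proof (rule Q_roots[OF b nz y])
      show "?G \<in> cpoly poly_fun"
        by (intro cpoly_add cpoly_sum cpoly_smult cpoly_mult cpoly_fixed fun_algebra_poly_fun D N pvar)
      show "\<forall>w\<in>\<Omega>. poly (?G (\<pi> w)) (lin (w \<circ> Inr) (inv (w \<circ> Inl))) = 0"
      proof
        fix w :: "nat + 'a \<Rightarrow> complex" assume w: "w \<in> \<Omega>"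
        have L: "lin (\<lambda>e. w (Inr e)) = lin (w \<circ> Inr)" by (simp add: comp_def)
        show "poly (?G (\<pi> w)) (lin (w \<circ> Inr) (inv (w \<circ> Inl))) = 0"
          by (simp add: poly_sum Nw[OF w] lin_mult sum_negf \<pi>_free L)
      qed
    qed
    then have "y * poly (?D ?b) y - lin t x * poly (?D ?b) y = 0"
      by (simp add: poly_sum xe lin_mult sum_negf)
    then show ?thesis using Dy by (simp add: left_diff_distrib[symmetric])
  qed
  ultimately show ?thesis by (auto simp: Fib_def)
qed

lemma Fib_bij:
  assumes s: "s \<in> supp" and nz: "disc (case_sum s t) \<noteq> 0"
  shows "bij_betw (lin t) (Fib s) {y. poly (Q (case_sum s t)) y = 0}"
proof (rule bij_betw_imageI)
  have b: "case_sum s t \<in> BB" using s by (simp add: case_sum_BB)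
  have root: "poly (Q (case_sum s t)) (lin t x) = 0" if "x \<in> Fib s" for x
    using that X_Q[of x t] by (auto simp: Fib_def)
  show "inj_on (lin t) (Fib s)"
    using Fib_separated Q_simple[OF b nz root] by (auto intro!: inj_onI)
  show "lin t ` Fib s = {y. poly (Q (case_sum s t)) y = 0}"
    using root root_lift[OF s nz] by auto
qed

lemma Fib_card:
  assumes s: "s \<in> supp" and nz: "disc (case_sum s t) \<noteq> 0"
  shows "finite (Fib s)" "card (Fib s) = d"
    "Q (case_sum s t) = smult (coeff (Q (case_sum s t)) d) (\<Prod>x\<in>Fib s. [:- lin t x, 1:])"
proof -
  let ?b = "case_sum s t"
  have b: "?b \<in> BB" using s by (simp add: case_sum_BB)
  have lead: "coeff (Q ?b) d \<noteq> 0" by (rule Q_lead[OF b nz])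
  then have Q0: "Q ?b \<noteq> 0" by auto
  have "degree (Q ?b) \<le> d" using Q_degree b by blast
  then have deg: "degree (Q ?b) = d" using le_degree[OF lead] by simp
  note bij = Fib_bij[OF s nz]
  show "finite (Fib s)" using bij_betw_finite[OF bij] poly_roots_finite[OF Q0] by simp
  show "card (Fib s) = d"
    using bij_betw_same_card[OF bij] card_roots_simple(1)[OF Q0 Q_simple[OF b nz]] deg by simp
  have "Q ?b = smult (lead_coeff (Q ?b)) (\<Prod>y\<in>{y. poly (Q ?b) y = 0}. [:-y, 1:])"
    by (rule card_roots_simple(2)[OF Q0 Q_simple[OF b nz]])
  also have "(\<Prod>y\<in>{y. poly (Q ?b) y = 0}. [:-y, 1:]) = (\<Prod>x\<in>Fib s. [:- lin t x, 1:])"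
    by (rule prod.reindex_bij_betw[OF bij, symmetric])
  finally show "Q ?b = smult (coeff (Q ?b) d) (\<Prod>x\<in>Fib s. [:- lin t x, 1:])" by (simp only: deg)
qed

end

section \<open>The join with the polar space\<close>


definition plk :: "('e \<Rightarrow> complex) \<Rightarrow> ('e \<Rightarrow> complex) \<Rightarrow> 'e \<times> 'e \<Rightarrow> complex" where
  "plk u v = (\<lambda>(e, e'). u e * v e' - u e' * v e)"

text \<open>Contraction of a bivector with a linear form. On the line through \<open>u\<close> and
  \<open>v\<close> it picks, if nonzero, the point where \<open>l\<close> vanishes, and it depends
  polynomially on the Pluecker vector.\<close>

definition contract :: "('e::finite \<Rightarrow> complex) \<Rightarrow> ('e \<times> 'e \<Rightarrow> complex) \<Rightarrow> 'e \<Rightarrow> complex" where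
  "contract l p e = (\<Sum>e'\<in>UNIV. p (e, e') * l e')"

lemma contract_plk: "contract l (plk u v) = (\<lambda>e. lin l v * u e - lin l u * v e)"
proof
  fix e
  have "contract l (plk u v) e = (\<Sum>e'\<in>UNIV. l e' * v e' * u e - l e' * u e' * v e)"
    by (simp add: contract_def plk_def algebra_simps)
  then show "contract l (plk u v) e = lin l v * u e - lin l u * v e"
    by (simp add: lin_def sum_subtractf sum_distrib_right)
qed

lemma contract_poly: "(\<lambda>p. contract l p e) \<in> poly_fun"
  unfolding contract_def by (intro pf_intros)

text \<open>The retraction \<open>pr\<close> onto \<open>V\<close>, in the application
  symmetrisation, lets auxiliary vectors range over the full coordinate space.
  \<open>inv_scale\<close> makes \<open>X\<close> a cone, and \<open>H_kernel\<close> is the form in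
  which codimension at least two enters.\<close>

locale reciprocal_cone = param_cone k \<beta> dv V \<delta> num
  for k :: nat and \<beta> dv :: "nat \<Rightarrow> 'e::finite \<Rightarrow> complex" and V :: "('e \<Rightarrow> complex) set"
    and \<delta> :: "(nat \<Rightarrow> complex) \<Rightarrow> complex" and num :: "'e \<Rightarrow> (nat \<Rightarrow> complex) \<Rightarrow> complex" +
  fixes pr :: "('e \<Rightarrow> complex) \<Rightarrow> 'e \<Rightarrow> complex"
  assumes pr_poly: "(\<lambda>h. pr h e) \<in> poly_fun" and pr_V: "pr h \<in> V"
    and pr_id: "h \<in> V \<Longrightarrow> pr h = h" and pr_add: "pr (\<lambda>e. x e + y e) = (\<lambda>e. pr x e + pr y e)"
    and inv_V: "a \<in> reg \<Longrightarrow> inv a \<in> V"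
    and inv_scale: "a \<in> reg \<Longrightarrow> c \<noteq> 0 \<Longrightarrow> \<exists>a'\<in>reg. inv a' = (\<lambda>e. c * inv a e)"
    and H_kernel: "\<exists>\<gamma>\<in>H. \<gamma> \<noteq> (\<lambda>_. 0) \<and> lin t \<gamma> = 0"
begin

lemma X_V: "x \<in> X \<Longrightarrow> x \<in> V"
proof -
  assume x: "x \<in> X"
  have "X0 \<subseteq> V" using inv_V by (auto simp: X0_def)
  then show ?thesis using x V_closed unfolding X_def zariski_closure_def by blast
qed

text \<open>Scaling by \<open>c \<noteq> 0\<close> maps parametrised points to parametrised points,
  hence preserves the closure. The origin is reached as a limit: a polynomial that vanishes at all
  nonzero multiples of \<open>x\<close> also vanishes at 0.\<close>

lemma X_scale:
  assumes x: "x \<in> X" shows "(\<lambda>e. c * x e) \<in> X"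
proof -
  have nz: "(\<lambda>e. c * x e) \<in> X" if "c \<noteq> 0" for c
    unfolding X_def zariski_closure_iff
  proof (intro ballI impI)
    fix p :: "('e \<Rightarrow> complex) \<Rightarrow> complex" assume p: "p \<in> poly_fun" "\<forall>y\<in>X0. p y = 0"
    have "(\<lambda>x. p (\<lambda>e. c * x e)) \<in> poly_fun" by (rule pf_subst[OF p(1)]) (intro pf_intros)
    then show "p (\<lambda>e. c * x e) = 0"
    proof (rule X_ext[OF _ _ x])
      fix a assume "a \<in> reg"
      then obtain a' where a': "a' \<in> reg" "inv a' = (\<lambda>e. c * inv a e)" using inv_scale[of a c] \<open>c \<noteq> 0\<close> by blast
      have "p (inv a') = 0" using p(2) a'(1) by (simp add: X0_def)
      then show "p (\<lambda>e. c * inv a e) = 0" unfolding a'(2) .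
    qed
  qed
  have "(\<lambda>e. 0 * x e) \<in> X"
    unfolding X_def zariski_closure_iff
  proof (intro ballI impI)
    fix p :: "('e \<Rightarrow> complex) \<Rightarrow> complex" assume p: "p \<in> poly_fun" "\<forall>y\<in>X0. p y = 0"
    obtain P where P: "\<And>\<tau>. p (\<lambda>i. 0 + \<tau> * x i) = poly P \<tau>"
      by (rule poly_fun_line[OF p(1), of "\<lambda>_. 0" x], rule that)
    have "poly P \<tau> = 0" if "\<tau> \<noteq> 0" for \<tau>
    proof -
      have "p (\<lambda>e. \<tau> * x e) = 0" using nz[OF that] p unfolding X_def zariski_closure_iff by blast
      then show ?thesis using P[of \<tau>] by simp
    qed
    then have "poly (P * [:0,1:]) \<tau> = 0" for \<tau> by (cases "\<tau> = 0") auto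
    then have "P * [:0,1:] = 0" using poly_all_0_iff_0 by blast
    then show "p (\<lambda>e. 0 * x e) = 0" using P[of 0] by simp
  qed
  then show ?thesis using nz by (cases "c = 0") auto
qed

text \<open>An upper bound for the Pluecker vectors of joining lines. Independence of
  \<open>x\<close> and \<open>\<gamma>\<close> is not demanded, and scalar factors can be absorbed
  into \<open>x\<close> because \<open>X\<close> is a cone.\<close>

definition join_plk :: "('e \<times> 'e \<Rightarrow> complex) set" where
  "join_plk = {plk x \<gamma> | x \<gamma>. x \<in> X \<and> \<gamma> \<in> H}"

text \<open>Contracting \<open>plk x \<gamma>\<close> gives
  \<open>lin l \<gamma> * x - lin l x * \<gamma>\<close>, which projects like a multiple of
  \<open>x\<close> and so satisfies \<open>p\<close>. This condition is polynomial in the Pluecker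
  vector, and at \<open>plk S v\<close> the contraction is \<open>S\<close>.\<close>

lemma degenerate_join:
  assumes p: "p \<in> poly_fun" "\<forall>x\<in>X0. p (sv x) = 0"
    and A: "A \<subseteq> join_plk" and v: "plk S v \<in> zariski_closure A" and l: "lin l v = 1" "lin l S = 0"
  shows "p (sv S) = 0"
proof -
  have psv: "(\<lambda>x. p (sv x)) \<in> poly_fun" by (rule pf_subst[OF p(1) sv_poly])
  have pX: "p (sv x) = 0" if "x \<in> X" for x
    by (rule X_ext[OF psv _ that]) (use p in \<open>auto simp: X0_def\<close>)
  have poly: "(\<lambda>q. p (sv (contract l q))) \<in> poly_fun"
    by (rule pf_subst[OF psv contract_poly])
  have zero: "p (sv (contract l q)) = 0" if qA: "q \<in> A" for q
  proof -
    obtain x \<gamma> where q: "q = plk x \<gamma>" "x \<in> X" "\<gamma> \<in> H" using subsetD[OF A qA] unfolding join_plk_def by blast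
    have "sv (contract l q) = sv (\<lambda>e. lin l \<gamma> * x e)"
      using q(3) by (simp add: q(1) contract_plk sv_diff sv_scale H_iff)
    then show ?thesis using pX[OF X_scale[OF q(2)]] by simp
  qed
  have "p (sv (contract l (plk S v))) = 0"
    by (rule zariski_closure_iff[THEN iffD1, OF v, rule_format, OF poly zero])
  then show ?thesis using l by (simp add: contract_plk)
qed

definition pH :: "('e \<Rightarrow> complex) \<Rightarrow> 'e \<Rightarrow> complex" where
  "pH h = (\<lambda>e. pr h e - sec (sv (pr h)) e)"

lemma pH_H: "pH h \<in> H"
  by (simp add: pH_def H_iff V_diff pr_V sec_V sv_diff sv_sec sv_supp)

lemma pH_id: "h \<in> H \<Longrightarrow> pH h = h"
  by (simp add: pH_def H_iff pr_id sec_def)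

lemma pH_add: "pH (\<lambda>e. x e + y e) = (\<lambda>e. pH x e + pH y e)"
  by (simp add: pH_def pr_add sv_add sec_def algebra_simps sum.distrib)

lemma pH_poly: "(\<lambda>h. pH h e) \<in> poly_fun"
  unfolding pH_def sec_def
  by (intro pf_intros pr_poly sv_fa[OF fun_algebra_poly_fun])

end

locale reciprocal_relation = reciprocal_cone k \<beta> dv V \<delta> num pr + cone_relation k \<beta> dv V \<delta> num Q d disc
  for k :: nat and \<beta> dv :: "nat \<Rightarrow> 'e::finite \<Rightarrow> complex" and V :: "('e \<Rightarrow> complex) set"
    and \<delta> :: "(nat \<Rightarrow> complex) \<Rightarrow> complex" and num :: "'e \<Rightarrow> (nat \<Rightarrow> complex) \<Rightarrow> complex"
    and pr :: "('e \<Rightarrow> complex) \<Rightarrow> 'e \<Rightarrow> complex"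
    and Q :: "(nat + 'e \<Rightarrow> complex) \<Rightarrow> complex poly" and d :: nat and disc :: "(nat + 'e \<Rightarrow> complex) \<Rightarrow> complex"
begin

lemma bdeg_linear_form: "bdeg 1 (\<lambda>t. y + lin t x * c)"
proof -
  have "bdeg (1 + 0) (\<lambda>t. \<Sum>e\<in>UNIV. t e * x e)"
    by (intro bdeg_sum bdeg_mult bdeg_var bdeg_const)
  then have "bdeg (1 + 0) (\<lambda>t. (\<Sum>e\<in>UNIV. t e * x e) * c)"
    by (intro bdeg_mult[OF _ bdeg_const]) simp
  then show ?thesis unfolding lin_def by (intro bdeg_add bdeg_const) simp
qed

text \<open>
  The leading coefficient of \<open>Q\<close> may depend on \<open>t\<close>.  The product over the fibre has degree at most
  \<open>d\<close> in each coordinate of \<open>t\<close>, so it is interpolated from fixed nodes \<open>t\<close> at which that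
  coefficient is nonzero.
\<close>
lemma universal_relation:
  "\<exists>C\<in>poly_fun. \<exists>\<Theta>\<in>cpoly poly_fun. (\<exists>s\<in>supp. C s \<noteq> 0) \<and>
    (\<forall>s\<in>supp. C s \<noteq> 0 \<longrightarrow> finite (Fib s) \<and> card (Fib s) = d \<and>
       (\<forall>t. \<Theta> (case_sum s t) = smult (C s) (\<Prod>x\<in>Fib s. [:- lin t x, 1:]))) \<and>
    (\<forall>x\<in>X. \<forall>t. poly (\<Theta> (case_sum (sv x) t)) (lin t x) = 0)"
proof -
  let ?G = "grid (UNIV :: 'e set) d"
  have finG: "finite ?G" by (simp add: finite_PiE)
  let ?c = "\<lambda>b. coeff (Q b) d * disc b"
  have cp: "?c \<in> poly_fun" by (intro pf_intros cpoly_coeff[OF fun_algebra_poly_fun] Q disc)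
  let ?n = "node (UNIV :: 'e set)"
  have "\<exists>b\<in>BB. (\<Prod>g\<in>?G. ?c (case_sum (b \<circ> Inl) (?n (b \<circ> Inr) g))) \<noteq> 0"
  proof (rule fun_domain_prod[OF poly_fun_domain[OF BB_affine] fun_algebra_poly_fun finG])
    show "(BB :: (nat + 'e \<Rightarrow> complex) set) \<noteq> {}" using disc_nz by blast
  next
    fix g assume "g \<in> ?G"
    show "(\<lambda>b. ?c (case_sum (b \<circ> Inl) (?n (b \<circ> Inr) g))) \<in> poly_fun"
      by (rule pf_subst[OF cp], rule case_sum_fa) (simp_all add: node_def pvar padd pconst)
    obtain b where b: "b \<in> BB" "disc b \<noteq> 0" using disc_nz by blast
    then have c: "?c b \<noteq> 0" using Q_lead by simp
    \<comment> \<open>The form is shifted back so that the node with index \<open>g\<close> falls on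
      \<open>b\<close>, where \<open>?c\<close> is nonzero.\<close>
    let ?b = "case_sum (b \<circ> Inl) (\<lambda>e. b (Inr e) - of_nat (g e))"
    have e: "case_sum (?b \<circ> Inl) (?n (?b \<circ> Inr) g) = b"
      by (auto simp: fun_eq_iff node_def split: sum.split)
    have "?b \<in> BB" using b(1) by (simp add: BB_def)
    moreover have "?c (case_sum (?b \<circ> Inl) (?n (?b \<circ> Inr) g)) \<noteq> 0" unfolding e by (rule c)
    ultimately show "\<exists>b\<in>BB. ?c (case_sum (b \<circ> Inl) (?n (b \<circ> Inr) g)) \<noteq> 0" by (intro bexI[of _ ?b])
  qed
  then obtain b where b: "b \<in> BB" and bnz: "(\<Prod>g\<in>?G. ?c (case_sum (b \<circ> Inl) (?n (b \<circ> Inr) g))) \<noteq> 0" by blast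
  define N where "N = ?n (b \<circ> Inr)"
  define C where "C = (\<lambda>s. \<Prod>g\<in>?G. ?c (case_sum s (N g)))"
  have cN: "(\<lambda>s. ?c (case_sum s (N g))) \<in> poly_fun" for g
    by (rule pf_subst[OF cp], rule case_sum_fa) (rule pvar pconst)+
  have Cp: "C \<in> poly_fun" unfolding C_def by (rule pf_prod, rule cN)
  have Cnz: "\<exists>s\<in>supp. C s \<noteq> 0"
    using b bnz unfolding C_def N_def by (intro bexI[of _ "b \<circ> Inl"]) (auto simp: supp_def BB_def)
  \<comment> \<open>At the node \<open>N g\<close>, \<open>Q\<close> is its leading coefficient
    times the product over the fibre. The factor \<open>disc\<close> and the product over the other
    nodes complete that coefficient to \<open>C\<close>, so the sum is \<open>C\<close> times the
    interpolated product.\<close>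
  define \<Theta> where "\<Theta> = (\<lambda>w. \<Sum>g\<in>?G. smult ((\<Prod>g'\<in>?G - {g}. ?c (case_sum (w \<circ> Inl) (N g'))) *
     disc (case_sum (w \<circ> Inl) (N g)) * lag UNIV (b \<circ> Inr) d g (w \<circ> Inr)) (Q (case_sum (w \<circ> Inl) (N g))))"
  have sub: "(\<lambda>b. p (case_sum (b \<circ> Inl) (N g))) \<in> poly_fun"
    if "p \<in> poly_fun" for p :: "(nat + 'e \<Rightarrow> complex) \<Rightarrow> complex" and g
    by (rule pf_subst[OF that], rule case_sum_fa) (simp_all add: pvar pconst)
  have Qg: "(\<lambda>b. Q (case_sum (b \<circ> Inl) (N g))) \<in> cpoly poly_fun" for g
  proof -
    obtain e where "\<And>b. degree (Q b) \<le> e" using cpoly_degree[OF fun_algebra_poly_fun Q] by blast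
    then show ?thesis using sub[OF cpoly_coeff[OF fun_algebra_poly_fun Q]] by (auto simp: cpoly_def)
  qed
  have lagp: "(\<lambda>b. lag UNIV u d g (b \<circ> Inr)) \<in> poly_fun" for u g
    by (rule pf_subst[OF lag_poly_fun]) (simp add: pvar)
  have \<Theta>: "\<Theta> \<in> cpoly poly_fun" unfolding \<Theta>_def
    by (intro cpoly_sum cpoly_smult fun_algebra_poly_fun Qg pmult pf_prod sub[OF cp] sub[OF disc] lagp)
  have fibre: "finite (Fib s) \<and> card (Fib s) = d \<and> (\<forall>t. \<Theta> (case_sum s t) = smult (C s) (\<Prod>x\<in>Fib s. [:- lin t x, 1:]))"
    if s: "s \<in> supp" and Cs: "C s \<noteq> 0" for s
  proof -
    have cg: "?c (case_sum s (N g)) \<noteq> 0" if "g \<in> ?G" for g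
      using Cs that finG unfolding C_def by simp
    have g0: "(\<lambda>_. 0) \<in> ?G" by (rule PiE_I) auto
    have dg: "disc (case_sum s (N g)) \<noteq> 0" if "g \<in> ?G" for g using cg[OF that] by simp
    note F = Fib_card[OF s dg]
    have fin: "finite (Fib s)" and card: "card (Fib s) = d" using F(1,2)[OF g0] .
    have "\<Theta> (case_sum s t) = smult (C s) (\<Prod>x\<in>Fib s. [:- lin t x, 1:])" for t
    proof (rule poly_eq_poly_eq_iff[THEN iffD1], rule ext)
      fix y
      have "bdeg (1 * card (Fib s)) (\<lambda>t. \<Prod>x\<in>Fib s. y + lin t x * (-1))"
        by (intro bdeg_prod bdeg_linear_form)
      then have bd: "bdeg d (\<lambda>t. \<Prod>x\<in>Fib s. y - lin t x)" using card by simp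
      have inter: "(\<Prod>x\<in>Fib s. y - lin t x) = (\<Sum>g\<in>?G. (\<Prod>x\<in>Fib s. y - lin (N g) x) * lag UNIV (b \<circ> Inr) d g t)"
        unfolding N_def by (rule interpolation[OF _ bd]) auto
      have summand: "poly (smult ((\<Prod>g'\<in>?G - {g}. ?c (case_sum s (N g'))) *
           disc (case_sum s (N g)) * lag UNIV (b \<circ> Inr) d g t) (Q (case_sum s (N g)))) y
         = C s * ((\<Prod>x\<in>Fib s. y - lin (N g) x) * lag UNIV (b \<circ> Inr) d g t)" if g: "g \<in> ?G" for g
      proof -
        have "C s = ?c (case_sum s (N g)) * (\<Prod>g'\<in>?G - {g}. ?c (case_sum s (N g')))"
          unfolding C_def by (rule prod.remove[OF finG g])
        moreover have "poly (Q (case_sum s (N g))) y = coeff (Q (case_sum s (N g))) d * (\<Prod>x\<in>Fib s. y - lin (N g) x)"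
          by (subst F(3)[OF g]) (simp add: poly_prod)
        ultimately show ?thesis by (simp only: poly_smult mult_ac)
      qed
      have proj: "case_sum s t \<circ> Inl = s" "case_sum s t \<circ> Inr = t" by (simp_all add: comp_def)
      have "poly (\<Theta> (case_sum s t)) y = (\<Sum>g\<in>?G. C s * ((\<Prod>x\<in>Fib s. y - lin (N g) x) * lag UNIV (b \<circ> Inr) d g t))"
        unfolding \<Theta>_def poly_sum proj by (intro sum.cong refl summand)
      also have "\<dots> = C s * (\<Prod>x\<in>Fib s. y - lin t x)" by (simp add: inter sum_distrib_left)
      finally show "poly (\<Theta> (case_sum s t)) y = poly (smult (C s) (\<Prod>x\<in>Fib s. [:- lin t x, 1:])) y"
        by (simp add: poly_prod)
    qed
    then show ?thesis using fin card by blast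
  qed
  \<comment> \<open>The factorisation is available only where \<open>C\<close> is nonzero. If
    \<open>\<Theta>\<close> did not vanish along the cover, neither would its product with
    \<open>C\<close>, and a point where that product is nonzero contradicts the
    factorisation.\<close>
  have "poly (\<Theta> (case_sum (sv x) t)) (lin t x) = 0" if x: "x \<in> X" for x t
  proof (rule X_relation[OF \<Theta> _ x], rule ccontr)
    let ?f = "\<lambda>w::nat + 'e \<Rightarrow> complex. lin (w \<circ> Inr) (inv (w \<circ> Inl))"
    assume "\<not> (\<forall>w\<in>\<Omega>. poly (\<Theta> (\<pi> w)) (?f w) = 0)"
    then have 1: "\<exists>w\<in>\<Omega>. poly (\<Theta> (\<pi> w)) (?f w) \<noteq> 0" by blast
    interpret alg_cover poly_fun "BB :: (nat + 'e \<Rightarrow> complex) set" PW \<Omega> \<pi> by (rule cover[OF dom])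
    have f: "?f \<in> PW"
      by (intro lin_fa PW_algebra PW_inv PW_poly) (simp add: pvar)
    have Cb: "(\<lambda>b::nat + 'e \<Rightarrow> complex. C (b \<circ> Inl)) \<in> poly_fun" by (rule pf_subst[OF Cp]) (simp add: pvar)
    obtain s where s: "s \<in> supp" "C s \<noteq> 0" using Cnz by blast
    have "\<exists>w\<in>(\<Omega> :: (nat + 'e \<Rightarrow> complex) set). C (\<pi> w \<circ> Inl) \<noteq> 0"
      using dominant[OF Cb, of "case_sum s (\<lambda>_. 0)"] s by (simp add: case_sum_BB o_def)
    then obtain w where w: "w \<in> \<Omega>" "C (\<pi> w \<circ> Inl) * poly (\<Theta> (\<pi> w)) (?f w) \<noteq> 0"
      using dom[unfolded fun_domain_def, rule_format, OF pull[OF Cb] eval_PW[OF \<Theta> f] _ 1] by blast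
    let ?x = "inv (w \<circ> Inl)"
    have "w \<circ> Inl \<in> reg" using w by (auto simp: \<Omega>_def reg_def BB_def supp_def)
    then have "?x \<in> X" using X0_X by (auto simp: X0_def)
    then have xF: "?x \<in> Fib (sv ?x)" by (simp add: Fib_def)
    have \<pi>w: "\<pi> w = case_sum (sv ?x) (w \<circ> Inr)" by (simp add: \<pi>_def)
    have "C (sv ?x) \<noteq> 0" using w by (simp add: \<pi>w comp_def)
    then have "finite (Fib (sv ?x))" "\<Theta> (\<pi> w) = smult (C (sv ?x)) (\<Prod>x\<in>Fib (sv ?x). [:- lin (w \<circ> Inr) x, 1:])"
      using fibre[OF sv_supp] unfolding \<pi>w by blast+
    then have "poly (\<Theta> (\<pi> w)) (?f w) = 0" using xF by (simp add: poly_prod) (metis (no_types, lifting) cancel_comm_monoid_add_class.diff_cancel prod_zero)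
    then show False using w by simp
  qed
  then show ?thesis using Cp \<Theta> Cnz fibre by blast
qed

end

section \<open>Lines of the join through a generic point\<close>


context reciprocal_relation
begin

text \<open>On \<open>plk x \<gamma>\<close>, contraction with \<open>l\<close> gives
  \<open>lin l \<gamma> * x\<close> up to a multiple of \<open>\<gamma>\<close>, and contraction
  with \<open>\<beta> i\<close>, which vanishes on \<open>H\<close>, gives a multiple of
  \<open>\<gamma>\<close>. A form built to kill the second contraction cannot tell the first from
  \<open>lin l \<gamma> * x\<close>, so \<open>\<Theta>\<close> vanishes there. This equation
  involves the Pluecker vector alone and survives in the closure; at \<open>plk S v\<close> it
  forces, for each such form, a fibre point with the same value as \<open>S\<close>.\<close>

lemma join_closure:
  assumes \<Theta>: "\<Theta> \<in> cpoly poly_fun"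
    and fibre: "finite (Fib (sv S))" "C \<noteq> 0" "\<And>t. \<Theta> (case_sum (sv S) t) = smult C (\<Prod>x\<in>Fib (sv S). [:- lin t x, 1:])"
    and \<Theta>X: "\<And>x t. x \<in> X \<Longrightarrow> poly (\<Theta> (case_sum (sv x) t)) (lin t x) = 0"
    and A: "A \<subseteq> join_plk" and v: "plk S v \<in> zariski_closure A" and l: "lin l v = 1" "lin l S = 0"
    and i: "i < k" "lin (\<beta> i) S \<noteq> 0"
  shows "\<exists>x\<in>Fib (sv S). \<exists>c1 c2. x = (\<lambda>e. c1 * S e + c2 * v e)"
proof -
  define \<theta> where "\<theta> = \<beta> i"
  \<comment> \<open>The combination of \<open>\<mu>\<close> and \<open>\<nu>\<close> that kills
    \<open>contract \<theta> q\<close>, written without division to stay polynomial in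
    \<open>q\<close>.\<close>
  define T where "T = (\<lambda>\<mu> \<nu> q e. lin \<nu> (contract \<theta> q) * \<mu> e - lin \<mu> (contract \<theta> q) * \<nu> e)"
  have Tp: "(\<lambda>q. T \<mu> \<nu> q e) \<in> poly_fun" for \<mu> \<nu> e
    unfolding T_def by (intro pf_intros lin_fa fun_algebra_poly_fun contract_poly)
  let ?F = "\<lambda>\<mu> \<nu> q. poly (\<Theta> (case_sum (sv (contract l q)) (T \<mu> \<nu> q))) (lin (T \<mu> \<nu> q) (contract l q))"
  have Fp: "?F \<mu> \<nu> \<in> poly_fun" for \<mu> \<nu>
  proof (rule cpoly_eval[OF fun_algebra_poly_fun \<Theta> fun_algebra_poly_fun])
    fix p :: "(nat + 'e \<Rightarrow> complex) \<Rightarrow> complex" assume "p \<in> poly_fun"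
    then show "(\<lambda>q. p (case_sum (sv (contract l q)) (T \<mu> \<nu> q))) \<in> poly_fun"
      by (rule pf_subst) (rule case_sum_fa, rule sv_fa, rule fun_algebra_poly_fun, rule contract_poly, rule Tp)
  qed (intro lin_fa fun_algebra_poly_fun Tp contract_poly)
  have F_A: "?F \<mu> \<nu> q = 0" if qA: "q \<in> A" for \<mu> \<nu> q
  proof -
    obtain x \<gamma> where q: "q = plk x \<gamma>" "x \<in> X" "\<gamma> \<in> H" using subsetD[OF A qA] unfolding join_plk_def by blast
    let ?x = "\<lambda>e. lin l \<gamma> * x e"
    have "lin \<theta> \<gamma> = 0" using q(3) i by (simp add: H_def \<theta>_def)
    then have G: "contract \<theta> q = (\<lambda>e. - lin \<theta> x * \<gamma> e)" by (simp add: q(1) contract_plk)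
    have "lin (T \<mu> \<nu> q) \<gamma> = 0" unfolding T_def G by (simp add: lin_diff_left lin_scale_left lin_minus lin_scale)
    then have "lin (T \<mu> \<nu> q) (contract l q) = lin (T \<mu> \<nu> q) ?x"
      by (simp add: q(1) contract_plk lin_diff lin_scale)
    moreover have "sv (contract l q) = sv ?x"
      using q(3) by (simp add: q(1) contract_plk sv_diff sv_scale H_iff)
    ultimately show ?thesis using \<Theta>X[OF X_scale[OF q(2)]] by simp
  qed
  have cS: "contract l (plk S v) = S" using l by (simp add: contract_plk)
  define \<Gamma> where "\<Gamma> = contract \<theta> (plk S v)"
  have \<Gamma>: "\<Gamma> = (\<lambda>e. lin \<theta> v * S e - lin \<theta> S * v e)" by (simp add: \<Gamma>_def contract_plk)
  have "lin l \<Gamma> \<noteq> 0" using l i by (simp add: \<Gamma> lin_diff lin_scale \<theta>_def)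
  then have "\<Gamma> \<noteq> (\<lambda>_. 0)" by (auto simp: lin_zero)
  define \<nu> where "\<nu> = (\<lambda>e. (1 / lin l \<Gamma>) * l e)"
  have \<nu>: "lin \<nu> \<Gamma> = 1" unfolding \<nu>_def lin_scale_left using \<open>lin l \<Gamma> \<noteq> 0\<close> by simp
  \<comment> \<open>\<open>S - x\<close> projected along \<open>\<Gamma>\<close> to the kernel of
    \<open>\<nu>\<close>; it is zero exactly if \<open>S - x\<close> is a multiple of
    \<open>\<Gamma>\<close>.\<close>
  let ?z = "\<lambda>x e. (S e - x e) - lin \<nu> (\<lambda>e. S e - x e) * \<Gamma> e"
  have "\<exists>x\<in>Fib (sv S). ?z x = (\<lambda>_. 0)"
  proof (rule ccontr)
    assume H: "\<not> ?thesis"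
    \<comment> \<open>The fibre is finite, so one \<open>\<mu>\<close> avoids the hyperplanes of all
      the nonzero vectors \<open>?z x\<close>; this makes every factor of the product over the fibre
      nonzero.\<close>
    have "\<exists>\<mu>\<in>UNIV. (\<Prod>x\<in>Fib (sv S). lin \<mu> (?z x)) \<noteq> 0"
    proof (rule fun_domain_prod[OF poly_fun_domain fun_algebra_poly_fun fibre(1)])
      show "affine_closed (UNIV :: ('e \<Rightarrow> complex) set)" by (simp add: affine_closed_def)
      fix x assume x: "x \<in> Fib (sv S)"
      show "(\<lambda>\<mu>. lin \<mu> (?z x)) \<in> poly_fun" by (intro lin_fa fun_algebra_poly_fun pvar pconst)
      have "?z x \<noteq> (\<lambda>_. 0)" using H x by blast
      then show "\<exists>\<mu>\<in>UNIV. lin \<mu> (?z x) \<noteq> 0" using lin_nonzero by blast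
    qed auto
    then obtain \<mu> where \<mu>: "(\<Prod>x\<in>Fib (sv S). lin \<mu> (?z x)) \<noteq> 0" by blast
    let ?t = "T \<mu> \<nu> (plk S v)"
    have t: "?t = (\<lambda>e. \<mu> e - lin \<mu> \<Gamma> * \<nu> e)" unfolding T_def \<Gamma>_def[symmetric] \<nu> by simp
    have tz: "lin ?t S - lin ?t x = lin \<mu> (?z x)" for x
      unfolding t lin_diff_left lin_scale_left lin_diff lin_scale by (simp only: algebra_simps)
    have "?F \<mu> \<nu> (plk S v) = 0"
      by (rule zariski_closure_iff[THEN iffD1, OF v, rule_format, OF Fp F_A])
    then have "C * (\<Prod>x\<in>Fib (sv S). lin ?t S - lin ?t x) = 0"
      unfolding cS fibre(3) by (simp add: poly_prod)
    then show False using \<mu> fibre(2) unfolding tz by simp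
  qed
  then obtain x where x: "x \<in> Fib (sv S)" "?z x = (\<lambda>_. 0)" by blast
  let ?c = "lin \<nu> (\<lambda>e. S e - x e)"
  have "x = (\<lambda>e. (1 - ?c * lin \<theta> v) * S e + (?c * lin \<theta> S) * v e)"
  proof
    fix e
    have "S e - x e - ?c * (lin \<theta> v * S e - lin \<theta> S * v e) = 0" using fun_cong[OF x(2), of e] by (simp add: \<Gamma>)
    then show "x e = (1 - ?c * lin \<theta> v) * S e + (?c * lin \<theta> S) * v e" by (simp add: algebra_simps)
  qed
  then show ?thesis using x(1) by blast
qed

section \<open>Separation of fibre points lying on a common line\<close>

text \<open>For \<open>x\<close> in the fibre of \<open>S\<close> and suitable \<open>h\<close> this
  is \<open>S - x\<close>, the direction in which the line from \<open>x\<close> to \<open>S\<close>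
  meets \<open>H\<close>. Together with the projection of \<open>x\<close>, the vector
  \<open>h\<close> replaces \<open>S\<close>, which makes the dependence on \<open>S\<close> a
  dependence on base coordinates.\<close>

definition polar_part :: "('e \<Rightarrow> complex) \<Rightarrow> ('e \<Rightarrow> complex) \<Rightarrow> 'e \<Rightarrow> complex" where
  "polar_part x h = (\<lambda>e. pH h e - (x e - sec (sv x) e))"

definition killer :: "('e \<Rightarrow> complex) \<Rightarrow> ('e \<Rightarrow> complex) \<Rightarrow> ('e \<Rightarrow> complex) \<Rightarrow> 'e \<Rightarrow> complex" where
  "killer \<mu> \<nu> \<gamma> = (\<lambda>e. lin \<nu> \<gamma> * \<mu> e - lin \<mu> \<gamma> * \<nu> e)"

text \<open>The second factor detects \<open>x \<noteq> S\<close>. The first is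
  \<open>Q\<^sub>y\<close> at a form that kills the polar part: fibre points on the line from
  \<open>x\<close> to \<open>S\<close> have equal values under this form, so
  \<open>Fib_separated\<close> identifies them when it is nonzero.\<close>

definition separator :: "('e \<Rightarrow> complex) \<Rightarrow> ('e \<Rightarrow> complex) \<Rightarrow> ('e \<Rightarrow> complex) \<Rightarrow> ('e \<Rightarrow> complex) \<Rightarrow> complex" where
  "separator x h \<mu> \<nu> = poly (pderiv (Q (case_sum (sv x) (killer \<mu> \<nu> (polar_part x h))))) (lin (killer \<mu> \<nu> (polar_part x h)) x) * lin \<nu> (polar_part x h)"

lemma separator_fa:
  assumes R: "fun_algebra R" and x: "\<And>e. (\<lambda>w. x w e) \<in> R" and h: "\<And>e. (\<lambda>w. h w e) \<in> R"
    and \<mu>: "\<And>e. (\<lambda>w. \<mu> w e) \<in> R" and \<nu>: "\<And>e. (\<lambda>w. \<nu> w e) \<in> R"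
  shows "(\<lambda>w. separator (x w) (h w) (\<mu> w) (\<nu> w)) \<in> R"
proof -
  have g: "(\<lambda>w. polar_part (x w) (h w) e) \<in> R" for e
    unfolding polar_part_def sec_def
    by (intro fa_diff[OF R] fa_sum[OF R] fa_mult[OF R] fa_const[OF R] x sv_fa[OF R]
        poly_fun_subst[OF pH_poly R] h)
  have t: "(\<lambda>w. killer (\<mu> w) (\<nu> w) (polar_part (x w) (h w)) e) \<in> R" for e
    unfolding killer_def by (intro fa_diff[OF R] fa_mult[OF R] lin_fa[OF R] \<mu> \<nu> g)
  have D: "(\<lambda>b. pderiv (Q b)) \<in> cpoly poly_fun" by (intro cpoly_pderiv fun_algebra_poly_fun Q)
  have "(\<lambda>w. poly (pderiv (Q (case_sum (sv (x w)) (killer (\<mu> w) (\<nu> w) (polar_part (x w) (h w)))))) (lin (killer (\<mu> w) (\<nu> w) (polar_part (x w) (h w))) (x w))) \<in> R"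
  proof (rule cpoly_eval[OF fun_algebra_poly_fun D R])
    fix p :: "(nat + 'e \<Rightarrow> complex) \<Rightarrow> complex" assume "p \<in> poly_fun"
    then show "(\<lambda>w. p (case_sum (sv (x w)) (killer (\<mu> w) (\<nu> w) (polar_part (x w) (h w))))) \<in> R"
      by (rule poly_fun_subst[OF _ R]) (rule case_sum_fa, rule sv_fa[OF R], rule x, rule t)
  qed (intro lin_fa[OF R] t x)
  then show ?thesis unfolding separator_def by (intro fa_mult[OF R] lin_fa[OF R] \<nu> g)
qed

text \<open>
  The relation \<open>W\<close> for the separator lives over pairs \<open>(s, h)\<close> with \<open>h\<close> unconstrained, and its
  constant coefficient need not be nonzero for \<open>h \<in> H\<close>.  A fixed offset \<open>\<eta>\<close>, killed by the
  projection onto \<open>H\<close>, makes it nonzero for generic \<open>S\<close>.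
\<close>
lemma generic_separation:
  "\<exists>G\<in>poly_fun. (\<exists>S\<in>V. G S \<noteq> 0) \<and> (\<forall>S\<in>V. G S \<noteq> 0 \<longrightarrow> (\<forall>x\<in>Fib (sv S). x \<noteq> S \<and>
    (\<forall>x'\<in>Fib (sv S). (\<exists>c. \<forall>e. S e - x' e = c * (S e - x e)) \<longrightarrow> x' = x)))"
proof -
  let ?BB = "BB :: (nat + ('e + 'e + 'e) \<Rightarrow> complex) set" and ?\<Omega> = "\<Omega> :: (nat + ('e + 'e + 'e) \<Rightarrow> complex) set"
  let ?h = "\<lambda>w (e::'e). w (Inr (Inl e)) :: complex"
  let ?\<mu> = "\<lambda>w (e::'e). w (Inr (Inr (Inl e))) :: complex"
  let ?\<nu> = "\<lambda>w (e::'e). w (Inr (Inr (Inr e))) :: complex"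
  define g where "g = (\<lambda>w::nat + ('e + 'e + 'e) \<Rightarrow> complex. separator (inv (w \<circ> Inl)) (?h w) (?\<mu> w) (?\<nu> w))"
  interpret A: alg_cover poly_fun ?BB PW ?\<Omega> \<pi> by (rule cover[OF dom])
  interpret A1: alg_cover poly_fun "BB :: (nat + 'e \<Rightarrow> complex) set" PW \<Omega> \<pi> by (rule cover[OF dom])
  have g: "g \<in> PW"
    unfolding g_def by (rule separator_fa[OF PW_algebra]) (rule PW_inv PW_poly pvar)+
  \<comment> \<open>Where \<open>disc\<close> is nonzero, the derivative at \<open>(sv x, t)\<close>
    is nonzero for some form \<open>t\<close>. A direction \<open>\<gamma>\<close> of
    \<open>H\<close> killed by \<open>t\<close> is then made the polar part by the choice of
    \<open>h\<close>, and \<open>\<nu>\<close> is normalised so that the killer is \<open>t\<close>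
    itself.\<close>
  have "\<exists>w\<in>?\<Omega>. g w \<noteq> 0"
  proof -
    obtain b0 :: "nat + 'e \<Rightarrow> complex" where "b0 \<in> BB" "disc b0 \<noteq> 0" using disc_nz by blast
    then obtain w :: "nat + 'e \<Rightarrow> complex" where w: "w \<in> \<Omega>" "disc (\<pi> w) \<noteq> 0" using A1.dominant[OF disc] by blast
    define a where "a = w \<circ> Inl"
    define t where "t = w \<circ> Inr"
    have a: "a \<in> reg" using w by (auto simp: a_def \<Omega>_def reg_def BB_def supp_def)
    define x where "x = inv a"
    have xX: "x \<in> X" using a X0_X by (auto simp: X0_def x_def)
    have \<pi>w: "\<pi> w = case_sum (sv x) t" by (simp add: \<pi>_def x_def a_def t_def)
    have Dnz: "poly (pderiv (Q (case_sum (sv x) t))) (lin t x) \<noteq> 0"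
      using Q_simple[OF \<pi>_BB w(2)] X_Q[OF xX, of t] unfolding \<pi>w by blast
    obtain \<gamma> where \<gamma>: "\<gamma> \<in> H" "\<gamma> \<noteq> (\<lambda>_. 0)" "lin t \<gamma> = 0" using H_kernel by blast
    obtain \<nu>0 where "lin \<nu>0 \<gamma> \<noteq> 0" using lin_nonzero[OF \<gamma>(2)] by blast
    define \<nu> where "\<nu> = (\<lambda>e. (1 / lin \<nu>0 \<gamma>) * \<nu>0 e)"
    have \<nu>: "lin \<nu> \<gamma> = 1" unfolding \<nu>_def lin_scale_left using \<open>lin \<nu>0 \<gamma> \<noteq> 0\<close> by simp
    define h where "h = (\<lambda>e. \<gamma> e + (x e - sec (sv x) e))"
    have "h \<in> V" unfolding h_def using \<gamma>(1) by (intro V_add V_diff X_V[OF xX] sec_V) (simp add: H_def)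
    moreover have "sv h = (\<lambda>_. 0)"
      using \<gamma>(1) by (simp add: h_def sv_add sv_diff sv_sec sv_supp H_iff)
    ultimately have "h \<in> H" by (simp add: H_iff)
    then have gm: "polar_part x h = \<gamma>" by (simp add: polar_part_def pH_id) (simp add: h_def)
    have kl: "killer t \<nu> (polar_part x h) = t" by (simp add: killer_def gm \<nu> \<gamma>)
    have "separator x h t \<nu> \<noteq> 0" unfolding separator_def kl using Dnz by (simp add: gm \<nu>)
    then have "g (case_sum a (case_sum h (case_sum t \<nu>))) \<noteq> 0" by (simp add: g_def comp_def x_def)
    moreover have "case_sum a (case_sum h (case_sum t \<nu>)) \<in> ?\<Omega>" using a by (auto simp: \<Omega>_def case_sum_BB reg_def comp_def)
    ultimately show ?thesis by blast
  qed
  then obtain W where W: "W \<in> cpoly poly_fun" "\<exists>b\<in>?BB. coeff (W b) 0 \<noteq> 0" "\<forall>w\<in>?\<Omega>. poly (W (\<pi> w)) (g w) = 0"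
    using A.const_coeff[OF g] by blast
  have WX: "poly (W (case_sum (sv x) (case_sum h (case_sum \<mu> \<nu>)))) (separator x h \<mu> \<nu>) = 0" if x: "x \<in> X" for x h \<mu> \<nu>
  proof -
    have "(\<lambda>x. poly (W (case_sum (sv x) (case_sum h (case_sum \<mu> \<nu>)))) (separator x h \<mu> \<nu>)) \<in> poly_fun"
    proof (rule cpoly_eval[OF fun_algebra_poly_fun W(1) fun_algebra_poly_fun])
      fix p :: "(nat + ('e + 'e + 'e) \<Rightarrow> complex) \<Rightarrow> complex" assume "p \<in> poly_fun"
      then show "(\<lambda>x. p (case_sum (sv x) (case_sum h (case_sum \<mu> \<nu>)))) \<in> poly_fun"
        by (rule pf_subst) (rule case_sum_fa, rule sv_poly, rule pconst)
    next
      show "(\<lambda>x. separator x h \<mu> \<nu>) \<in> poly_fun" by (rule separator_fa[OF fun_algebra_poly_fun]) (rule pvar pconst)+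
    qed
    then show ?thesis
    proof (rule X_ext[OF _ _ x])
      fix a assume "a \<in> reg"
      then have "case_sum a (case_sum h (case_sum \<mu> \<nu>)) \<in> ?\<Omega>" by (auto simp: \<Omega>_def case_sum_BB reg_def comp_def)
      then show "poly (W (case_sum (sv (inv a)) (case_sum h (case_sum \<mu> \<nu>)))) (separator (inv a) h \<mu> \<nu>) = 0"
        using W(3) by (fastforce simp: \<pi>_def g_def comp_def)
    qed
  qed
  obtain b where b: "b \<in> ?BB" "coeff (W b) 0 \<noteq> 0" using W(2) by blast
  define h where "h = ?h b"
  define \<mu> where "\<mu> = ?\<mu> b"
  define \<nu> where "\<nu> = ?\<nu> b"
  define s where "s = b \<circ> Inl"
  have s: "s \<in> supp" using b(1) by (auto simp: s_def BB_def supp_def)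
  have b_eq: "b = case_sum s (case_sum h (case_sum \<mu> \<nu>))"
    by (auto simp: fun_eq_iff s_def h_def \<mu>_def \<nu>_def split: sum.split)
  define \<eta> where "\<eta> = (\<lambda>e. h e - pH h e)"
  have "pH (\<lambda>e. \<eta> e + pH h e) = (\<lambda>e. pH \<eta> e + pH (pH h) e)" by (rule pH_add)
  then have \<eta>: "pH \<eta> = (\<lambda>_. 0)" by (simp add: \<eta>_def pH_id[OF pH_H] fun_eq_iff)
  \<comment> \<open>The projection of this vector to \<open>H\<close> is
    \<open>S - sec (sv S)\<close> for \<open>S\<close> in \<open>V\<close>; and for
    \<open>S = sec s + pH h\<close> the vector is \<open>h\<close>, where the constant coefficient
    is known to be nonzero.\<close>
  let ?hS = "\<lambda>S e. (S e - sec (sv S) e) + \<eta> e"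
  define G where "G = (\<lambda>S. coeff (W (case_sum (sv S) (case_sum (?hS S) (case_sum \<mu> \<nu>)))) 0)"
  have "G \<in> poly_fun" unfolding G_def
  proof (rule pf_subst[OF cpoly_coeff[OF fun_algebra_poly_fun W(1)]], intro case_sum_fa sv_poly pconst)
    show "(\<lambda>S. ?hS S e) \<in> poly_fun" for e unfolding sec_def by (intro pf_intros sv_poly)
  qed
  moreover have "\<exists>S\<in>V. G S \<noteq> 0"
  proof
    let ?S = "\<lambda>e. sec s e + pH h e"
    show "?S \<in> V" using pH_H by (intro V_add sec_V) (simp add: H_def)
    have "sv ?S = s" using pH_H[of h] by (simp add: sv_add sv_sec s H_iff)
    then show "G ?S \<noteq> 0" using b(2) by (simp add: G_def \<eta>_def b_eq)
  qed
  moreover have "x \<noteq> S \<and> (\<forall>x'\<in>Fib (sv S). (\<exists>c. \<forall>e. S e - x' e = c * (S e - x e)) \<longrightarrow> x' = x)"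
    if S: "S \<in> V" "G S \<noteq> 0" and x: "x \<in> Fib (sv S)" for S x
  proof -
    have xX: "x \<in> X" "sv x = sv S" using x by (auto simp: Fib_def)
    have "(\<lambda>e. S e - sec (sv S) e) \<in> H" using S by (simp add: H_iff V_diff sec_V sv_diff sv_sec sv_supp)
    then have "pH (?hS S) = (\<lambda>e. S e - sec (sv S) e)" by (simp add: pH_add \<eta> pH_id)
    then have gm: "polar_part x (?hS S) = (\<lambda>e. S e - x e)" by (simp add: polar_part_def xX)
    let ?t = "killer \<mu> \<nu> (\<lambda>e. S e - x e)"
    have "separator x (?hS S) \<mu> \<nu> \<noteq> 0"
    proof
      assume "separator x (?hS S) \<mu> \<nu> = 0"
      then have "poly (W (case_sum (sv S) (case_sum (?hS S) (case_sum \<mu> \<nu>)))) 0 = 0"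
        using WX[OF xX(1), of "?hS S" \<mu> \<nu>] xX(2) by simp
      then show False using S(2) by (simp add: G_def poly_0_coeff_0)
    qed
    then have D: "poly (pderiv (Q (case_sum (sv S) ?t))) (lin ?t x) \<noteq> 0" and nz: "lin \<nu> (\<lambda>e. S e - x e) \<noteq> 0"
      by (auto simp: separator_def gm xX)
    have "x \<noteq> S" using nz by (auto simp: lin_zero)
    moreover have "x' = x" if x': "x' \<in> Fib (sv S)" and par: "\<forall>e. S e - x' e = c * (S e - x e)" for x' c
    proof -
      have "lin ?t (\<lambda>e. S e - x e) = 0" by (simp add: killer_def lin_diff_left lin_scale_left)
      moreover have "lin ?t (\<lambda>e. S e - x' e) = c * lin ?t (\<lambda>e. S e - x e)" by (simp add: par lin_scale)
      ultimately have "lin ?t x = lin ?t x'" by (simp add: lin_diff)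
      then show "x' = x" using Fib_separated[OF x x' _ D] by simp
    qed
    ultimately show ?thesis by blast
  qed
  ultimately show ?thesis by blast
qed

end

section \<open>Symmetric matrices in coordinates\<close>


definition of_coords :: "('n \<times> 'n \<Rightarrow> complex) \<Rightarrow> complex^'n^'n" where
  "of_coords x = (\<chi> i j. x (i, j))"

lemma mat_coords_apply: "mat_coords M (i, j) = M$i$j"
  by (simp add: mat_coords_def)

lemma of_coords_inverse [simp]: "mat_coords (of_coords x) = x" "of_coords (mat_coords M) = M"
  by (auto simp: mat_coords_def of_coords_def fun_eq_iff vec_eq_iff)

lemma mat_coords_inject: "mat_coords M = mat_coords N \<longleftrightarrow> M = N"
  by (metis of_coords_inverse(2))

lemma mat_coords_linear:
  "mat_coords (M + N) = (\<lambda>e. mat_coords M e + mat_coords N e)"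
  "mat_coords (M - N) = (\<lambda>e. mat_coords M e - mat_coords N e)"
  "mat_coords (mscale c M) = (\<lambda>e. c * mat_coords M e)"
  "mat_coords 0 = (\<lambda>_. 0)"
  by (auto simp: mat_coords_def mscale_def fun_eq_iff)

lemma mat_coords_sum: "mat_coords (\<Sum>i\<in>A. f i) = (\<lambda>e. \<Sum>i\<in>A. mat_coords (f i) e)"
  by (induction A rule: infinite_finite_induct) (auto simp: mat_coords_linear)

lemma matrix_unit_expansion:
  "M = (\<Sum>e\<in>UNIV. mscale (mat_coords M e) (of_coords (\<lambda>e'. if e' = e then 1 else 0)))"
  by (subst mat_coords_inject[symmetric])
    (simp add: mat_coords_sum mat_coords_linear if_distrib[of "\<lambda>z. _ * z"] cong: if_cong)

lemma symmat_iff: "M \<in> symmat \<longleftrightarrow> (\<forall>i j. mat_coords M (i, j) = mat_coords M (j, i))"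
  by (auto simp: symmat_def transpose_def vec_eq_iff mat_coords_def)

lemma pluecker_plk: "pluecker u v = plk (mat_coords u) (mat_coords v)"
  by (auto simp: pluecker_def plk_def mat_coords_def fun_eq_iff)

lemma lin_pair: "lin t x = (\<Sum>i\<in>UNIV. \<Sum>j\<in>UNIV. t (i, j) * x (i, j))"
  unfolding lin_def by (simp add: sum.cartesian_product)

lemma trace_lin: "K \<in> symmat \<Longrightarrow> trace (K ** M) = lin (mat_coords K) (mat_coords M)"
proof -
  assume "K \<in> symmat"
  then have K: "K$i$j = K$j$i" for i j by (simp add: symmat_iff mat_coords_apply)
  have "trace (K ** M) = (\<Sum>i\<in>UNIV. \<Sum>j\<in>UNIV. K$j$i * M$j$i)"
    unfolding trace_def matrix_matrix_mult_def using K by (simp cong: sum.cong)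
  also have "\<dots> = (\<Sum>j\<in>UNIV. \<Sum>i\<in>UNIV. K$j$i * M$j$i)" by (rule sum.swap)
  finally show ?thesis by (simp add: lin_pair mat_coords_apply)
qed

lemma subspace_symmat: "cmat.subspace symmat"
  by (auto simp: cmat.subspace_def symmat_iff mat_coords_linear)

lemma matrix_inv_invertible:
  fixes A :: "complex^'n^'n"
  assumes "invertible A"
  shows "A ** matrix_inv A = mat 1" "matrix_inv A ** A = mat 1"
proof -
  have "\<exists>B. A ** B = mat 1 \<and> B ** A = mat 1" using assms by (simp add: invertible_def)
  then have "A ** matrix_inv A = mat 1 \<and> matrix_inv A ** A = mat 1"
    unfolding matrix_inv_def by (rule someI_ex)
  then show "A ** matrix_inv A = mat 1" "matrix_inv A ** A = mat 1" by auto
qed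

lemma matrix_inv_unique:
  fixes A :: "complex^'n^'n"
  assumes "A ** B = mat 1" "B ** A = mat 1"
  shows "matrix_inv A = B"
proof -
  have "invertible A" using assms by (auto simp: invertible_def)
  then have "matrix_inv A ** (A ** B) = B"
    by (simp add: matrix_mul_assoc matrix_inv_invertible)
  then show ?thesis using assms by simp
qed

lemma matrix_inv_symmat:
  fixes A :: "complex^'n^'n"
  assumes "invertible A" "A \<in> symmat"
  shows "matrix_inv A \<in> symmat"
proof -
  have A: "transpose A = A" using assms by (simp add: symmat_def)
  have "transpose (A ** matrix_inv A) = mat 1" "transpose (matrix_inv A ** A) = mat 1"
    by (simp_all add: matrix_inv_invertible assms transpose_mat)
  then have "matrix_inv A = transpose (matrix_inv A)"
    by (intro matrix_inv_unique) (simp_all add: matrix_transpose_mul A)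
  then show ?thesis by (simp add: symmat_def)
qed

lemma mscale_mult: "mscale c A ** mscale d B = mscale (c * d) (A ** B)"
  by (auto simp: mscale_def matrix_matrix_mult_def vec_eq_iff sum_distrib_left intro!: sum.cong)

lemma matrix_inv_mscale:
  fixes A :: "complex^'n^'n"
  assumes "invertible A" "c \<noteq> 0"
  shows "invertible (mscale c A)" "matrix_inv (mscale c A) = mscale (1 / c) (matrix_inv A)"
proof -
  have 1: "mscale c A ** mscale (1/c) (matrix_inv A) = mat 1" "mscale (1/c) (matrix_inv A) ** mscale c A = mat 1"
    using assms by (simp_all add: mscale_mult matrix_inv_invertible cmat.scale_one)
  then show "invertible (mscale c A)" unfolding invertible_def by blast
  show "matrix_inv (mscale c A) = mscale (1 / c) (matrix_inv A)" using 1 by (rule matrix_inv_unique)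
qed

text \<open>Cramer's rule for column \<open>j\<close> of the inverse, which \<open>A\<close> maps to
  a unit vector.\<close>

lemma matrix_inv_cofactor:
  fixes A :: "complex^'n^'n"
  assumes "invertible A"
  shows "matrix_inv A $ i $ j = det (\<chi> r c. if c = i then (if r = j then 1 else 0) else A$r$c) / det A"
proof -
  have d: "det A \<noteq> 0" using assms by (simp add: invertible_det_nz)
  let ?x = "\<chi> r. matrix_inv A $ r $ j"
  have "(A *v ?x) $ r = (A ** matrix_inv A) $ r $ j" for r
    by (simp add: matrix_vector_mult_def matrix_matrix_mult_def)
  then have "A *v ?x = (\<chi> r. if r = j then 1 else 0)"
    by (simp add: vec_eq_iff matrix_inv_invertible assms mat_def)
  then have "?x = (\<chi> k. det (\<chi> r c. if c = k then (\<chi> r. if r = j then 1 else 0) $ r else A$r$c) / det A)"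
    by (rule cramer[OF d, THEN iffD1])
  from arg_cong[where f = "\<lambda>v. v $ i", OF this] show ?thesis by (simp cong: if_cong)
qed

lemma det_poly:
  assumes "\<And>r c. (\<lambda>a. M a r c) \<in> poly_fun"
  shows "(\<lambda>a. det (\<chi> r c. M a r c)) \<in> poly_fun"
  unfolding det_def by (simp, intro pf_intros assms)

lemma finite_independent_cmat:
  assumes "cmat.independent (B :: (complex^'n^'n) set)" shows "finite B"
proof -
  let ?E = "range (\<lambda>e. of_coords (\<lambda>e'. if e' = e then 1 else 0)) :: (complex^'n^'n) set"
  have "M \<in> cmat.span ?E" for M :: "complex^'n^'n"
  proof -
    have "(\<Sum>e\<in>UNIV. mscale (mat_coords M e) (of_coords (\<lambda>e'. if e' = e then 1 else 0))) \<in> cmat.span ?E"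
      by (intro cmat.span_sum cmat.span_scale cmat.span_base) auto
    then show ?thesis by (simp flip: matrix_unit_expansion)
  qed
  then show ?thesis using cmat.independent_span_bound[of ?E B] assms by auto
qed

text \<open>The coordinate functionals of an extended basis are dual to \<open>B\<close>. Averaging
  their coefficients with the transposes makes them symmetric and keeps their pairing with a
  symmetric \<open>B i\<close>.\<close>

lemma dual_vectors:
  fixes B :: "nat \<Rightarrow> complex^'n^'n"
  assumes inj: "inj_on B {..<k}" and indep: "cmat.independent (B ` {..<k})" and sym: "\<And>i. i < k \<Longrightarrow> B i \<in> symmat"
  shows "\<exists>D. (\<forall>i<k. \<forall>j<k. lin (mat_coords (B i)) (D j) = (if i = j then 1 else 0)) \<and> (\<forall>j a b. D j (a, b) = D j (b, a))"
proof -
  define T where "T = cmat.extend_basis (B ` {..<k})"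
  have T: "cmat.independent T" "cmat.span T = UNIV" "B ` {..<k} \<subseteq> T"
    unfolding T_def using cmat.independent_extend_basis[OF indep] cmat.span_extend_basis[OF indep]
      cmat.extend_basis_superset[OF indep] by auto
  define f where "f = (\<lambda>j M. cmat.representation T M (B j))"
  define F where "F = (\<lambda>j e. f j (of_coords (\<lambda>e'. if e' = e then 1 else 0)))"
  have f: "f j M = lin (mat_coords M) (F j)" for j M
  proof -
    have "f j M = f j (\<Sum>e\<in>UNIV. mscale (mat_coords M e) (of_coords (\<lambda>e'. if e' = e then 1 else 0)))"
      by (simp flip: matrix_unit_expansion)
    also have "\<dots> = (\<Sum>e\<in>UNIV. mat_coords M e * F j e)"
      unfolding f_def F_def
      by (subst cmat.representation_sum[OF T(1)]) (auto simp: T(2) cmat.representation_scale[OF T(1)])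
    finally show ?thesis by (simp add: lin_def)
  qed
  define D where "D = (\<lambda>j (a, b). (F j (a, b) + F j (b, a)) / 2)"
  have "lin (mat_coords (B i)) (D j) = (if i = j then 1 else 0)" if ij: "i < k" "j < k" for i j
  proof -
    let ?b = "mat_coords (B i)"
    have s: "?b (a, b) = ?b (b, a)" for a b using sym[OF ij(1)] by (simp add: symmat_iff)
    have "(\<Sum>a\<in>UNIV. \<Sum>b\<in>UNIV. ?b (a, b) * F j (b, a)) = (\<Sum>b\<in>UNIV. \<Sum>a\<in>UNIV. ?b (b, a) * F j (b, a))"
      by (subst sum.swap) (simp add: s cong: sum.cong)
    then have sw: "(\<Sum>a\<in>UNIV. \<Sum>b\<in>UNIV. ?b (a, b) * F j (b, a)) = lin ?b (F j)" by (simp add: lin_pair)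
    have "lin ?b (D j) = (\<Sum>a\<in>UNIV. \<Sum>b\<in>UNIV. (?b (a, b) * F j (a, b) + ?b (a, b) * F j (b, a)) * (1/2))"
      by (simp add: lin_pair D_def algebra_simps add_divide_distrib)
    also have "\<dots> = (lin ?b (F j) + (\<Sum>a\<in>UNIV. \<Sum>b\<in>UNIV. ?b (a, b) * F j (b, a))) * (1/2)"
      by (simp only: sum.distrib sum_distrib_right[symmetric] lin_pair)
    also have "\<dots> = f j (B i)" unfolding sw f by simp
    also have "\<dots> = (if i = j then 1 else 0)"
    proof -
      have "B i \<in> T" using T(3) ij by auto
      then have "f j (B i) = (if B j = B i then 1 else 0)" unfolding f_def by (simp add: cmat.representation_basis[OF T(1)])
      then show ?thesis using inj ij by (auto dest: inj_onD)
    qed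
    finally show ?thesis .
  qed
  moreover have "D j (a, b) = D j (b, a)" for j a b by (simp add: D_def)
  ultimately show ?thesis by blast
qed

locale regular_sym_basis =
  fixes L :: "(complex^'n^'n) set" and k :: nat and B :: "nat \<Rightarrow> complex^'n^'n" and D :: "nat \<Rightarrow> 'n \<times> 'n \<Rightarrow> complex"
  assumes subL: "cmat.subspace L" and symL: "L \<subseteq> symmat" and regL: "regular_subspace L"
    and L_eq: "L = range (\<lambda>a. \<Sum>i<k. mscale (a i) (B i))"
    and D_dual: "i < k \<Longrightarrow> j < k \<Longrightarrow> lin (mat_coords (B i)) (D j) = (if i = j then 1 else 0)"
    and D_sym: "D j (a, b) = D j (b, a)"
    and codim: "k + 2 \<le> cmat.dim (symmat :: (complex^'n^'n) set)"
begin

definition comb :: "(nat \<Rightarrow> complex) \<Rightarrow> complex^'n^'n" where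
  "comb a = (\<Sum>i<k. mscale (a i) (B i))"

definition cdet :: "(nat \<Rightarrow> complex) \<Rightarrow> complex" where
  "cdet a = det (comb a)"

definition cnum :: "'n \<times> 'n \<Rightarrow> (nat \<Rightarrow> complex) \<Rightarrow> complex" where
  "cnum e a = det (\<chi> r c. if c = fst e then (if r = snd e then 1 else 0) else comb a $ r $ c)"

definition symm :: "('n \<times> 'n \<Rightarrow> complex) \<Rightarrow> 'n \<times> 'n \<Rightarrow> complex" where
  "symm h e = (h e + h (snd e, fst e)) / 2"

abbreviation SV :: "('n \<times> 'n \<Rightarrow> complex) set" where
  "SV \<equiv> {x. \<forall>i j. x (i, j) = x (j, i)}"

lemma comb_L: "comb a \<in> L" by (auto simp: comb_def L_eq)

lemma L_comb: "K \<in> L \<Longrightarrow> \<exists>a. K = comb a" by (auto simp: comb_def L_eq)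

lemma B_L: "i < k \<Longrightarrow> B i \<in> L"
proof -
  assume i: "i < k"
  have "comb (\<lambda>j. if j = i then 1 else 0) = (\<Sum>j<k. if j = i then B j else 0)"
    unfolding comb_def by (intro sum.cong refl) simp
  then show ?thesis using comb_L[of "\<lambda>j. if j = i then 1 else 0"] i by simp
qed

lemma comb_restrict: "comb a = comb (\<lambda>i. if i < k then a i else 0)"
  unfolding comb_def by (intro sum.cong) auto

lemma mat_coords_SV: "mat_coords M \<in> SV \<longleftrightarrow> M \<in> symmat"
  by (simp add: symmat_iff)

lemma comb_entry: "comb a $ r $ c = (\<Sum>i<k. a i * B i $ r $ c)"
  by (simp add: comb_def sum_component mscale_def)

lemma k_pos: "k > 0"
proof (rule ccontr)
  assume "\<not> k > 0"
  then have "comb a = 0" for a unfolding comb_def by simp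
  moreover obtain K where "K \<in> L" "invertible K" using regL by (auto simp: regular_subspace_def)
  ultimately have "invertible (0 :: complex^'n^'n)" using L_comb by metis
  then have "(0 :: complex^'n^'n) ** matrix_inv 0 = mat 1" by (rule matrix_inv_invertible)
  then have "(0 :: complex^'n^'n) = mat 1" by (simp add: matrix_matrix_mult_def vec_eq_iff)
  then have "(0 :: complex^'n^'n) $ i $ i = mat 1 $ i $ i" for i by simp
  then show False by (simp add: mat_def)
qed

sublocale param_cone k "\<lambda>i. mat_coords (B i)" D SV cdet cnum
proof
  have entry: "(\<lambda>a. comb a $ r $ c) \<in> poly_fun" for r c
    unfolding comb_entry by (intro pf_intros)
  have "(\<lambda>a. det (\<chi> r c. comb a $ r $ c)) \<in> poly_fun" by (rule det_poly) (rule entry)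
  then show "cdet \<in> poly_fun" by (simp add: cdet_def[abs_def])
  show "cnum e \<in> poly_fun" for e
    unfolding cnum_def[abs_def]
  proof (rule det_poly)
    show "(\<lambda>a. if c = fst e then (if r = snd e then 1 else 0) else comb a $ r $ c) \<in> poly_fun" for r c
      by (cases "c = fst e"; cases "r = snd e") (simp_all add: pconst entry)
  qed
  show "zariski_closed SV"
    unfolding zariski_closed_def
  proof (intro exI conjI)
    show "range (\<lambda>(i, j) x. x (i, j) - x (j, i)) \<subseteq> (poly_fun :: (('n \<times> 'n \<Rightarrow> complex) \<Rightarrow> complex) set)"
      by (auto intro!: pf_intros)
    show "SV = {x. \<forall>p\<in>range (\<lambda>(i, j) x. x (i, j) - x (j, i)). p x = 0}" by auto
  qed
qed (use k_pos D_dual D_sym in auto)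

lemma reg_invertible: "a \<in> reg \<longleftrightarrow> a \<in> supp \<and> invertible (comb a)"
  by (simp add: reg_def cdet_def invertible_det_nz)

lemma inv_matrix_inv: "a \<in> reg \<Longrightarrow> inv a = mat_coords (matrix_inv (comb a))"
  by (auto simp: reg_invertible inv_def cnum_def cdet_def mat_coords_def matrix_inv_cofactor fun_eq_iff cong: if_cong)

lemma X0_eq: "X0 = mat_coords ` {matrix_inv K | K. K \<in> L \<and> invertible K}"
proof -
  have "inv a \<in> mat_coords ` {matrix_inv K | K. K \<in> L \<and> invertible K}" if "a \<in> reg" for a
    using that comb_L inv_matrix_inv reg_invertible by blast
  moreover have "mat_coords (matrix_inv K) \<in> inv ` reg" if K: "K \<in> L" "invertible K" for K
  proof -
    obtain a where "K = comb a" using L_comb K by blast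
    then have a': "K = comb (\<lambda>i. if i < k then a i else 0)" using comb_restrict by simp
    then have r: "(\<lambda>i. if i < k then a i else 0) \<in> reg" using K by (simp add: reg_invertible supp_def)
    have "mat_coords (matrix_inv K) = inv (\<lambda>i. if i < k then a i else 0)"
      by (simp only: a' inv_matrix_inv[OF r])
    then show ?thesis using r by blast
  qed
  ultimately show ?thesis unfolding X0_def by auto
qed

lemma reciprocal_X: "M \<in> reciprocal_variety L \<longleftrightarrow> mat_coords M \<in> X"
  by (simp add: reciprocal_variety_def mat_zariski_closure_def X_def X0_eq)

lemma polar_H: "M \<in> polar_space L \<longleftrightarrow> mat_coords M \<in> H"
proof -
  have "trace (K ** M) = 0" if M: "\<forall>i<k. lin (mat_coords (B i)) (mat_coords M) = 0" and K: "K \<in> L" for K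
  proof -
    obtain a where a: "K = comb a" using L_comb K by blast
    have "trace (K ** M) = lin (mat_coords K) (mat_coords M)" using K symL by (intro trace_lin) auto
    also have "\<dots> = (\<Sum>e\<in>UNIV. \<Sum>i<k. a i * (mat_coords (B i) e * mat_coords M e))"
      by (simp add: a comb_def lin_def mat_coords_sum mat_coords_linear sum_distrib_right mult.assoc)
    also have "\<dots> = (\<Sum>i<k. a i * lin (mat_coords (B i)) (mat_coords M))"
      by (subst sum.swap) (simp add: lin_def sum_distrib_left)
    finally show ?thesis using M by simp
  qed
  moreover have "lin (mat_coords (B i)) (mat_coords M) = 0" if "\<forall>K\<in>L. trace (K ** M) = 0" "i < k" for i
    using that B_L symL trace_lin by (metis subsetD)
  ultimately have "(\<forall>K\<in>L. trace (K ** M) = 0) \<longleftrightarrow> (\<forall>i<k. lin (mat_coords (B i)) (mat_coords M) = 0)"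
    by blast
  then show ?thesis by (simp add: polar_space_def H_def symmat_iff)
qed

text \<open>A form injective on \<open>H\<close> would leave \<open>H\<close> of dimension at most
  one; but \<open>H\<close> and the \<open>k\<close> dual vectors span the symmetric matrices,
  against \<open>codim\<close>.\<close>

lemma H_kernel: "\<exists>\<gamma>\<in>H. \<gamma> \<noteq> (\<lambda>_. 0) \<and> lin t \<gamma> = 0"
proof (rule ccontr)
  assume H: "\<not> ?thesis"
  \<comment> \<open>The value 0 covers the case that \<open>H\<close> is zero, so one vector
    suffices in the spanning set either way.\<close>
  define \<gamma>1 where "\<gamma>1 = (if \<exists>\<gamma>\<in>H. \<gamma> \<noteq> (\<lambda>_. 0) then SOME \<gamma>. \<gamma> \<in> H \<and> \<gamma> \<noteq> (\<lambda>_. 0) else (\<lambda>_. 0))"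
  have multiple: "\<exists>c. \<gamma> = (\<lambda>e. c * \<gamma>1 e)" if \<gamma>: "\<gamma> \<in> H" for \<gamma>
  proof (cases "\<exists>\<gamma>\<in>H. \<gamma> \<noteq> (\<lambda>_. 0)")
    case False
    then show ?thesis using \<gamma> by (intro exI[of _ 0]) auto
  next
    case True
    then have "\<gamma>1 \<in> H \<and> \<gamma>1 \<noteq> (\<lambda>_. 0)" unfolding \<gamma>1_def using someI_ex[of "\<lambda>\<gamma>. \<gamma> \<in> H \<and> \<gamma> \<noteq> (\<lambda>_. 0)"] by auto
    then have g1: "\<gamma>1 \<in> H" "lin t \<gamma>1 \<noteq> 0" using H by auto
    let ?g = "\<lambda>e. lin t \<gamma>1 * \<gamma> e - lin t \<gamma> * \<gamma>1 e"
    have "?g \<in> H" using g1 \<gamma> unfolding H_iff by (auto simp: sv_diff sv_scale)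
    moreover have "lin t ?g = 0" by (simp add: lin_diff lin_scale)
    ultimately have g0: "?g = (\<lambda>_. 0)" using H by blast
    have "\<gamma> e = lin t \<gamma> / lin t \<gamma>1 * \<gamma>1 e" for e
      using fun_cong[OF g0, of e] g1 by (simp add: field_simps)
    then show ?thesis by blast
  qed
  let ?T = "insert (of_coords \<gamma>1) ((\<lambda>j. of_coords (D j)) ` {..<k})"
  have "symmat \<subseteq> cmat.span ?T"
  proof
    fix M :: "complex^'n^'n" assume M: "M \<in> symmat"
    let ?x = "mat_coords M"
    have "?x \<in> SV" using M by (simp only: mat_coords_SV)
    then have "(\<lambda>e. ?x e - sec (sv ?x) e) \<in> H"
      using V_diff[OF _ sec_V] by (simp only: H_iff sv_diff sv_sec[OF sv_supp]) simp
    then obtain c where c: "(\<lambda>e. ?x e - sec (sv ?x) e) = (\<lambda>e. c * \<gamma>1 e)" using multiple by blast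
    have "?x e = c * \<gamma>1 e + (\<Sum>j<k. sv ?x j * D j e)" for e
      using fun_cong[OF c, of e] by (simp add: sec_def algebra_simps)
    then have "?x = mat_coords (mscale c (of_coords \<gamma>1) + (\<Sum>j<k. mscale (sv ?x j) (of_coords (D j))))"
      by (auto simp: mat_coords_linear mat_coords_sum)
    then have "M = mscale c (of_coords \<gamma>1) + (\<Sum>j<k. mscale (sv ?x j) (of_coords (D j)))"
      by (simp only: mat_coords_inject)
    also have "\<dots> \<in> cmat.span ?T"
      by (intro cmat.span_add cmat.span_scale cmat.span_sum cmat.span_base) auto
    finally show "M \<in> cmat.span ?T" .
  qed
  then have "cmat.dim (symmat :: (complex^'n^'n) set) \<le> card ?T" by (rule cmat.dim_le_card) simp
  also have "\<dots> \<le> Suc (card ((\<lambda>j. of_coords (D j)) ` {..<k}))" by (rule card_insert_le_m1) simp_all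
  also have "\<dots> \<le> Suc k" using card_image_le[of "{..<k}"] by fastforce
  finally show False using codim by simp
qed

sublocale reciprocal_cone k "\<lambda>i. mat_coords (B i)" D SV cdet cnum symm
proof
  show "(\<lambda>h. symm h e) \<in> poly_fun" for e
    using pmult[OF padd[OF pvar[of e] pvar[of "(snd e, fst e)"]] pconst[of "1/2"]] by (simp add: symm_def)
  show "inv a \<in> SV" if a: "a \<in> reg" for a
  proof -
    have "matrix_inv (comb a) \<in> symmat" using a comb_L symL by (intro matrix_inv_symmat) (auto simp: reg_invertible)
    then show ?thesis by (simp only: inv_matrix_inv[OF a] mat_coords_SV)
  qed
  show "\<exists>a'\<in>reg. inv a' = (\<lambda>e. c * inv a e)" if a: "a \<in> reg" and c: "c \<noteq> 0" for a c
  proof -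
    let ?a = "\<lambda>i. (1 / c) * a i"
    have eq: "comb ?a = mscale (1 / c) (comb a)"
      unfolding comb_def by (simp add: cmat.scale_sum_right)
    have i: "invertible (comb a)" using a by (simp add: reg_invertible)
    have r: "?a \<in> reg" using a matrix_inv_mscale(1)[OF i, of "1/c"] c unfolding reg_invertible eq by (auto simp: supp_def)
    have "inv ?a = mat_coords (matrix_inv (comb ?a))" by (rule inv_matrix_inv[OF r])
    also have "\<dots> = mat_coords (mscale c (matrix_inv (comb a)))"
      unfolding eq using matrix_inv_mscale(2)[OF i, of "1/c"] c by simp
    also have "\<dots> = (\<lambda>e. c * inv a e)" by (simp add: mat_coords_linear inv_matrix_inv[OF a])
    finally show ?thesis using r by blast
  qed
  show "\<exists>\<gamma>\<in>H. \<gamma> \<noteq> (\<lambda>_. 0) \<and> lin t \<gamma> = 0" for t by (rule H_kernel)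
qed (auto simp: symm_def fun_eq_iff add_divide_distrib)

end

lemma regular_sym_basis_exists:
  fixes L :: "(complex^'n^'n) set"
  assumes "lin_subspace_sym L" "regular_subspace L"
    and dim: "cmat.dim L + 2 \<le> cmat.dim (symmat :: (complex^'n^'n) set)"
  shows "\<exists>k B D. regular_sym_basis L k B D"
proof -
  have L: "cmat.subspace L" "L \<subseteq> symmat" using assms by (auto simp: lin_subspace_sym_def)
  obtain T where T: "T \<subseteq> L" "cmat.independent T" "L \<subseteq> cmat.span T" "card T = cmat.dim L"
    by (rule cmat.basis_exists)
  define k where "k = card T"
  have fin: "finite T" by (rule finite_independent_cmat[OF T(2)])
  then obtain B where B: "bij_betw B {..<k} T"
    unfolding k_def using ex_bij_betw_nat_finite[OF fin] by (auto simp: atLeast0LessThan)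
  have img: "B ` {..<k} = T" and inj: "inj_on B {..<k}" using B by (auto simp: bij_betw_def)
  have sym: "B i \<in> symmat" if "i < k" for i using img T(1) L(2) that by blast
  obtain D where D: "\<forall>i<k. \<forall>j<k. lin (mat_coords (B i)) (D j) = (if i = j then 1 else 0)" "\<forall>j a b. D j (a, b) = D j (b, a)"
    using dual_vectors[OF inj _ sym] T(2) img by auto
  have "L = cmat.span T" using T(1,3) L(1) cmat.span_minimal by blast
  also have "\<dots> = range (\<lambda>a. \<Sum>i<k. mscale (a i) (B i))"
  proof -
    have "cmat.span T = range (\<lambda>u. \<Sum>v\<in>T. mscale (u v) v)" by (rule cmat.span_finite[OF fin])
    also have "\<dots> = range (\<lambda>u. \<Sum>i<k. mscale (u (B i)) (B i))"
      by (intro image_cong refl sum.reindex_bij_betw[OF B, symmetric])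
    also have "\<dots> = range (\<lambda>a. \<Sum>i<k. mscale (a i) (B i))"
    proof (intro equalityI subsetI)
      fix M assume "M \<in> range (\<lambda>a. \<Sum>i<k. mscale (a i) (B i))"
      then obtain a where a: "M = (\<Sum>i<k. mscale (a i) (B i))" by blast
      have "M = (\<Sum>i<k. mscale ((a \<circ> the_inv_into {..<k} B) (B i)) (B i))"
        unfolding a by (intro sum.cong refl) (simp add: the_inv_into_f_f[OF inj])
      then show "M \<in> range (\<lambda>u. \<Sum>i<k. mscale (u (B i)) (B i))" by blast
    qed auto
    finally show ?thesis .
  qed
  finally show ?thesis
    using L assms(2) D dim T(4) unfolding k_def[symmetric]
    by (intro exI[of _ k] exI[of _ B] exI[of _ D]) (unfold_locales, auto simp: k_def)
qed

section \<open>The maximum likelihood degree as a number of lines\<close>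


lemma in_span_pair: "x \<in> cmat.span {u, v} \<longleftrightarrow> (\<exists>a b. x = mscale a u + mscale b v)"
  by (simp add: cmat.span_breakdown_eq) (metis add.commute diff_add_cancel add_diff_cancel_left')

lemma indep_pair_iff: "indep_pair u v \<longleftrightarrow> (\<forall>a b. mscale a u + mscale b v = 0 \<longrightarrow> a = 0 \<and> b = 0)"
proof (cases "u = v")
  case True
  have "mscale 1 v + mscale (-1) v = 0" by (auto simp: mscale_def vec_eq_iff)
  then show ?thesis using True unfolding indep_pair_def by (metis zero_neq_one)
next
  case False
  have "cmat.dependent {u, v} \<longleftrightarrow> (\<exists>f. (f u \<noteq> 0 \<or> f v \<noteq> 0) \<and> mscale (f u) u + mscale (f v) v = 0)"
    using False by (simp add: cmat.dependent_finite)
  also have "\<dots> \<longleftrightarrow> (\<exists>a b. (a \<noteq> 0 \<or> b \<noteq> 0) \<and> mscale a u + mscale b v = 0)"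
  proof
    assume "\<exists>a b. (a \<noteq> 0 \<or> b \<noteq> 0) \<and> mscale a u + mscale b v = 0"
    then obtain a b where "(a \<noteq> 0 \<or> b \<noteq> 0) \<and> mscale a u + mscale b v = 0" by blast
    then show "\<exists>f. (f u \<noteq> 0 \<or> f v \<noteq> 0) \<and> mscale (f u) u + mscale (f v) v = 0"
      using False by (intro exI[of _ "\<lambda>x. if x = u then a else b"]) auto
  qed blast
  finally show ?thesis using False unfolding indep_pair_def by blast
qed

lemma is_line_span:
  assumes "u \<in> symmat" "v \<in> symmat" "indep_pair u v"
  shows "is_line (cmat.span {u, v})"
proof -
  have "cmat.span {u, v} \<subseteq> symmat" using assms by (intro cmat.span_minimal subspace_symmat) auto
  moreover have "cmat.dim (cmat.span {u, v}) = 2"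
    using assms(3) by (subst cmat.dim_span_eq_card_independent) (auto simp: indep_pair_def)
  ultimately show ?thesis by (simp add: is_line_def cmat.subspace_span)
qed

lemma line_eq_span:
  fixes W :: "(complex^'n^'n) set"
  assumes W: "is_line W" and uv: "indep_pair u v" "u \<in> W" "v \<in> W"
  shows "W = cmat.span {u, v}"
proof
  show "cmat.span {u, v} \<subseteq> W" using W uv by (intro cmat.span_minimal) (auto simp: is_line_def)
  show "W \<subseteq> cmat.span {u, v}"
  proof (rule ccontr)
    assume "\<not> ?thesis"
    then obtain w where w: "w \<in> W" "w \<notin> cmat.span {u, v}" by blast
    then have ind: "cmat.independent (insert w {u, v})"
      using uv(1) cmat.independent_insertI[OF w(2)] unfolding indep_pair_def by blast
    have "w \<noteq> u" "w \<noteq> v" using w(2) by (auto intro: cmat.span_base)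
    then have card: "card (insert w {u, v}) = 3" using uv(1) by (simp add: indep_pair_def)
    obtain T where T: "T \<subseteq> W" "cmat.independent T" "W \<subseteq> cmat.span T" "card T = cmat.dim W"
      by (rule cmat.basis_exists)
    have "insert w {u, v} \<subseteq> cmat.span T" using T(3) w(1) uv by blast
    then have "card (insert w {u, v}) \<le> card T"
      using cmat.independent_span_bound[OF finite_independent_cmat[OF T(2)] ind] by blast
    then show False using card T(4) W by (simp add: is_line_def)
  qed
qed

lemma line_second_point:
  assumes W: "is_line W" and S: "S \<in> W" "S \<noteq> 0"
  shows "\<exists>v\<in>W. indep_pair S v"
proof (rule ccontr)
  assume H: "\<not> ?thesis"
  have "v \<in> cmat.span {S}" if "v \<in> W" for v
  proof -
    have "\<not> indep_pair S v" using H that by blast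
    then obtain a b where ab: "mscale a S + mscale b v = 0" "a \<noteq> 0 \<or> b \<noteq> 0"
      unfolding indep_pair_iff by auto
    have "b \<noteq> 0"
    proof
      assume "b = 0"
      then have "mscale a S = 0" using ab(1) by simp
      then show False using ab(2) \<open>b = 0\<close> S(2) cmat.scale_eq_0_iff by blast
    qed
    then have "v = mscale (1 / b) (mscale b v)" by simp
    also have "mscale b v = mscale (- a) S" using ab(1) by (simp add: eq_neg_iff_add_eq_0 add.commute)
    finally have "v = mscale (1 / b) (mscale (- a) S)" .
    moreover have "mscale (1 / b) (mscale (- a) S) \<in> cmat.span {S}"
      by (intro cmat.span_scale cmat.span_base) simp
    ultimately show ?thesis by (rule ssubst)
  qed
  then have "cmat.dim W \<le> card {S}" by (intro cmat.dim_le_card) auto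
  then show False using W by (simp add: is_line_def)
qed

text \<open>Supplies the form for the contractions: on the Pluecker vector of \<open>u\<close> and
  \<open>v\<close> it returns \<open>u\<close>.\<close>

lemma indep_pair_functional:
  assumes "indep_pair u v"
  shows "\<exists>l. lin l (mat_coords v) = 1 \<and> lin l (mat_coords u) = 0"
proof -
  let ?u = "mat_coords u" and ?v = "mat_coords v"
  have "u \<noteq> 0"
  proof
    assume "u = 0"
    then have "mscale 1 u + mscale 0 v = 0" by simp
    then show False using assms unfolding indep_pair_iff by (metis zero_neq_one)
  qed
  then obtain e where e: "?u e \<noteq> 0" using mat_coords_inject[of u 0] by (auto simp: mat_coords_linear fun_eq_iff)
  have "\<exists>e'. ?v e' - ?v e / ?u e * ?u e' \<noteq> 0"
  proof (rule ccontr)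
    assume "\<not> ?thesis"
    then have "mat_coords (mscale (- ?v e / ?u e) u + mscale 1 v) = mat_coords 0"
      by (simp add: mat_coords_linear fun_eq_iff)
    then show False using assms unfolding mat_coords_inject indep_pair_iff by (metis zero_neq_one)
  qed
  then obtain e' where e': "?v e' - ?v e / ?u e * ?u e' \<noteq> 0" by blast
  let ?z = "?v e' - ?v e / ?u e * ?u e'"
  \<comment> \<open>Coordinate \<open>e'\<close> after elimination of \<open>u\<close> with the
    pivot \<open>e\<close>, normalised by \<open>?z\<close> to be 1 at \<open>v\<close>.\<close>
  define l where "l = (\<lambda>i. (1 / ?z) * ((if i = e' then 1 else 0) - (?u e' / ?u e) * (if i = e then 1 else 0)))"
  have l: "lin l x = (1 / ?z) * (x e' - ?u e' / ?u e * x e)" for x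
    unfolding l_def lin_scale_left lin_diff_left lin_unit ..
  have "lin l ?u = 0" using e by (simp add: l)
  moreover have "lin l ?v = 1"
  proof -
    have "?v e' - ?u e' / ?u e * ?v e = ?z" by simp
    then show ?thesis unfolding l using e' by simp
  qed
  ultimately show ?thesis by blast
qed

lemma zariski_closed_single: "p \<in> poly_fun \<Longrightarrow> zariski_closed {x. p x = 0}"
  unfolding zariski_closed_def by (rule exI[of _ "{p}"]) auto

lemma symmat_affine: "affine_closed {x :: 'n \<times> 'n \<Rightarrow> complex. \<forall>i j. x (i, j) = x (j, i)}"
  by (auto simp: affine_closed_def)

text \<open>Irreducibility of the space of symmetric matrices. It makes the generic cardinality
  unique, as the description operator in \<open>ml_degree\<close> demands.\<close>

lemma nonempty_open_meet:
  fixes U U' :: "(complex^'n^'n) set"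
  assumes "nonempty_open_in_sym U" "nonempty_open_in_sym U'"
  shows "U \<inter> U' \<noteq> {}"
proof -
  have nz: "\<exists>p\<in>poly_fun. (\<exists>x\<in>{x. \<forall>i j. x (i, j) = x (j, i)}. p x \<noteq> 0) \<and>
      (\<forall>M\<in>symmat. p (mat_coords M) \<noteq> 0 \<longrightarrow> M \<in> U)"
    if "nonempty_open_in_sym U" for U :: "(complex^'n^'n) set"
  proof -
    obtain C P M where *: "P \<subseteq> poly_fun" "C = {x. \<forall>p\<in>P. p x = 0}"
      "U = {M\<in>symmat. mat_coords M \<notin> C}" "M \<in> U"
      using \<open>nonempty_open_in_sym U\<close> unfolding nonempty_open_in_sym_def zariski_closed_def by blast
    then obtain p where "p \<in> P" "p (mat_coords M) \<noteq> 0" by blast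
    then show ?thesis using * by (intro bexI[of _ p]) (auto simp: symmat_iff)
  qed
  obtain p where p: "p \<in> poly_fun" "\<exists>x\<in>{x. \<forall>i j. x (i, j) = x (j, i)}. p x \<noteq> 0" "\<forall>M\<in>symmat. p (mat_coords M) \<noteq> 0 \<longrightarrow> M \<in> U"
    using nz[OF assms(1)] by blast
  obtain q where q: "q \<in> poly_fun" "\<exists>x\<in>{x. \<forall>i j. x (i, j) = x (j, i)}. q x \<noteq> 0" "\<forall>M\<in>symmat. q (mat_coords M) \<noteq> 0 \<longrightarrow> M \<in> U'"
    using nz[OF assms(2)] by blast
  obtain x where x: "\<forall>i j. x (i, j) = x (j, i)" "p x * q x \<noteq> 0"
    using poly_fun_domain[OF symmat_affine, unfolded fun_domain_def, rule_format, OF p(1) q(1) p(2) q(2)] by blast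
  then have "of_coords x \<in> symmat" by (simp add: symmat_iff)
  then show ?thesis using p(3) q(3) x(2) by (metis disjoint_iff mult_eq_0_iff of_coords_inverse(1))
qed

lemma ml_degree_eqI:
  assumes U: "nonempty_open_in_sym U" and fib: "\<And>S. S \<in> U \<Longrightarrow> finite (ml_fibre L S) \<and> card (ml_fibre L S) = d"
  shows "ml_degree L = d"
  unfolding ml_degree_def
proof (rule the_equality)
  show "\<exists>U. nonempty_open_in_sym U \<and> (\<forall>S\<in>U. finite (ml_fibre L S) \<and> card (ml_fibre L S) = d)"
    using assms by blast
  fix d' assume "\<exists>U. nonempty_open_in_sym U \<and> (\<forall>S\<in>U. finite (ml_fibre L S) \<and> card (ml_fibre L S) = d')"
  then obtain U' where U': "nonempty_open_in_sym U'" "\<forall>S\<in>U'. card (ml_fibre L S) = d'" by blast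
  obtain S where S: "S \<in> U" "S \<in> U'" using nonempty_open_meet[OF U U'(1)] by blast
  then show "d' = d" using fib[OF S(1)] U'(2) by simp
qed

context regular_sym_basis
begin

lemma open_nonvanishing:
  assumes "p \<in> poly_fun" "\<exists>S\<in>SV. p S \<noteq> 0"
  shows "nonempty_open_in_sym {M\<in>symmat. p (mat_coords M) \<noteq> 0}"
proof -
  obtain x where x: "x \<in> SV" "p x \<noteq> 0" using assms by blast
  then have "of_coords x \<in> {M\<in>symmat. p (mat_coords M) \<noteq> 0}" by (simp add: symmat_iff)
  moreover have "{M\<in>symmat. p (mat_coords M) \<noteq> 0} = {M\<in>symmat. mat_coords M \<notin> {x. p x = 0}}" by simp
  ultimately show ?thesis unfolding nonempty_open_in_sym_def
    using zariski_closed_single[OF assms(1)] by blast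
qed

lemma ml_fibre_iff:
  assumes S: "S \<in> symmat"
  shows "M \<in> ml_fibre L S \<longleftrightarrow> mat_coords M \<in> X \<and> sv (mat_coords M) = sv (mat_coords S)"
proof -
  have "M \<in> ml_fibre L S \<longleftrightarrow> mat_coords M \<in> X \<and> M - S \<in> polar_space L"
    unfolding ml_fibre_def by (auto simp: reciprocal_X) (metis add_diff_cancel_right' diff_add_cancel)+
  also have "\<dots> \<longleftrightarrow> mat_coords M \<in> X \<and> sv (mat_coords M) = sv (mat_coords S)"
  proof (intro conj_cong refl)
    assume "mat_coords M \<in> X"
    then have "mat_coords M \<in> SV" by (rule X_V)
    moreover have "mat_coords S \<in> SV" using S by (simp only: mat_coords_SV)
    ultimately have "mat_coords (M - S) \<in> SV" unfolding mat_coords_linear by (rule V_diff)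
    then show "M - S \<in> polar_space L \<longleftrightarrow> sv (mat_coords M) = sv (mat_coords S)"
      unfolding polar_H H_iff by (simp only: mat_coords_linear sv_diff) (auto simp: fun_eq_iff)
  qed
  finally show ?thesis .
qed

definition join_lines :: "(complex^'n^'n) set set" where
  "join_lines = {W. is_line W \<and>
     (\<exists>\<Sigma> \<Gamma>. \<Sigma> \<in> reciprocal_variety L \<and> \<Sigma> \<noteq> 0 \<and> \<Gamma> \<in> polar_space L \<and> \<Gamma> \<noteq> 0 \<and>
        indep_pair \<Sigma> \<Gamma> \<and> \<Sigma> \<in> W \<and> \<Gamma> \<in> W)}"

definition join_coords :: "(('n \<times> 'n) \<times> ('n \<times> 'n) \<Rightarrow> complex) set" where
  "join_coords = {pluecker u v | u v. indep_pair u v \<and> cmat.span {u, v} \<in> join_lines}"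

lemma J_lines_iff: "W \<in> J_lines L \<longleftrightarrow> is_line W \<and>
    (\<forall>u v. u \<in> W \<and> v \<in> W \<and> indep_pair u v \<longrightarrow> pluecker u v \<in> zariski_closure join_coords)"
  by (simp add: J_lines_def line_closure_def join_lines_def join_coords_def)

lemma join_lines_J: "W \<in> join_lines \<Longrightarrow> W \<in> J_lines L"
proof -
  assume W: "W \<in> join_lines"
  then have line: "is_line W" by (simp add: join_lines_def)
  have "pluecker u v \<in> zariski_closure join_coords" if "u \<in> W" "v \<in> W" "indep_pair u v" for u v
  proof -
    have "pluecker u v \<in> join_coords"
      using line_eq_span[OF line that(3,1,2)] W that(3) by (auto simp: join_coords_def)
    then show ?thesis by (auto simp: zariski_closure_def)
  qed
  then show ?thesis using line by (simp add: J_lines_iff)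
qed

text \<open>Another spanning pair changes the Pluecker vector by the determinant
  \<open>a * d - b * c\<close>, and this scalar moves into the point of the cone
  \<open>X\<close>.\<close>

lemma join_coords_plk: "join_coords \<subseteq> join_plk"
proof
  fix q assume "q \<in> join_coords"
  then obtain u v where q: "q = pluecker u v" "indep_pair u v" "cmat.span {u, v} \<in> join_lines"
    by (auto simp: join_coords_def)
  then obtain \<Sigma> \<Gamma> where *: "is_line (cmat.span {u, v})" "\<Sigma> \<in> reciprocal_variety L" "\<Gamma> \<in> polar_space L"
    "indep_pair \<Sigma> \<Gamma>" "\<Sigma> \<in> cmat.span {u, v}" "\<Gamma> \<in> cmat.span {u, v}" by (auto simp: join_lines_def)
  have eq: "cmat.span {u, v} = cmat.span {\<Sigma>, \<Gamma>}" by (rule line_eq_span[OF *(1,4,5,6)])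
  have "u \<in> cmat.span {\<Sigma>, \<Gamma>}" "v \<in> cmat.span {\<Sigma>, \<Gamma>}" unfolding eq[symmetric] by (auto intro: cmat.span_base)
  then obtain a b c d where u: "u = mscale a \<Sigma> + mscale b \<Gamma>" and v: "v = mscale c \<Sigma> + mscale d \<Gamma>"
    unfolding in_span_pair by blast
  have "q = plk (\<lambda>e. (a * d - b * c) * mat_coords \<Sigma> e) (mat_coords \<Gamma>)"
    unfolding q(1) pluecker_plk u v mat_coords_linear plk_def by (auto simp: fun_eq_iff algebra_simps)
  moreover have "(\<lambda>e. (a * d - b * c) * mat_coords \<Sigma> e) \<in> X"
    using *(2) by (intro X_scale) (simp add: reciprocal_X)
  moreover have "mat_coords \<Gamma> \<in> H" using *(3) by (simp add: polar_H)
  ultimately show "q \<in> join_plk" unfolding join_plk_def by blast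
qed

lemma J_line_through:
  assumes W: "W \<in> J_lines L \<inter> lines_through S" and S: "S \<noteq> 0"
  obtains v l where "v \<in> W" "indep_pair S v" "plk (mat_coords S) (mat_coords v) \<in> zariski_closure join_coords"
    "lin l (mat_coords v) = 1" "lin l (mat_coords S) = 0"
proof -
  have line: "is_line W" "S \<in> W" using W by (auto simp: lines_through_def)
  obtain v where v: "v \<in> W" "indep_pair S v" using line_second_point[OF line S] by blast
  have "pluecker S v \<in> zariski_closure join_coords" using W line v by (auto simp: J_lines_iff)
  moreover obtain l where "lin l (mat_coords v) = 1" "lin l (mat_coords S) = 0"
    using indep_pair_functional[OF v(2)] by blast
  ultimately show ?thesis using that v by (simp add: pluecker_plk)
qed

lemma nonzero_of_sv: "sv (mat_coords S) \<noteq> (\<lambda>_. 0) \<Longrightarrow> S \<noteq> 0"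
  by (auto simp: mat_coords_linear sv_def lin_zero)

text \<open>The form of \<open>B 0\<close> keeps \<open>S\<close> away from the origin in both
  cases; in the dominant case it also serves as the form that vanishes on \<open>H\<close> but not
  at \<open>S\<close>.\<close>

lemma B0_nonzero: "\<exists>x\<in>SV. lin (mat_coords (B 0)) x \<noteq> 0"
proof (rule bexI)
  show "lin (mat_coords (B 0)) (D 0) \<noteq> 0" unfolding D_dual[OF k_pos k_pos] by simp
  show "D 0 \<in> SV" by (rule dv[OF k_pos])
qed

lemma degenerate_case:
  assumes "\<not> dominant_cone"
  shows "\<exists>U. nonempty_open_in_sym U \<and> (\<forall>S\<in>U. ml_fibre L S = {} \<and> J_lines L \<inter> lines_through S = {})"
proof -
  obtain p s where p: "p \<in> poly_fun" "\<forall>x\<in>X0. p (sv x) = 0" "s \<in> supp" "p s \<noteq> 0"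
    using assms unfolding dominant_cone_def by blast
  have psv: "(\<lambda>x. p (sv x)) \<in> poly_fun" by (rule pf_subst[OF p(1) sv_poly])
  let ?F = "\<lambda>x. p (sv x) * lin (mat_coords (B 0)) x"
  have "\<exists>x\<in>SV. ?F x \<noteq> 0"
  proof (rule poly_fun_domain[OF symmat_affine, unfolded fun_domain_def, rule_format, OF psv])
    show "(\<lambda>x. lin (mat_coords (B 0)) x) \<in> poly_fun" by (intro lin_fa fun_algebra_poly_fun pvar pconst)
    show "\<exists>x\<in>SV. p (sv x) \<noteq> 0" by (rule bexI[OF _ sec_V[of s]]) (simp add: sv_sec[OF p(3)] p(4))
    show "\<exists>x\<in>SV. lin (mat_coords (B 0)) x \<noteq> 0" by (rule B0_nonzero)
  qed
  moreover have "?F \<in> poly_fun" by (intro pmult psv lin_fa fun_algebra_poly_fun pvar pconst)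
  ultimately have U: "nonempty_open_in_sym {M\<in>symmat. ?F (mat_coords M) \<noteq> 0}" by (rule open_nonvanishing[rotated])
  have "ml_fibre L S = {} \<and> J_lines L \<inter> lines_through S = {}" if S: "S \<in> symmat" "?F (mat_coords S) \<noteq> 0" for S
  proof
    have pS: "p (sv (mat_coords S)) \<noteq> 0" and "lin (mat_coords (B 0)) (mat_coords S) \<noteq> 0" using S by auto
    then have S0: "S \<noteq> 0" by (auto simp: mat_coords_linear lin_zero)
    show "ml_fibre L S = {}"
    proof (rule equals0I)
      fix M assume "M \<in> ml_fibre L S"
      then have M: "mat_coords M \<in> X" "sv (mat_coords M) = sv (mat_coords S)" by (auto simp: ml_fibre_iff[OF S(1)])
      have "p (sv (mat_coords M)) = 0" by (rule X_ext[OF psv _ M(1)]) (use p(2) in \<open>auto simp: X0_def\<close>)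
      then show False using M(2) pS by simp
    qed
    show "J_lines L \<inter> lines_through S = {}"
    proof (rule equals0I)
      fix W assume W: "W \<in> J_lines L \<inter> lines_through S"
      obtain v l where v: "plk (mat_coords S) (mat_coords v) \<in> zariski_closure join_coords"
        "lin l (mat_coords v) = 1" "lin l (mat_coords S) = 0"
        by (rule J_line_through[OF W S0])
      show False using degenerate_join[OF p(1,2) join_coords_plk v] pS by simp
    qed
  qed
  then show ?thesis using U by (intro exI[of _ "{M\<in>symmat. ?F (mat_coords M) \<noteq> 0}"]) blast
qed

text \<open>Three conditions cut out the open set: \<open>C\<close> nonzero gives the size of the
  fibre and the factorisation of \<open>\<Theta>\<close>, \<open>G\<close> nonzero separates fibre
  points by lines, and the form of \<open>B 0\<close> nonzero keeps the projection of
  \<open>S\<close> away from 0.\<close>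

lemma dominant_case:
  assumes dominant_cone
  shows "\<exists>U d. nonempty_open_in_sym U \<and> (\<forall>S\<in>U. finite (ml_fibre L S) \<and> card (ml_fibre L S) = d \<and>
    bij_betw (\<lambda>M. cmat.span {M, S}) (ml_fibre L S) (J_lines L \<inter> lines_through S))"
proof -
  obtain Q d disc where "cone_relation k (\<lambda>i. mat_coords (B i)) D SV cdet cnum Q d disc"
    using cone_relation_exists[OF assms] by blast
  then interpret cr: cone_relation k "\<lambda>i. mat_coords (B i)" D SV cdet cnum Q d disc .
  interpret rr: reciprocal_relation k "\<lambda>i. mat_coords (B i)" D SV cdet cnum symm Q d disc ..
  obtain C \<Theta> where C: "C \<in> poly_fun" "\<Theta> \<in> cpoly poly_fun" "\<exists>s\<in>supp. C s \<noteq> 0"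
    and fibre: "\<forall>s\<in>supp. C s \<noteq> 0 \<longrightarrow> finite (cr.Fib s) \<and> card (cr.Fib s) = d \<and>
       (\<forall>t. \<Theta> (case_sum s t) = smult (C s) (\<Prod>x\<in>cr.Fib s. [:- lin t x, 1:]))"
    and \<Theta>X: "\<forall>x\<in>X. \<forall>t. poly (\<Theta> (case_sum (sv x) t)) (lin t x) = 0"
    using rr.universal_relation by blast
  obtain G where G: "G \<in> poly_fun" "\<exists>S\<in>SV. G S \<noteq> 0"
    and sep: "\<forall>S\<in>SV. G S \<noteq> 0 \<longrightarrow> (\<forall>x\<in>cr.Fib (sv S). x \<noteq> S \<and>
      (\<forall>x'\<in>cr.Fib (sv S). (\<exists>c. \<forall>e. S e - x' e = c * (S e - x e)) \<longrightarrow> x' = x))"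
    using rr.generic_separation by blast
  have Csv: "(\<lambda>x. C (sv x)) \<in> poly_fun" by (rule pf_subst[OF C(1) sv_poly])
  have lp: "(\<lambda>x. lin (mat_coords (B 0)) x) \<in> poly_fun" by (intro lin_fa fun_algebra_poly_fun pvar pconst)
  note domV = poly_fun_domain[OF symmat_affine, unfolded fun_domain_def, rule_format]
  obtain s where s: "s \<in> supp" "C s \<noteq> 0" using C(3) by blast
  have "\<exists>x\<in>SV. C (sv x) \<noteq> 0" by (rule bexI[OF _ sec_V[of s]]) (simp add: sv_sec[OF s(1)] s(2))
  moreover have "\<exists>x\<in>SV. lin (mat_coords (B 0)) x \<noteq> 0" by (rule B0_nonzero)
  ultimately have "\<exists>x\<in>SV. C (sv x) * lin (mat_coords (B 0)) x \<noteq> 0" by (rule domV[OF Csv lp])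
  then have "\<exists>x\<in>SV. (C (sv x) * lin (mat_coords (B 0)) x) * G x \<noteq> 0"
    by (rule domV[OF pmult[OF Csv lp] G(1) _ G(2)])
  then have U: "nonempty_open_in_sym {M\<in>symmat. (C (sv (mat_coords M)) * lin (mat_coords (B 0)) (mat_coords M)) * G (mat_coords M) \<noteq> 0}"
    by (rule open_nonvanishing[OF pmult[OF pmult[OF Csv lp] G(1)]])
  have "finite (ml_fibre L S) \<and> card (ml_fibre L S) = d \<and>
    bij_betw (\<lambda>M. cmat.span {M, S}) (ml_fibre L S) (J_lines L \<inter> lines_through S)"
    if S: "S \<in> symmat" and nz: "C (sv (mat_coords S)) \<noteq> 0" "lin (mat_coords (B 0)) (mat_coords S) \<noteq> 0" "G (mat_coords S) \<noteq> 0" for S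
  proof -
    let ?S = "mat_coords S"
    let ?F = "cr.Fib (sv ?S)"
    have SV: "?S \<in> SV" using S by (simp only: mat_coords_SV)
    have svS: "sv ?S \<noteq> (\<lambda>_. 0)" using nz(2) k_pos by (auto simp: sv_def fun_eq_iff)
    have S0: "S \<noteq> 0" using svS by (rule nonzero_of_sv)
    have fib: "finite ?F" "card ?F = d" "\<And>t. \<Theta> (case_sum (sv ?S) t) = smult (C (sv ?S)) (\<Prod>x\<in>?F. [:- lin t x, 1:])"
      using fibre sv_supp nz(1) by blast+
    have fib_iff: "M \<in> ml_fibre L S \<longleftrightarrow> mat_coords M \<in> ?F" for M
      by (simp add: ml_fibre_iff[OF S] cr.Fib_def)
    have bij: "bij_betw mat_coords (ml_fibre L S) ?F"
      by (rule bij_betw_byWitness[where f' = of_coords]) (auto simp: fib_iff)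
    have fin: "finite (ml_fibre L S)" and card: "card (ml_fibre L S) = d"
      using bij_betw_finite[OF bij] bij_betw_same_card[OF bij] fib(1,2) by simp_all
    have fibre_point: "M \<in> symmat" "S - M \<in> polar_space L" "M \<in> reciprocal_variety L" "M \<noteq> 0" "S - M \<noteq> 0"
      "indep_pair M (S - M)" "indep_pair M S" "sv (mat_coords M) = sv ?S" "sv (mat_coords (S - M)) = (\<lambda>_. 0)"
      if M: "M \<in> ml_fibre L S" for M
    proof -
      have x: "mat_coords M \<in> X" and sv: "sv (mat_coords M) = sv ?S" using M by (auto simp: ml_fibre_iff[OF S])
      have MV: "mat_coords M \<in> SV" using x by (rule X_V)
      show "M \<in> symmat" using MV by (simp only: mat_coords_SV)
      show "M \<in> reciprocal_variety L" using x by (simp add: reciprocal_X)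
      show "sv (mat_coords M) = sv ?S" by fact
      show sv0: "sv (mat_coords (S - M)) = (\<lambda>_. 0)" by (simp add: mat_coords_linear sv_diff sv)
      show "S - M \<in> polar_space L"
        unfolding polar_H H_iff using sv0 V_diff[OF SV MV] by (simp only: mat_coords_linear)
      show M0: "M \<noteq> 0" using svS sv nonzero_of_sv by metis
      have "mat_coords M \<noteq> ?S" using sep SV nz(3) M fib_iff by blast
      then show SM: "S - M \<noteq> 0" by (auto simp: mat_coords_inject)
      \<comment> \<open>Projections decide independence: \<open>M\<close> projects to the nonzero
        vector \<open>sv ?S\<close>, and \<open>S - M\<close> to 0.\<close>
      have ind: "a = 0 \<and> b = 0" if "mscale a M + mscale b (S - M) = 0" for a b
      proof -
        have "sv (mat_coords (mscale a M + mscale b (S - M))) = (\<lambda>i. a * sv ?S i)"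
          using sv0 sv by (simp only: mat_coords_linear sv_add sv_scale) (simp add: sv_diff sv)
        moreover have "sv (mat_coords (mscale a M + mscale b (S - M))) = (\<lambda>_. 0)"
          unfolding that mat_coords_linear by (auto simp: sv_def lin_zero)
        ultimately have "a * sv ?S i = 0" for i by metis
        then have a: "a = 0" using svS by (metis ext mult_eq_0_iff)
        then show ?thesis using that SM by simp
      qed
      then show "indep_pair M (S - M)" by (simp add: indep_pair_iff)
      show "indep_pair M S"
        unfolding indep_pair_iff
      proof (intro allI impI)
        fix a b assume ab: "mscale a M + mscale b S = 0"
        have "mscale (a + b) M + mscale b (S - M) = mscale a M + mscale b S"
          by (simp add: cmat.scale_left_distrib cmat.scale_right_diff_distrib)
        then show "a = 0 \<and> b = 0" using ind[of "a + b" b] ab by auto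
      qed
    qed
    have S_in: "S \<in> cmat.span {M, S}" "M \<in> cmat.span {M, S}" "S - M \<in> cmat.span {M, S}" for M
      by (auto intro: cmat.span_base cmat.span_diff)
    have line: "is_line (cmat.span {M, S})" if "M \<in> ml_fibre L S" for M
      using fibre_point[OF that] S by (intro is_line_span)
    have "bij_betw (\<lambda>M. cmat.span {M, S}) (ml_fibre L S) (J_lines L \<inter> lines_through S)"
    proof (rule bij_betw_imageI)
      show "inj_on (\<lambda>M. cmat.span {M, S}) (ml_fibre L S)"
      proof (rule inj_onI)
        fix M M' assume M: "M \<in> ml_fibre L S" and M': "M' \<in> ml_fibre L S" and eq: "cmat.span {M, S} = cmat.span {M', S}"
        note P = fibre_point[OF M] and P' = fibre_point[OF M']
        have "cmat.span {M, S} = cmat.span {M, S - M}" by (rule line_eq_span[OF line[OF M] P(6) S_in(2,3)])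
        then have "M' \<in> cmat.span {M, S - M}" using eq S_in(2)[of M'] by simp
        then obtain a b where ab: "M' = mscale a M + mscale b (S - M)" unfolding in_span_pair by blast
        \<comment> \<open>Comparing projections forces \<open>a = 1\<close>, so
          \<open>S - M'\<close> is a multiple of \<open>S - M\<close>, as the separation property
          demands.\<close>
        have "sv (mat_coords M') = (\<lambda>i. a * sv ?S i)"
          unfolding ab using P(8,9) by (simp only: mat_coords_linear sv_add sv_scale) (simp add: sv_diff P(8))
        then have "(a - 1) * sv ?S i = 0" for i using fun_cong[of _ _ i] P'(8) by (fastforce simp: algebra_simps)
        then have a: "a = 1" using svS by (metis eq_iff_diff_eq_0 ext mult_eq_0_iff)
        have "?S e - mat_coords M' e = (1 - b) * (?S e - mat_coords M e)" for e
          unfolding ab a by (simp add: mat_coords_linear algebra_simps)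
        then have "mat_coords M' = mat_coords M" using sep SV nz(3) M M' fib_iff by blast
        then show "M = M'" by (simp add: mat_coords_inject)
      qed
      show "(\<lambda>M. cmat.span {M, S}) ` ml_fibre L S = J_lines L \<inter> lines_through S"
      proof (intro equalityI subsetI)
        fix W assume "W \<in> (\<lambda>M. cmat.span {M, S}) ` ml_fibre L S"
        then obtain M where M: "M \<in> ml_fibre L S" "W = cmat.span {M, S}" by blast
        note P = fibre_point[OF M(1)]
        have "W \<in> join_lines" unfolding join_lines_def M(2)
          using line[OF M(1)] P S_in[of M] by blast
        then show "W \<in> J_lines L \<inter> lines_through S"
          using join_lines_J line[OF M(1)] S_in(1) M(2) by (auto simp: lines_through_def)
      next
        fix W assume W: "W \<in> J_lines L \<inter> lines_through S"
        obtain v l where v: "v \<in> W" "plk ?S (mat_coords v) \<in> zariski_closure join_coords"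
          "lin l (mat_coords v) = 1" "lin l ?S = 0" by (rule J_line_through[OF W S0])
        have "\<exists>x\<in>?F. \<exists>c1 c2. x = (\<lambda>e. c1 * ?S e + c2 * mat_coords v e)"
          using \<Theta>X by (intro rr.join_closure[OF C(2) fib(1) nz(1) fib(3) _ join_coords_plk v(2,3,4) k_pos nz(2)]) blast
        then obtain x c1 c2 where x: "x \<in> ?F" "x = (\<lambda>e. c1 * ?S e + c2 * mat_coords v e)" by blast
        define M where "M = mscale c1 S + mscale c2 v"
        have "mat_coords M = x" by (simp add: M_def mat_coords_linear x(2))
        then have M: "M \<in> ml_fibre L S" using x(1) fib_iff by simp
        have lineW: "is_line W" "S \<in> W" using W by (auto simp: lines_through_def)
        have "M \<in> W" unfolding M_def using lineW v(1)
          by (auto simp: is_line_def intro!: cmat.subspace_add cmat.subspace_scale)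
        then have "W = cmat.span {M, S}" by (intro line_eq_span lineW fibre_point[OF M])
        then show "W \<in> (\<lambda>M. cmat.span {M, S}) ` ml_fibre L S" using M by blast
      qed
    qed
    then show ?thesis using fin card by blast
  qed
  then show ?thesis using U
    by (intro exI[of _ "{M\<in>symmat. (C (sv (mat_coords M)) * lin (mat_coords (B 0)) (mat_coords M)) * G (mat_coords M) \<noteq> 0}"] exI[of _ d]) simp
qed

end

theorem theorem2p11:
  fixes L :: "(complex^'n^'n) set"
  assumes "lin_subspace_sym L"
    and "regular_subspace L"
    and "cmat.dim L + 2 \<le> cmat.dim (symmat :: (complex^'n^'n) set)"
  shows "\<exists>U. nonempty_open_in_sym U \<and>
           (\<forall>S\<in>U. finite (J_lines L \<inter> lines_through S) \<and>
                  ml_degree L = card (J_lines L \<inter> lines_through S))"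
proof -
  obtain k B D where "regular_sym_basis L k B D" using regular_sym_basis_exists[OF assms] by blast
  then interpret regular_sym_basis L k B D .
  show ?thesis
  proof (cases dominant_cone)
    case True
    then obtain U d where U: "nonempty_open_in_sym U" and fib: "\<forall>S\<in>U. finite (ml_fibre L S) \<and> card (ml_fibre L S) = d \<and>
      bij_betw (\<lambda>M. cmat.span {M, S}) (ml_fibre L S) (J_lines L \<inter> lines_through S)"
      using dominant_case by blast
    have "ml_degree L = d" using U fib by (intro ml_degree_eqI) auto
    moreover have "finite (J_lines L \<inter> lines_through S) \<and> card (J_lines L \<inter> lines_through S) = d" if "S \<in> U" for S
      using fib that bij_betw_finite bij_betw_same_card by metis
    ultimately show ?thesis using U by auto
  next
    case False
    then obtain U where U: "nonempty_open_in_sym U" and fib: "\<forall>S\<in>U. ml_fibre L S = {} \<and> J_lines L \<inter> lines_through S = {}"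
      using degenerate_case by blast
    have "ml_degree L = 0" using U fib by (intro ml_degree_eqI) auto
    then show ?thesis using U fib by auto
  qed
qed

end
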